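(* Let $A\in\mathcal{C}_n$ satisfy $A_{ii}=1$ for all $i$, and suppose $A$ is irreducible with respect to both $S_+(n)$ and $\mathcal{N}_n$. Let $I_1,\dots,I_m$ be the elements of the minimal support set $\mathcal{I}=\operatorname{Supp}(\mathcal{M}(A))$, ordered by nondecreasing cardinality, and let $m_2$ be the number of them of cardinality 2. Then: (i) $2\le |I_i|\le n-2$ for every $i$; (ii) there do not exist $i,j$ with $I_i\subsetneq I_j$; (iii) for every index set $I\subset\{1,\dots,n\}$, every $l\ge1$ and indices $i,i^1,\dots,i^l,j\in\{1,\dots,m\}$ such that $I\subsetneq I_i$; $I_{i^r}\setminus I=\{k^r\}$ is a single element for $r=1,\dots,l$; $I_{i^r}\cap I\subset I_{i^{r+1}}\cap I$ for $r=1,\dots,l-1$; and $I_j\subset I\cup\{k^1,\dots,k^l\}$, there exists $r\in\{1,\dots,l\}$ with $j=i^r$; (iv) let $G_2(\mathcal{I})$ be the graph with vertex set $\{1,\dots,n\}$ and edge set $\{I_1,\dots,I_{m_2}\}$, and let $G_{>2}(\mathcal{I})$ be the bipartite graph with vertex classes $V=\{1,\dots,n\}$ and $W=\{m_2+1,\dots,m\}$, where $(v,w)\in V\times W$ is an edge iff $v\in I_w$; let $G_{2,1},\dots,G_{2,r}$ be the connected components of $G_2(\mathcal{I})$ that are bipartite. Then there exist edges $(v_1,w_1),\dots,(v_r,w_r)$ of $G_{>2}(\mathcal{I})$ such that $v_j$ is a vertex of $G_{2,j}$ for each $j$ and $w_1,\dots,w_r$ are mutually different; (v) there exist real numbers $\alpha_{ij}=\alpha_{ji}\in[0,1]$,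 $1\le i,j\le n$, with $\alpha_{ii}=1$, such that, setting $B_{ij}=2\alpha_{ij}-1$ and writing $i,j,k$ for pairwise distinct indices: (a) $\alpha_{ij}=0$ whenever $\{i,j\}\in\mathcal{I}$; (b) $\alpha_{ij}>0$ whenever $\{i,j\}\notin\mathcal{I}$; (c) $B_J\in\mathcal{MC}_{|J|}$ for every $J\in\mathcal{I}$; (d) $B_J\in\operatorname{relint}\mathcal{MC}_{|J|}$ whenever $\emptyset\ne J\subsetneq J'$ for some $J'\in\mathcal{I}$; (e) $\alpha_{ij}+\alpha_{ik}+\alpha_{jk}=1$ whenever $\{i,j,k\}\in\mathcal{I}$; (f) $\alpha_{ij}+\alpha_{ik}+\alpha_{jk}>1$ whenever no $J\in\mathcal{I}$ satisfies $J\subset\{i,j,k\}$; (g) $\alpha_{ik}+\alpha_{jk}\ge1$ for all $k$ whenever $\{i,j\}\in\mathcal{I}$; (h) $\sum_{1\le j<k\le5}\alpha_{i_ji_k}\ge4$ for all pairwise distinct $i_1,\dots,i_5\in\{1,\dots,n\}$.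
   Context: $\mathcal{C}_n$ denotes the cone of copositive matrices: real symmetric $n\times n$ matrices $A$ with $x^TAx\ge 0$ for all $x\in\mathbb{R}^n_+$. $S_+(n)$ is the cone of positive semidefinite $n\times n$ matrices and $\mathcal{N}_n$ the cone of entrywise nonnegative symmetric $n\times n$ matrices. For $A\in\mathcal{C}_n$, a zero of $A$ is a nonzero $u\in\mathbb{R}^n_+$ with $u^TAu=0$; $\operatorname{Supp}(u)=\{i:u_i\ne0\}$; a zero $u$ is minimal if there is no zero $v$ with $\operatorname{Supp}(v)\subsetneq\operatorname{Supp}(u)$. $\mathcal{M}(A)$ is the set of minimal zeros and $\operatorname{Supp}(\mathcal{M}(A))=\{\operatorname{Supp}(u):u\in\mathcal{M}(A)\}$ is the minimal support set. For $\mathcal{M}\subset\mathcal{C}_n$, $A$ is irreducible with respect to $\mathcal{M}$ if there do not exist $\gamma>0$ and $M\in\mathcal{M}\setminus\{0\}$ with $A-\gamma M\in\mathcal{C}_n$. For a symmetric matrix $B$ and index set $J$, $B_J=(B_{ij})_{i,j\in J}$. The MAXCUT polytope $\mathcal{MC}_k$ is the convex hull of all matrices $vv^T$ with $v\in\{-1,+1\}^k$; $\operatorname{relint}$ denotes relative interior. *)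

theory Defs
  imports "HOL-Analysis.Analysis"
begin

definition symmetric_mat :: "real^'n^'n \<Rightarrow> bool" where
  "symmetric_mat A \<longleftrightarrow> transpose A = A"

definition nonneg_vec :: "real^'n \<Rightarrow> bool" where
  "nonneg_vec x \<longleftrightarrow> (\<forall>i. x $ i \<ge> 0)"

definition copositive_cone :: "(real^'n^'n) set" where
  "copositive_cone = {A. symmetric_mat A \<and> (\<forall>x. nonneg_vec x \<longrightarrow> x \<bullet> (A *v x) \<ge> 0)}"

definition psd_cone :: "(real^'n^'n) set" where
  "psd_cone = {A. symmetric_mat A \<and> (\<forall>x. x \<bullet> (A *v x) \<ge> 0)}"

definition nonneg_cone :: "(real^'n^'n) set" where
  "nonneg_cone = {A. symmetric_mat A \<and> (\<forall>i j. A $ i $ j \<ge> 0)}"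

definition irreducible_wrt :: "(real^'n^'n) set \<Rightarrow> real^'n^'n \<Rightarrow> bool" where
  "irreducible_wrt M A \<longleftrightarrow>
     \<not> (\<exists>\<gamma>>0. \<exists>B \<in> M - {0}. A - \<gamma> *\<^sub>R B \<in> copositive_cone)"

definition supp :: "real^'n \<Rightarrow> 'n set" where
  "supp u = {i. u $ i \<noteq> 0}"

definition is_zero :: "real^'n^'n \<Rightarrow> real^'n \<Rightarrow> bool" where
  "is_zero A u \<longleftrightarrow> nonneg_vec u \<and> u \<noteq> 0 \<and> u \<bullet> (A *v u) = 0"

definition minimal_zero :: "real^'n^'n \<Rightarrow> real^'n \<Rightarrow> bool" where
  "minimal_zero A u \<longleftrightarrow> is_zero A u \<and> \<not> (\<exists>v. is_zero A v \<and> supp v \<subset> supp u)"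

definition min_supp_set :: "real^'n^'n \<Rightarrow> 'n set set" where
  "min_supp_set A = {supp u | u. minimal_zero A u}"

text \<open>Principal submatrix B_J, embedded into the n x n matrices by zero padding
  (a linear isometric embedding of the |J| x |J| matrices).\<close>
definition submat :: "'n set \<Rightarrow> real^'n^'n \<Rightarrow> real^'n^'n" where
  "submat J B = (\<chi> i j. if i \<in> J \<and> j \<in> J then B $ i $ j else 0)"

definition maxcut :: "'n set \<Rightarrow> (real^'n^'n) set" where
  "maxcut J = convex hull {submat J (\<chi> i j. v i * v j) | v :: 'n \<Rightarrow> real.
                              \<forall>i. v i = 1 \<or> v i = -1}"

definition edge2 :: "'n set set \<Rightarrow> 'n \<Rightarrow> 'n \<Rightarrow> bool" where
  "edge2 \<I> u v \<longleftrightarrow> u \<noteq> v \<and> {u, v} \<in> \<I>"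

definition components2 :: "'n set set \<Rightarrow> 'n set set" where
  "components2 \<I> = range (\<lambda>v. {u. (edge2 \<I>)\<^sup>*\<^sup>* v u})"

definition bipartite_comp :: "'n set set \<Rightarrow> 'n set \<Rightarrow> bool" where
  "bipartite_comp \<I> C \<longleftrightarrow>
     (\<exists>S. \<forall>u\<in>C. \<forall>v\<in>C. edge2 \<I> u v \<longrightarrow> (u \<in> S \<longleftrightarrow> v \<notin> S))"

end

theory Submission
  imports Defs
begin

text \<open>
  Irreducibility with respect to the nonnegative matrices forces all entries into \<open>[-1, 1]\<close>, so one may
  put \<open>\<alpha>\<^sub>i\<^sub>j = arccos (- A\<^sub>i\<^sub>j) / \<pi>\<close>. On a minimal support the matrix is positive semidefinite, and
  positive definite on its proper subsets. There \<open>A\<close> is a Gram matrix of unit vectors, and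
  \<open>2 \<alpha>\<^sub>i\<^sub>j - 1\<close> is the expected product of the signs that a random hyperplane gives to the vectors
  \<open>i\<close> and \<open>j\<close>; this yields the statements about the cut polytope. Irreducibility with respect to the
  positive semidefinite matrices makes the minimal zeros span the space, and Hall's theorem then
  gives (iv). A copositive matrix with a zero of support size at least \<open>n - 1\<close> dominates a positive
  semidefinite matrix with the same diagonal, which gives the bound in (i), and also (v)(h) by
  deforming a hypothetical counterexample until such a zero appears.
\<close>

subsection \<open>Zeros of copositive matrices\<close>

text \<open>The random hyperplane identity needs Gram vectors, hence positive semidefiniteness,
  while copositivity grants that only on supports of zeros. The gap can be bridged for one further
  index: if \<open>A\<close> is a Gram matrix of vectors \<open>X i\<close> on \<open>J\<close> and
  \<open>k\<close> lies outside, then a separation argument fed by copositivity yields a vector of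
  norm at most 1 whose product with each \<open>X i\<close> is at most \<open>A $ k $ i\<close>, and
  one more coordinate restores unit length. Lowering the entries only lowers the angles
  \<open>arccos (- A $ i $ j)\<close>, so lower bounds on angle sums pass from the Gram matrix back
  to \<open>A\<close>. Five arbitrary indices are out of reach of this argument as long as no zero
  has four positive entries among them; hence the deformation, along which the lower bounds on angle
  sums of triples rule out zeros with smaller support.\<close>

lemma quad_form_sum:
  fixes A :: "real^'n^'n"
  shows "x \<bullet> (A *v y) = (\<Sum>i\<in>UNIV. \<Sum>j\<in>UNIV. A $ i $ j * x $ i * y $ j)"
  by (simp add: inner_vec_def matrix_vector_mult_def sum_distrib_left mult_ac)

lemma symmetric_mat_inner:
  assumes "symmetric_mat A"
  shows "x \<bullet> (A *v y) = y \<bullet> (A *v x)"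
proof -
  have "x \<bullet> (A *v y) = (x v* A) \<bullet> y"
    by (simp add: dot_lmul_matrix)
  also have "x v* A = A *v x"
    using assms by (metis symmetric_mat_def transpose_matrix_vector)
  finally show ?thesis
    by (simp add: inner_commute)
qed

lemma symmetric_mat_iff: "symmetric_mat A \<longleftrightarrow> (\<forall>i j. A $ i $ j = A $ j $ i)"
  by (auto simp: symmetric_mat_def transpose_def vec_eq_iff)

lemma quad_form_add_scaleR:
  assumes "symmetric_mat A"
  shows "(x + t *\<^sub>R y) \<bullet> (A *v (x + t *\<^sub>R y)) =
         x \<bullet> (A *v x) + 2 * t * (y \<bullet> (A *v x)) + t\<^sup>2 * (y \<bullet> (A *v y))"
  using symmetric_mat_inner[OF assms, of x y]
  by (simp add: matrix_vector_right_distrib matrix_vector_mult_scaleR inner_add_left inner_add_right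
      power2_eq_square algebra_simps)

lemma copositiveD:
  assumes "A \<in> copositive_cone"
  shows "symmetric_mat A" and "nonneg_vec x \<Longrightarrow> 0 \<le> x \<bullet> (A *v x)"
  using assms by (auto simp: copositive_cone_def)

text \<open>Near 0 the linear term dominates. This extracts first-order conditions from inequalities
  that are quadratic in a step length.\<close>

lemma nonneg_small_linear_term:
  fixes b c :: real
  assumes "\<And>t. 0 < t \<Longrightarrow> t \<le> e \<Longrightarrow> 0 \<le> b * t + c * t\<^sup>2" and "0 < e"
  shows "0 \<le> b"
proof (rule ccontr)
  assume "\<not> 0 \<le> b"
  \<comment> \<open>The second bound keeps \<open>c * t\<close> at most \<open>- b / 2\<close>; the
    added 1 keeps the denominator positive for \<open>c = 0\<close>.\<close>
  define t where "t = min e (- b / (2 * (\<bar>c\<bar> + 1)))"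
  have t: "0 < t" "t \<le> e"
    using \<open>\<not> 0 \<le> b\<close> \<open>0 < e\<close> by (auto simp: t_def intro!: divide_neg_pos)
  have "c * t \<le> (\<bar>c\<bar> + 1) * t"
    using t by (intro mult_right_mono) auto
  also have "\<dots> \<le> (\<bar>c\<bar> + 1) * (- b / (2 * (\<bar>c\<bar> + 1)))"
    by (intro mult_left_mono) (auto simp: t_def)
  also have "\<dots> = - b / 2"
    by (simp add: field_simps)
  finally have "b + c * t < 0"
    using \<open>\<not> 0 \<le> b\<close> by simp
  then have "t * (b + c * t) < 0"
    using t by (simp add: mult_pos_neg)
  then show False
    using assms(1)[OF t] by (simp add: algebra_simps power2_eq_square)
qed

text \<open>A zero minimises the form over the orthant, \<open>axis i 1\<close> is an admissible
  direction there, and \<open>2 * (A *v u) $ i\<close> is the derivative along it.\<close>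

lemma zero_image_nonneg:
  assumes cop: "A \<in> copositive_cone" and u: "is_zero A u"
  shows "0 \<le> (A *v u) $ i"
proof -
  have "0 \<le> 2 * (A *v u) $ i * t + (axis i 1 \<bullet> (A *v axis i 1)) * t\<^sup>2" if "0 < t" for t
  proof -
    have "nonneg_vec (u + t *\<^sub>R axis i 1)"
      using u that by (auto simp: is_zero_def nonneg_vec_def axis_def)
    from copositiveD(2)[OF cop this] show ?thesis
      using u unfolding quad_form_add_scaleR[OF copositiveD(1)[OF cop]]
      by (simp add: is_zero_def inner_axis' algebra_simps)
  qed
  from nonneg_small_linear_term[OF this, of 1] show ?thesis
    by simp
qed

text \<open>Complementary slackness: \<open>u \<bullet> (A *v u) = 0\<close> is a sum of nonnegative
  products \<open>u $ j * (A *v u) $ j\<close>, so each of them vanishes.\<close>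

lemma zero_image_eq_0:
  assumes cop: "A \<in> copositive_cone" and u: "is_zero A u" and i: "i \<in> supp u"
  shows "(A *v u) $ i = 0"
proof -
  have "(\<Sum>j\<in>UNIV. u $ j * (A *v u) $ j) = 0"
    using u by (simp add: is_zero_def inner_vec_def)
  moreover have "0 \<le> u $ j * (A *v u) $ j" for j
    using u zero_image_nonneg[OF cop u] by (simp add: is_zero_def nonneg_vec_def)
  ultimately have "u $ i * (A *v u) $ i = 0"
    by (simp add: sum_nonneg_eq_0_iff)
  then show ?thesis
    using i by (simp add: supp_def)
qed

lemma inner_zero_image_eq_0:
  assumes "A \<in> copositive_cone" "is_zero A u" "supp x \<subseteq> supp u"
  shows "x \<bullet> (A *v u) = 0"
  unfolding inner_vec_def
proof (intro sum.neutral ballI)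
  fix i
  show "x $ i \<bullet> (A *v u) $ i = 0"
    using assms zero_image_eq_0[OF assms(1,2), of i] by (cases "i \<in> supp u") (auto simp: supp_def)
qed

lemma inner_zero_image_nonneg:
  assumes "A \<in> copositive_cone" "is_zero A u" "\<And>i. i \<notin> supp u \<Longrightarrow> 0 \<le> x $ i"
  shows "0 \<le> x \<bullet> (A *v u)"
  unfolding inner_vec_def
proof (intro sum_nonneg)
  fix i
  show "0 \<le> x $ i \<bullet> (A *v u) $ i"
    using assms zero_image_eq_0[OF assms(1,2), of i] zero_image_nonneg[OF assms(1,2), of i]
    by (cases "i \<in> supp u") auto
qed

lemma is_zero_pos: "is_zero A u \<Longrightarrow> i \<in> supp u \<Longrightarrow> 0 < u $ i"
  by (auto simp: is_zero_def nonneg_vec_def supp_def order_less_le)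

lemma supp_empty_iff: "supp u = {} \<longleftrightarrow> u = 0"
  by (auto simp: supp_def vec_eq_iff)

lemma supp_add_scaleR: "supp (x + c *\<^sub>R y) \<subseteq> supp x \<union> supp y"
  by (auto simp: supp_def)

text \<open>The zero is positive on its whole support, so a small multiple of \<open>x\<close> can
  be added without leaving the orthant. Constant and linear term vanish there, and only
  \<open>t\<^sup>2 * (x \<bullet> (A *v x))\<close> remains.\<close>

lemma zero_support_psd:
  assumes cop: "A \<in> copositive_cone" and u: "is_zero A u" and x: "supp x \<subseteq> supp u"
  shows "0 \<le> x \<bullet> (A *v x)"
proof (cases "x = 0")
  case False
  define t where "t = Min ((\<lambda>i. u $ i / \<bar>x $ i\<bar>) ` supp x)"
  have ne: "supp x \<noteq> {}"
    using False supp_empty_iff by blast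
  have t: "0 < t"
    unfolding t_def using ne x is_zero_pos[OF u]
    by (subst Min_gr_iff) (auto simp: supp_def divide_simps)
  have "nonneg_vec (u + t *\<^sub>R x)"
    unfolding nonneg_vec_def
  proof
    fix i
    show "0 \<le> (u + t *\<^sub>R x) $ i"
    proof (cases "i \<in> supp x")
      case True
      then have "t \<le> u $ i / \<bar>x $ i\<bar>"
        unfolding t_def by (intro Min_le) auto
      then have "t * \<bar>x $ i\<bar> \<le> u $ i"
        using True by (simp add: supp_def field_simps)
      moreover have "- (t * \<bar>x $ i\<bar>) \<le> t * x $ i"
        using t by (metis abs_ge_minus_self abs_mult abs_of_pos minus_le_iff)
      ultimately show ?thesis by simp
    next
      case False
      then show ?thesis
        using u by (auto simp: supp_def is_zero_def nonneg_vec_def)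
    qed
  qed
  from copositiveD(2)[OF cop this] have "0 \<le> t\<^sup>2 * (x \<bullet> (A *v x))"
    using u inner_zero_image_eq_0[OF cop u x]
    unfolding quad_form_add_scaleR[OF copositiveD(1)[OF cop]] by (simp add: is_zero_def)
  then show ?thesis
    using t by (simp add: zero_le_mult_iff)
qed auto

text \<open>Otherwise \<open>u\<close> could be moved along \<open>x\<close> or \<open>- x\<close>
  at no cost until a first coordinate vanishes. Strictness of the inclusion leaves some coordinate
  of \<open>u\<close> untouched, so the end point is not the origin and is a zero of smaller
  support.\<close>

lemma minimal_zero_support_definite:
  assumes cop: "A \<in> copositive_cone" and min: "minimal_zero A u"
    and x: "supp x \<subset> supp u" and le: "x \<bullet> (A *v x) \<le> 0"
  shows "x = 0"
proof (rule ccontr)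
  assume "x \<noteq> 0"
  have u: "is_zero A u"
    using min by (simp add: minimal_zero_def)
  obtain y where y: "supp y = supp x" "y \<bullet> (A *v y) \<le> 0" "\<exists>i. 0 < y $ i"
  proof (cases "\<exists>i. 0 < x $ i")
    case True
    then show ?thesis using that[of x] le by simp
  next
    case False
    obtain i where "x $ i \<noteq> 0"
      using \<open>x \<noteq> 0\<close> by (auto simp: vec_eq_iff)
    then have "0 < (- x) $ i"
      using False[simplified, rule_format, of i] by simp
    moreover have "supp (- x) = supp x"
      by (simp add: supp_def)
    moreover have "(- x) \<bullet> (A *v (- x)) = x \<bullet> (A *v x)"
      by (simp add: quad_form_sum)
    ultimately show ?thesis
      using that[of "- x"] le by metis
  qed
  have yu: "supp y \<subset> supp u"
    using x y by simp
  have qy: "y \<bullet> (A *v y) = 0"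
    using y(2) zero_support_psd[OF cop u, of y] yu by force
  define P where "P = {i. 0 < y $ i}"
  \<comment> \<open>The largest step that keeps the moved vector nonnegative; it is attained at
    \<open>k\<close>, which thereby leaves the support.\<close>
  define t where "t = Min ((\<lambda>i. u $ i / y $ i) ` P)"
  have P: "P \<noteq> {}" "P \<subseteq> supp y"
    using y(3) by (auto simp: P_def supp_def)
  have "t \<in> (\<lambda>i. u $ i / y $ i) ` P"
    unfolding t_def using P by (intro Min_in) auto
  then obtain k where k: "k \<in> P" "t = u $ k / y $ k"
    by blast
  define v where "v = u + (- t) *\<^sub>R y"
  have t: "0 < t"
    using k P yu is_zero_pos[OF u, of k] by (auto simp: P_def)
  have "is_zero A v"
    unfolding is_zero_def
  proof (intro conjI)
    show "nonneg_vec v"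
      unfolding nonneg_vec_def
    proof
      fix i
      have ui: "0 \<le> u $ i"
        using u by (simp add: is_zero_def nonneg_vec_def)
      show "0 \<le> v $ i"
      proof (cases "i \<in> P")
        case True
        then have "t \<le> u $ i / y $ i"
          unfolding t_def by (intro Min_le) auto
        then show ?thesis
          using True by (simp add: v_def P_def field_simps)
      next
        case False
        then have "t * y $ i \<le> 0"
          using t by (simp add: P_def mult_nonneg_nonpos)
        then show ?thesis
          using ui by (simp add: v_def)
      qed
    qed
    obtain i where "i \<in> supp u" "i \<notin> supp y"
      using yu by auto
    then have "v $ i \<noteq> 0"
      by (simp add: v_def supp_def)
    then show "v \<noteq> 0"
      by auto
    show "v \<bullet> (A *v v) = 0"
      unfolding v_def using u qy inner_zero_image_eq_0[OF cop u, of y] yu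
      unfolding quad_form_add_scaleR[OF copositiveD(1)[OF cop]] by (simp add: is_zero_def)
  qed
  moreover have "supp v \<subset> supp u"
  proof
    show "supp v \<subseteq> supp u"
      using yu by (auto simp: v_def supp_def)
    have "k \<in> supp u" "k \<notin> supp v"
      using k P yu by (auto simp: v_def supp_def P_def)
    then show "supp v \<noteq> supp u" by auto
  qed
  ultimately show False
    using min by (auto simp: minimal_zero_def)
qed

text \<open>Cancelling one common coordinate leaves a difference of properly smaller support on
  which the form is nonpositive, and definiteness there makes it vanish.\<close>

lemma minimal_zero_unique:
  assumes cop: "A \<in> copositive_cone" and u: "minimal_zero A u" and v: "minimal_zero A v"
    and eq: "supp u = supp v"
  shows "\<exists>c. v = c *\<^sub>R u"
proof -
  have zu: "is_zero A u" and zv: "is_zero A v"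
    using u v by (auto simp: minimal_zero_def)
  then have "u \<noteq> 0"
    by (simp add: is_zero_def)
  then obtain i where i: "i \<in> supp u"
    using supp_empty_iff by blast
  define c where "c = v $ i / u $ i"
  define x where "x = v + (- c) *\<^sub>R u"
  have "supp x \<subset> supp u"
  proof
    show "supp x \<subseteq> supp u"
      unfolding x_def using supp_add_scaleR[of v "- c" u] eq by blast
    have "i \<notin> supp x"
      using i by (simp add: x_def c_def supp_def)
    then show "supp x \<noteq> supp u"
      using i by auto
  qed
  moreover have "x \<bullet> (A *v x) \<le> 0"
    unfolding x_def using zu zv inner_zero_image_eq_0[OF cop zv, of u] eq
    unfolding quad_form_add_scaleR[OF copositiveD(1)[OF cop]] by (simp add: is_zero_def)
  ultimately have "x = 0"
    by (rule minimal_zero_support_definite[OF cop u])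
  then show ?thesis
    by (auto simp: x_def)
qed

lemma ex_minimal_zero_subset:
  assumes "is_zero A v"
  shows "\<exists>u. minimal_zero A u \<and> supp u \<subseteq> supp v"
  using assms
proof (induction "card (supp v)" arbitrary: v rule: less_induct)
  case less
  show ?case
  proof (cases "minimal_zero A v")
    case False
    then obtain w where w: "is_zero A w" "supp w \<subset> supp v"
      using less.prems by (auto simp: minimal_zero_def)
    then have "card (supp w) < card (supp v)"
      by (simp add: psubset_card_mono)
    from less.hyps[OF this w(1)] show ?thesis
      using w(2) by blast
  qed auto
qed

lemma min_supp_set_no_psubset: "I \<in> min_supp_set A \<Longrightarrow> J \<in> min_supp_set A \<Longrightarrow> \<not> I \<subset> J"
  by (auto simp: min_supp_set_def minimal_zero_def)

text \<open>The chain condition makes the greedy elimination of the entries \<open>k r\<close> from a zero of \<open>Ij\<close>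
  never increase the quadratic form, so that what remains is supported in \<open>I\<close> and must vanish.\<close>
lemma min_supp_set_chain:
  fixes f :: "nat \<Rightarrow> 'n::finite set" and k :: "nat \<Rightarrow> 'n"
  assumes cop: "A \<in> copositive_cone"
    and Ii: "Ii \<in> min_supp_set A" and Ij: "Ij \<in> min_supp_set A" and I: "I \<subset> Ii"
    and f: "\<And>r. r \<in> {1..l} \<Longrightarrow> f r \<in> min_supp_set A \<and> f r - I = {k r}"
    and chain: "\<And>r. r \<in> {1..<l} \<Longrightarrow> f r \<inter> I \<subseteq> f (Suc r) \<inter> I"
    and sub: "Ij \<subseteq> I \<union> k ` {1..l}"
  shows "\<exists>r\<in>{1..l}. Ij = f r"
proof -
  obtain z where z: "minimal_zero A z" "Ij = supp z"
    using Ij by (auto simp: min_supp_set_def)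
  then have zz: "is_zero A z"
    by (simp add: minimal_zero_def)
  obtain ui where ui: "minimal_zero A ui" "Ii = supp ui"
    using Ii by (auto simp: min_supp_set_def)
  have "\<forall>r\<in>{1..l}. \<exists>u. minimal_zero A u \<and> f r = supp u"
    using f unfolding min_supp_set_def by blast
  then obtain u where u: "\<And>r. r \<in> {1..l} \<Longrightarrow> minimal_zero A (u r) \<and> f r = supp (u r)"
    by metis
  have mono: "f r \<inter> I \<subseteq> f s \<inter> I" if "1 \<le> r" "r \<le> s" "s \<le> l" for r s
    using that(2,1,3)
  proof (induction s rule: dec_induct)
    case (step s)
    then show ?case using chain[of s] by auto
  qed auto
  \<comment> \<open>Besides the sign conditions, the invariant records that \<open>z - x\<close> is
    nonnegative and, once something has been subtracted, positive on a whole \<open>f r\<close>.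
    This is what finally places some \<open>f r\<close> inside \<open>Ij\<close>.\<close>
  have "\<exists>x. x \<bullet> (A *v x) \<le> 0 \<and> supp x \<subseteq> I \<union> k ` {1..l} \<and> (\<forall>r\<in>{1..s}. x $ k r = 0)
      \<and> (\<forall>i. i \<notin> I \<longrightarrow> 0 \<le> x $ i) \<and> (\<forall>i\<in>I. (\<forall>r\<in>{1..s}. i \<notin> f r) \<longrightarrow> 0 \<le> x $ i)
      \<and> nonneg_vec (z - x) \<and> (x = z \<or> (\<exists>r\<in>{1..s}. f r \<subseteq> supp (z - x)))" if "s \<le> l" for s
    using that
  proof (induction s)
    case 0
    show ?case
      using zz sub z(2) unfolding is_zero_def nonneg_vec_def by (intro exI[of _ z]) simp
  next
    case (Suc s)
    then obtain x where x: "x \<bullet> (A *v x) \<le> 0" "supp x \<subseteq> I \<union> k ` {1..l}"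
      "\<And>r. r\<in>{1..s} \<Longrightarrow> x $ k r = 0" "\<And>i. i \<notin> I \<Longrightarrow> 0 \<le> x $ i"
      "\<And>i. i\<in>I \<Longrightarrow> (\<forall>r\<in>{1..s}. i \<notin> f r) \<Longrightarrow> 0 \<le> x $ i" "nonneg_vec (z - x)"
      "x = z \<or> (\<exists>r\<in>{1..s}. f r \<subseteq> supp (z - x))"
      using Suc_leD by blast
    let ?t = "Suc s"
    have tl: "?t \<in> {1..l}"
      using Suc.prems by auto
    define w where "w = u ?t"
    have w: "minimal_zero A w" "f ?t = supp w" and zw: "is_zero A w"
      using u[OF tl] by (auto simp: w_def minimal_zero_def)
    have kI: "k ?t \<in> supp w" "k ?t \<notin> I" and wI: "supp w \<subseteq> insert (k ?t) I"
      using f[OF tl] w(2) by auto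
    have wk: "0 < w $ k ?t"
      using is_zero_pos[OF zw kI(1)] .
    define c where "c = x $ k ?t / w $ k ?t"
    have c: "0 \<le> c"
      using x(4)[OF kI(2)] wk by (simp add: c_def)
    define y where "y = x + (- c) *\<^sub>R w"
    \<comment> \<open>\<open>x\<close> can be negative only at indices of \<open>I\<close> that
      belong to an earlier \<open>f r\<close>. The chain condition puts these into
      \<open>supp w\<close>, where \<open>A *v w\<close> vanishes.\<close>
    have "0 \<le> x \<bullet> (A *v w)"
    proof (rule inner_zero_image_nonneg[OF cop zw])
      fix i assume i: "i \<notin> supp w"
      show "0 \<le> x $ i"
      proof (cases "i \<in> I")
        case True
        have "i \<notin> f r" if "r \<in> {1..s}" for r
          using mono[of r ?t] that tl i w(2) True by auto
        then show ?thesis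
          using x(5) True by blast
      qed (use x in auto)
    qed
    then have "0 \<le> w \<bullet> (A *v x)"
      using symmetric_mat_inner[OF copositiveD(1)[OF cop]] by metis
    then have "x \<bullet> (A *v x) - 2 * c * (w \<bullet> (A *v x)) \<le> 0"
      using x(1) c mult_nonneg_nonneg[of "2 * c" "w \<bullet> (A *v x)"] by linarith
    then have "y \<bullet> (A *v y) \<le> 0"
      unfolding y_def quad_form_add_scaleR[OF copositiveD(1)[OF cop]]
      using zw by (simp add: is_zero_def)
    moreover have "supp y \<subseteq> I \<union> k ` {1..l}"
      unfolding y_def using supp_add_scaleR[of x "- c" w] x(2) wI tl by blast
    moreover have "y $ k r = 0" if "r \<in> {1..?t}" for r
    proof (cases "k r = k ?t")
      case True
      then show ?thesis
        using wk by (simp add: y_def c_def)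
    next
      case False
      then have "r \<in> {1..s}"
        using that le_Suc_eq by auto
      moreover have "k r \<notin> I"
        using f[of r] that tl by auto
      then have "k r \<notin> supp w"
        using False wI by auto
      ultimately show ?thesis
        using x(3) by (simp add: y_def supp_def)
    qed
    moreover have "0 \<le> y $ i" if "i \<notin> I" for i
    proof (cases "i = k ?t")
      case True
      then show ?thesis
        using wk by (simp add: y_def c_def)
    next
      case False
      then have "i \<notin> supp w"
        using that wI by auto
      then show ?thesis
        using x(4)[OF that] by (simp add: y_def supp_def)
    qed
    moreover have "0 \<le> y $ i" if "i \<in> I" "\<forall>r\<in>{1..?t}. i \<notin> f r" for i
    proof -
      have "i \<notin> supp w"
        using that w by auto
      moreover have "0 \<le> x $ i"
        using that by (intro x(5)) auto
      ultimately show ?thesis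
        by (simp add: y_def supp_def)
    qed
    moreover have zy: "nonneg_vec (z - y)"
      unfolding nonneg_vec_def
    proof
      fix i
      have "0 \<le> (z $ i - x $ i) + c * w $ i"
        using x(6) c zw by (intro add_nonneg_nonneg mult_nonneg_nonneg)
          (auto simp: nonneg_vec_def is_zero_def)
      then show "0 \<le> (z - y) $ i"
        by (simp add: y_def)
    qed
    moreover have "y = z \<or> (\<exists>r\<in>{1..?t}. f r \<subseteq> supp (z - y))"
    proof (cases "c = 0")
      case True
      then have "y = x" by (simp add: y_def)
      then show ?thesis using x(7) by fastforce
    next
      case False
      then have "0 < c" using c by simp
      have "f ?t \<subseteq> supp (z - y)"
      proof
        fix i assume "i \<in> f ?t"
        then have "0 < w $ i"
          using w is_zero_pos[OF zw] by auto
        then have "0 < c * w $ i"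
          using \<open>0 < c\<close> by simp
        moreover have "0 \<le> z $ i - x $ i"
          using x(6) by (simp add: nonneg_vec_def)
        ultimately show "i \<in> supp (z - y)"
          by (simp add: supp_def y_def)
      qed
      then show ?thesis
        using tl by auto
    qed
    ultimately show ?case by (intro exI[of _ y]) blast
  qed
  from this[of l] obtain x where x: "x \<bullet> (A *v x) \<le> 0" "supp x \<subseteq> I \<union> k ` {1..l}"
      "\<forall>r\<in>{1..l}. x $ k r = 0" "x = z \<or> (\<exists>r\<in>{1..l}. f r \<subseteq> supp (z - x))"
    by blast
  have "supp x \<subseteq> I"
    using x(2,3) by (auto simp: supp_def)
  then have "x = 0"
    using minimal_zero_support_definite[OF cop ui(1) _ x(1)] I ui(2) by blast
  \<comment> \<open>For \<open>x = 0\<close> the alternative \<open>x = z\<close> contradicts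
    \<open>z \<noteq> 0\<close>, so some \<open>f r\<close> lies in \<open>supp z\<close>.\<close>
  then obtain r where "r \<in> {1..l}" "f r \<subseteq> Ij"
    using x(4) zz z(2) by (auto simp: is_zero_def)
  then show ?thesis
    using min_supp_set_no_psubset[OF _ Ij, of "f r"] f by blast
qed

subsection \<open>Irreducibility\<close>

lemma nonneg_cone_subset_copositive: "nonneg_cone \<subseteq> copositive_cone"
  by (auto simp: nonneg_cone_def copositive_cone_def quad_form_sum nonneg_vec_def
      intro!: sum_nonneg mult_nonneg_nonneg)

lemma irreducible_not_psd_plus_nonneg:
  assumes irr: "irreducible_wrt psd_cone A"
    and P: "P \<in> psd_cone" "\<forall>i j. P $ i $ j \<le> A $ i $ j" "symmetric_mat A"
  shows "P = 0"
proof (rule ccontr)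
  assume "P \<noteq> 0"
  have "A - 1 *\<^sub>R P \<in> nonneg_cone"
    using P by (auto simp: nonneg_cone_def psd_cone_def symmetric_mat_iff)
  then have "A - 1 *\<^sub>R P \<in> copositive_cone"
    using nonneg_cone_subset_copositive by blast
  then show False
    using irr P \<open>P \<noteq> 0\<close> unfolding irreducible_wrt_def by (metis DiffI singletonD zero_less_one)
qed

lemma copositive_entry_ge:
  assumes cop: "A \<in> copositive_cone" and diag: "\<forall>i. A $ i $ i = 1"
  shows "- 1 \<le> A $ i $ j"
proof (cases "i = j")
  case False
  let ?x = "axis i 1 + 1 *\<^sub>R axis j (1::real)"
  have "nonneg_vec ?x"
    by (auto simp: nonneg_vec_def axis_def)
  then have "0 \<le> ?x \<bullet> (A *v ?x)"
    using copositiveD(2)[OF cop] by blast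
  also have "\<dots> = 2 + 2 * A $ i $ j"
    unfolding quad_form_add_scaleR[OF copositiveD(1)[OF cop]]
    using diag copositiveD(1)[OF cop]
    by (simp add: inner_axis' matrix_vector_mult_basis column_def symmetric_mat_iff)
  finally show ?thesis by simp
qed (use diag in auto)

text \<open>If \<open>A $ i $ j = 1\<close>, then the quadratic form is affine along \<open>e\<^sub>i - e\<^sub>j\<close>; hence copositivity
  only has to be checked where one of the two coordinates vanishes.\<close>
lemma irreducible_entry_le:
  fixes A :: "real^'n^'n"
  assumes cop: "A \<in> copositive_cone" and diag: "\<forall>i. A $ i $ i = 1"
    and irr: "irreducible_wrt nonneg_cone A"
  shows "A $ i $ j \<le> 1"
proof (rule ccontr)
  assume gt: "\<not> A $ i $ j \<le> 1"
  then have ij: "i \<noteq> j"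
    using diag by auto
  define E :: "real^'n^'n" where "E = (\<chi> a b. if {a, b} = {i, j} then 1 else 0)"
  define g where "g = A $ i $ j - 1"
  \<comment> \<open>\<open>g\<close> is the excess over 1, so exactly the entries
    \<open>(i, j)\<close> and \<open>(j, i)\<close> are lowered, to the value 1.\<close>
  define A' where "A' = A - g *\<^sub>R E"
  have symA: "symmetric_mat A"
    by (rule copositiveD[OF cop])
  have symE: "symmetric_mat E"
    by (auto simp: symmetric_mat_iff E_def insert_commute)
  have symA': "symmetric_mat A'"
    using symA symE by (auto simp: symmetric_mat_iff A'_def)
  have A'ij: "A' $ i $ j = 1" "A' $ j $ i = 1" "A' $ i $ i = 1" "A' $ j $ j = 1"
    using ij diag symA by (auto simp: A'_def E_def g_def symmetric_mat_iff doubleton_eq_iff)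
  have E: "E \<in> nonneg_cone"
    using symE by (auto simp: nonneg_cone_def E_def)
  have "E $ i $ j = 1"
    by (simp add: E_def)
  then have "E \<noteq> 0"
    by auto
  have edge: "0 \<le> y \<bullet> (A' *v y)" if "nonneg_vec y" "y $ i = 0 \<or> y $ j = 0" for y
  proof -
    have "A' $ a $ b * y $ a * y $ b = A $ a $ b * y $ a * y $ b" for a b
      using that(2) ij by (auto simp: A'_def E_def doubleton_eq_iff)
    then have "y \<bullet> (A' *v y) = y \<bullet> (A *v y)"
      unfolding quad_form_sum by (intro sum.cong refl)
    then show ?thesis
      using copositiveD(2)[OF cop that(1)] by simp
  qed
  have "A' \<in> copositive_cone"
    unfolding copositive_cone_def
  proof (intro CollectI conjI symA' allI impI)
    fix x :: "real^'n" assume x: "nonneg_vec x"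
    define d :: "real^'n" where "d = axis i 1 - axis j 1"
    have dAd: "d \<bullet> (A' *v d) = 0"
      using A'ij by (simp add: d_def inner_diff_left inner_diff_right matrix_vector_mult_diff_distrib
          inner_axis' matrix_vector_mult_basis column_def)
    have q: "(x + s *\<^sub>R d) \<bullet> (A' *v (x + s *\<^sub>R d)) = x \<bullet> (A' *v x) + 2 * s * (d \<bullet> (A' *v x))" for s
      unfolding quad_form_add_scaleR[OF symA'] using dAd by simp
    have xi: "0 \<le> x $ i" and xj: "0 \<le> x $ j"
      using x by (auto simp: nonneg_vec_def)
    show "0 \<le> x \<bullet> (A' *v x)"
    proof (cases "x $ i = 0 \<or> x $ j = 0")
      case True
      then show ?thesis using edge x by blast
    next
      case False
      then have pos: "0 < x $ i" "0 < x $ j"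
        using xi xj by auto
      have n: "nonneg_vec (x + s *\<^sub>R d)" if "s = x $ j \<or> s = - (x $ i)" for s
        unfolding nonneg_vec_def
      proof
        fix a
        have "0 \<le> x $ a"
          using x by (simp add: nonneg_vec_def)
        then show "0 \<le> (x + s *\<^sub>R d) $ a"
          using xi xj ij that by (cases "a = i"; cases "a = j") (auto simp: d_def axis_def)
      qed
      have 1: "0 \<le> x \<bullet> (A' *v x) + 2 * (x $ j) * (d \<bullet> (A' *v x))"
        unfolding q[symmetric]
        by (intro edge n) (use ij in \<open>auto simp: d_def axis_def\<close>)
      have 2: "0 \<le> x \<bullet> (A' *v x) + 2 * (- (x $ i)) * (d \<bullet> (A' *v x))"
        unfolding q[symmetric]
        by (intro edge n) (use ij in \<open>auto simp: d_def axis_def\<close>)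
      \<comment> \<open>The steps \<open>x $ j\<close> and \<open>- (x $ i)\<close> along
        \<open>d\<close> clear the coordinates \<open>j\<close> and \<open>i\<close>. Weighting the
        two values by \<open>x $ i\<close> and \<open>x $ j\<close> cancels the linear
        terms.\<close>
      have "0 \<le> x $ i * (x \<bullet> (A' *v x) + 2 * (x $ j) * (d \<bullet> (A' *v x)))
             + x $ j * (x \<bullet> (A' *v x) + 2 * (- (x $ i)) * (d \<bullet> (A' *v x)))"
        by (rule add_nonneg_nonneg[OF mult_nonneg_nonneg[OF xi 1] mult_nonneg_nonneg[OF xj 2]])
      also have "\<dots> = (x $ i + x $ j) * (x \<bullet> (A' *v x))"
        by (simp add: algebra_simps)
      finally show ?thesis
        using pos by (simp add: zero_le_mult_iff)
    qed
  qed
  moreover have "0 < g"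
    using gt by (simp add: g_def)
  ultimately show False
    using irr E \<open>E \<noteq> 0\<close> unfolding irreducible_wrt_def A'_def by blast
qed

text \<open>Subtracting a suitable multiple of a minimal zero moves a nonnegative vector to a smaller face
  without changing its product with \<open>x\<close>, so only the faces without zeros remain.\<close>
lemma quad_form_ge_inner_square:
  fixes A :: "real^'n^'n"
  assumes cop: "A \<in> copositive_cone" and orth: "\<And>u. minimal_zero A u \<Longrightarrow> x \<bullet> u = 0"
  shows "\<exists>d>0. \<forall>y. nonneg_vec y \<longrightarrow> supp y \<subseteq> J \<longrightarrow> d * (x \<bullet> y)\<^sup>2 \<le> y \<bullet> (A *v y)"
proof (induction "card J" arbitrary: J rule: less_induct)
  case less
  show ?case
  proof (cases "\<exists>u. minimal_zero A u \<and> supp u \<subseteq> J")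
    case True
    then obtain u where u: "minimal_zero A u" "supp u \<subseteq> J"
      by blast
    then have zu: "is_zero A u"
      by (simp add: minimal_zero_def)
    then have une: "supp u \<noteq> {}"
      using supp_empty_iff by (auto simp: is_zero_def)
    have "\<forall>i\<in>supp u. \<exists>d>0. \<forall>y. nonneg_vec y \<longrightarrow> supp y \<subseteq> J - {i} \<longrightarrow> d * (x \<bullet> y)\<^sup>2 \<le> y \<bullet> (A *v y)"
    proof
      fix i assume "i \<in> supp u"
      then have "card (J - {i}) < card J"
        using u(2) by (intro psubset_card_mono) auto
      from less.hyps[OF this] show "\<exists>d>0. \<forall>y. nonneg_vec y \<longrightarrow> supp y \<subseteq> J - {i} \<longrightarrow> d * (x \<bullet> y)\<^sup>2 \<le> y \<bullet> (A *v y)" .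
    qed
    then obtain D where D: "\<And>i. i \<in> supp u \<Longrightarrow> 0 < D i"
      "\<And>i y. i \<in> supp u \<Longrightarrow> nonneg_vec y \<Longrightarrow> supp y \<subseteq> J - {i} \<Longrightarrow> D i * (x \<bullet> y)\<^sup>2 \<le> y \<bullet> (A *v y)"
      by metis
    \<comment> \<open>Which index of \<open>supp u\<close> gets cleared depends on \<open>y\<close>,
      hence the minimum over the constants of all these smaller faces.\<close>
    define d where "d = Min (D ` supp u)"
    have "0 < d"
      unfolding d_def using une D(1) by (subst Min_gr_iff) auto
    moreover have "d * (x \<bullet> y)\<^sup>2 \<le> y \<bullet> (A *v y)" if y: "nonneg_vec y" "supp y \<subseteq> J" for y
    proof -
      define t where "t = Min ((\<lambda>i. y $ i / u $ i) ` supp u)"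
      have "t \<in> (\<lambda>i. y $ i / u $ i) ` supp u"
        unfolding t_def using une by (intro Min_in) auto
      then obtain k where k: "k \<in> supp u" "t = y $ k / u $ k"
        by blast
      have t0: "0 \<le> t"
        using k y(1) is_zero_pos[OF zu k(1)] by (simp add: nonneg_vec_def)
      define z where "z = y + (- t) *\<^sub>R u"
      have z: "nonneg_vec z"
        unfolding nonneg_vec_def
      proof
        fix i
        show "0 \<le> z $ i"
        proof (cases "i \<in> supp u")
          case True
          then have "t \<le> y $ i / u $ i"
            unfolding t_def by (intro Min_le) auto
          then show ?thesis
            using is_zero_pos[OF zu True] by (simp add: z_def field_simps)
        next
          case False
          then show ?thesis
            using y(1) by (simp add: z_def supp_def nonneg_vec_def)
        qed
      qed
      have "supp z \<subseteq> J"
        unfolding z_def using supp_add_scaleR[of y "- t" u] y(2) u(2) by blast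
      moreover have "z $ k = 0"
        using k is_zero_pos[OF zu k(1)] by (simp add: z_def)
      ultimately have "supp z \<subseteq> J - {k}"
        by (auto simp: supp_def)
      then have *: "D k * (x \<bullet> z)\<^sup>2 \<le> z \<bullet> (A *v z)"
        using D(2) k z by blast
      have xz: "x \<bullet> z = x \<bullet> y"
        using orth[OF u(1)] by (simp add: z_def inner_diff_right)
      have "y = z + t *\<^sub>R u"
        by (simp add: z_def)
      then have "y \<bullet> (A *v y) = z \<bullet> (A *v z) + 2 * t * (z \<bullet> (A *v u))"
        using quad_form_add_scaleR[OF copositiveD(1)[OF cop], of z t u] zu
          symmetric_mat_inner[OF copositiveD(1)[OF cop], of u z] by (simp add: is_zero_def)
      moreover have "0 \<le> z \<bullet> (A *v u)"
        using z by (intro inner_zero_image_nonneg[OF cop zu]) (simp add: nonneg_vec_def)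
      ultimately have "z \<bullet> (A *v z) \<le> y \<bullet> (A *v y)"
        using t0 by simp
      moreover have "d \<le> D k"
        unfolding d_def using k by (intro Min_le) auto
      then have "d * (x \<bullet> y)\<^sup>2 \<le> D k * (x \<bullet> y)\<^sup>2"
        by (intro mult_right_mono) auto
      ultimately show ?thesis
        using * xz by simp
    qed
    ultimately show ?thesis by blast
  next
    case False
    \<comment> \<open>Without zeros in this face the form is positive on the compact set
      \<open>S\<close>, so it dominates a multiple of \<open>(norm y)\<^sup>2\<close>, which
      Cauchy-Schwarz compares with \<open>(x \<bullet> y)\<^sup>2\<close>.\<close>
    define S where "S = {y. nonneg_vec y \<and> supp y \<subseteq> J \<and> norm y = 1}"
    have cont: "continuous_on UNIV (\<lambda>y. y \<bullet> (A *v y))"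
      by (intro continuous_intros linear_continuous_on matrix_vector_mul_bounded_linear)
    have pos: "0 < y \<bullet> (A *v y)" if "y \<in> S" for y
    proof -
      have "y \<noteq> 0"
        using that by (auto simp: S_def)
      then have "\<not> is_zero A y \<and> nonneg_vec y"
        using False ex_minimal_zero_subset[of A y] that by (auto simp: S_def)
      then have "y \<bullet> (A *v y) \<noteq> 0"
        using \<open>y \<noteq> 0\<close> by (simp add: is_zero_def)
      then show ?thesis
        using copositiveD(2)[OF cop, of y] that by (simp add: S_def)
    qed
    have "\<exists>c>0. \<forall>y\<in>S. c \<le> y \<bullet> (A *v y)"
    proof (cases "S = {}")
      case True
      then show ?thesis by (intro exI[of _ 1]) auto
    next
      case False
      have "S = (\<Inter>i. {y. 0 \<le> y $ i}) \<inter> (\<Inter>i\<in>-J. {y. y $ i = 0}) \<inter> sphere 0 1"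
        by (auto simp: S_def nonneg_vec_def supp_def)
      then have "compact S"
        by (auto intro!: closed_Int_compact closed_INT closed_Int closed_Collect_le closed_Collect_eq
            continuous_intros)
      then obtain y0 where "y0 \<in> S" "\<forall>y\<in>S. y0 \<bullet> (A *v y0) \<le> y \<bullet> (A *v y)"
        using continuous_attains_inf[of S "\<lambda>y. y \<bullet> (A *v y)"] False
          continuous_on_subset[OF cont] by blast
      then show ?thesis
        using pos by blast
    qed
    then obtain c where c: "0 < c" "\<And>y. y \<in> S \<Longrightarrow> c \<le> y \<bullet> (A *v y)"
      by blast
    define d where "d = c / ((norm x)\<^sup>2 + 1)"
    have n1: "0 < (norm x)\<^sup>2 + 1"
      by (simp add: add_nonneg_pos)
    have "0 < d"
      using c n1 by (simp add: d_def)
    moreover have "d * (x \<bullet> y)\<^sup>2 \<le> y \<bullet> (A *v y)" if y: "nonneg_vec y" "supp y \<subseteq> J" for y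
    proof (cases "y = 0")
      case False
      define v where "v = (1 / norm y) *\<^sub>R y"
      have "v \<in> S"
        using y False by (auto simp: S_def v_def nonneg_vec_def supp_def)
      then have "c \<le> v \<bullet> (A *v v)"
        by (rule c)
      then have *: "c * (norm y)\<^sup>2 \<le> y \<bullet> (A *v y)"
        using False by (simp add: v_def matrix_vector_mult_scaleR field_simps power2_eq_square)
      have "(x \<bullet> y)\<^sup>2 \<le> (norm x)\<^sup>2 * (norm y)\<^sup>2"
        by (metis Cauchy_Schwarz_ineq power2_norm_eq_inner)
      also have "\<dots> \<le> ((norm x)\<^sup>2 + 1) * (norm y)\<^sup>2"
        by (intro mult_right_mono) auto
      finally have "d * (x \<bullet> y)\<^sup>2 \<le> d * (((norm x)\<^sup>2 + 1) * (norm y)\<^sup>2)"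
        using \<open>0 < d\<close> by (intro mult_left_mono) auto
      also have "\<dots> = c * (norm y)\<^sup>2"
        using n1 by (simp add: d_def)
      finally show ?thesis
        using * by simp
    qed auto
    ultimately show ?thesis by blast
  qed
qed

text \<open>On the orthant the form dominates a positive multiple of
  \<open>(x \<bullet> y)\<^sup>2\<close>. For nonzero \<open>x\<close> that multiple of the rank-one
  matrix of \<open>x\<close> could be subtracted from \<open>A\<close>, against
  irreducibility.\<close>

lemma minimal_zeros_span:
  fixes A :: "real^'n^'n"
  assumes cop: "A \<in> copositive_cone" and irr: "irreducible_wrt psd_cone A"
    and orth: "\<And>u. minimal_zero A u \<Longrightarrow> x \<bullet> u = 0"
  shows "x = 0"
proof (rule ccontr)
  assume "x \<noteq> 0"
  obtain d where d: "0 < d" "\<And>y. nonneg_vec y \<Longrightarrow> d * (x \<bullet> y)\<^sup>2 \<le> y \<bullet> (A *v y)"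
    using quad_form_ge_inner_square[OF cop orth, where J=UNIV] by auto
  define B :: "real^'n^'n" where "B = (\<chi> i j. x $ i * x $ j)"
  have B: "y \<bullet> (B *v y) = (x \<bullet> y)\<^sup>2" for y
  proof -
    have "y \<bullet> (B *v y) = (\<Sum>i\<in>UNIV. \<Sum>j\<in>UNIV. (x $ i * y $ i) * (x $ j * y $ j))"
      by (simp add: quad_form_sum B_def mult_ac)
    also have "\<dots> = (x \<bullet> y)\<^sup>2"
      by (simp add: inner_vec_def power2_eq_square sum_product)
    finally show ?thesis .
  qed
  have symB: "symmetric_mat B"
    by (auto simp: symmetric_mat_iff B_def)
  have "B \<in> psd_cone"
    using symB B by (simp add: psd_cone_def)
  moreover have "B \<noteq> 0"
  proof
    assume "B = 0"
    then have "x $ i * x $ i = 0" for i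
      by (auto simp: B_def vec_eq_iff)
    then show False
      using \<open>x \<noteq> 0\<close> by (simp add: vec_eq_iff)
  qed
  moreover have "A - d *\<^sub>R B \<in> copositive_cone"
    unfolding copositive_cone_def
  proof (intro CollectI conjI allI impI)
    show "symmetric_mat (A - d *\<^sub>R B)"
      using symB copositiveD(1)[OF cop] by (simp add: symmetric_mat_iff)
    fix y :: "real^'n" assume "nonneg_vec y"
    then show "0 \<le> y \<bullet> ((A - d *\<^sub>R B) *v y)"
      using d(2)[of y] B[of y]
      by (simp add: matrix_vector_mult_diff_rdistrib inner_diff_right scaleR_matrix_vector_assoc[symmetric])
  qed
  ultimately show False
    using irr d(1) unfolding irreducible_wrt_def by blast
qed

section \<open>Supports of size one and two under a unit diagonal\<close>

lemma supp_card_ge_2: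
  fixes A :: "real^'n^'n"
  assumes diag: "\<forall>i. A $ i $ i = 1" and u: "is_zero A u"
  shows "2 \<le> card (supp u)"
proof (rule ccontr)
  assume "\<not> 2 \<le> card (supp u)"
  moreover have "card (supp u) \<noteq> 0"
    using u supp_empty_iff[of u] by (simp add: is_zero_def)
  ultimately have "card (supp u) = 1"
    by linarith
  then obtain i where i: "supp u = {i}"
    by (auto simp: card_1_singleton_iff)
  define c where "c = u $ i"
  have "c \<noteq> 0"
    using i by (auto simp: c_def supp_def)
  have "u = c *\<^sub>R axis i 1"
    using i by (auto simp: c_def vec_eq_iff axis_def supp_def)
  then have "u \<bullet> (A *v u) = c\<^sup>2"
    using diag by (simp add: matrix_vector_mult_scaleR inner_axis' matrix_vector_mult_basis column_def
        power2_eq_square)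
  then show False
    using u \<open>c \<noteq> 0\<close> by (simp add: is_zero_def)
qed

text \<open>\<open>A *v u\<close> vanishes at \<open>p\<close> and \<open>q\<close>, and the
  resulting symmetric two by two system forces equal squares, hence equal positive
  coordinates.\<close>

lemma pair_zero:
  fixes A :: "real^'n^'n"
  assumes cop: "A \<in> copositive_cone" and diag: "\<forall>i. A $ i $ i = 1"
    and u: "is_zero A u" and supp: "supp u = {p, q}" and pq: "p \<noteq> q"
  shows "A $ p $ q = - 1" and "u $ p = u $ q"
proof -
  have sym: "A $ q $ p = A $ p $ q"
    using copositiveD(1)[OF cop] by (simp add: symmetric_mat_iff)
  have Au: "(A *v u) $ i = A $ i $ p * u $ p + A $ i $ q * u $ q" for i
  proof -
    have "(A *v u) $ i = (\<Sum>j\<in>{p, q}. A $ i $ j * u $ j)"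
      unfolding matrix_vector_mult_def vec_lambda_beta
      using supp by (intro sum.mono_neutral_right) (auto simp: supp_def)
    then show ?thesis using pq by simp
  qed
  have e: "u $ p + A $ p $ q * u $ q = 0" "A $ p $ q * u $ p + u $ q = 0"
    using zero_image_eq_0[OF cop u, of p] zero_image_eq_0[OF cop u, of q] supp Au sym diag by auto
  have pos: "0 < u $ p" "0 < u $ q"
    using is_zero_pos[OF u] supp by auto
  have "u $ p * u $ p = u $ q * u $ q"
    using e by algebra
  then show eq: "u $ p = u $ q"
    using pos by (metis less_imp_le power2_eq_iff_nonneg power2_eq_square)
  then have "(1 + A $ p $ q) * u $ q = 0"
    using e by (simp add: algebra_simps)
  then show "A $ p $ q = - 1"
    using pos by simp
qed

lemma pair_in_min_supp_set_iff:
  fixes A :: "real^'n^'n"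
  assumes cop: "A \<in> copositive_cone" and diag: "\<forall>i. A $ i $ i = 1" and pq: "p \<noteq> q"
  shows "{p, q} \<in> min_supp_set A \<longleftrightarrow> A $ p $ q = - 1"
proof
  assume "{p, q} \<in> min_supp_set A"
  then obtain u where "is_zero A u" "supp u = {p, q}"
    by (auto simp: min_supp_set_def minimal_zero_def)
  then show "A $ p $ q = - 1"
    using pair_zero(1)[OF cop diag _ _ pq] by blast
next
  assume a: "A $ p $ q = - 1"
  define x where "x = axis p 1 + 1 *\<^sub>R axis q (1::real)"
  have s: "supp x = {p, q}"
    using pq by (auto simp: supp_def x_def axis_def)
  have x: "is_zero A x"
    unfolding is_zero_def
  proof (intro conjI)
    show "nonneg_vec x"
      by (auto simp: nonneg_vec_def axis_def x_def)
    show "x \<noteq> 0"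
      using s supp_empty_iff[of x] by auto
    show "x \<bullet> (A *v x) = 0"
      unfolding x_def quad_form_add_scaleR[OF copositiveD(1)[OF cop]]
      using diag a copositiveD(1)[OF cop]
      by (simp add: inner_axis' matrix_vector_mult_basis column_def symmetric_mat_iff)
  qed
  have "\<not> supp v \<subset> supp x" if "is_zero A v" for v
  proof
    assume "supp v \<subset> supp x"
    then have "card (supp v) < card (supp x)"
      by (simp add: psubset_card_mono)
    then show False
      using supp_card_ge_2[OF diag that] s pq by simp
  qed
  then have "minimal_zero A x"
    using x by (auto simp: minimal_zero_def)
  then show "{p, q} \<in> min_supp_set A"
    using s by (auto simp: min_supp_set_def)
qed

subsection \<open>Representatives of the bipartite components\<close>

text \<open>Halmos-Vaughan induction. If a proper nonempty \<open>T\<close> is tight, it is served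
  first and the remaining elements avoid its neighbours. If none is tight, an arbitrary choice for
  one element costs the others at most one neighbour, which they can spare.\<close>

theorem hall_marriage:
  assumes "finite S" and "\<And>C. C \<in> S \<Longrightarrow> finite (N C)"
    and "\<And>T. T \<subseteq> S \<Longrightarrow> card T \<le> card (\<Union>(N ` T))"
  shows "\<exists>w. inj_on w S \<and> (\<forall>C\<in>S. w C \<in> N C)"
  using assms
proof (induction "card S" arbitrary: S N rule: less_induct)
  case less
  note fin = less.prems(1,2) and hall = less.prems(3)
  consider "S = {}" | T where "T \<subset> S" "T \<noteq> {}" "card T = card (\<Union>(N ` T))"
    | "S \<noteq> {}" "\<And>T. T \<subset> S \<Longrightarrow> T \<noteq> {} \<Longrightarrow> card T < card (\<Union>(N ` T))"
    using hall by (metis order_le_less psubset_imp_subset)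
  then show ?case
  proof cases
    case 1
    then show ?thesis by simp
  next
    case (2 T)
    have finT: "finite T"
      using 2 fin(1) finite_subset by blast
    have finN: "finite (\<Union>(N ` U))" if "U \<subseteq> S" for U
      using that fin finite_subset by blast
    have "card T < card S"
      using psubset_card_mono[OF fin(1) 2(1)] .
    then have "\<exists>w. inj_on w T \<and> (\<forall>C\<in>T. w C \<in> N C)"
      using 2 fin hall finT by (intro less.hyps) auto
    then obtain w1 where w1: "inj_on w1 T" "\<And>C. C \<in> T \<Longrightarrow> w1 C \<in> N C"
      by blast
    define N' where "N' C = N C - \<Union>(N ` T)" for C
    have "\<exists>w. inj_on w (S - T) \<and> (\<forall>C\<in>S - T. w C \<in> N' C)"
    proof (intro less.hyps)
      show "card (S - T) < card S"
        using 2 fin(1) by (intro psubset_card_mono) auto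
      fix U assume U: "U \<subseteq> S - T"
      \<comment> \<open>Applying Hall's condition to \<open>U \<union> T\<close> and removing the
        exact count of the tight set \<open>T\<close> gives the condition for
        \<open>N'\<close>.\<close>
      have "card U + card T = card (U \<union> T)"
        using U finT fin(1) by (intro card_Un_disjoint[symmetric]) (auto intro: finite_subset)
      also have "\<dots> \<le> card (\<Union>(N ` (U \<union> T)))"
        using U 2 by (intro hall) auto
      also have "\<Union>(N ` (U \<union> T)) = \<Union>(N' ` U) \<union> \<Union>(N ` T)"
        by (auto simp: N'_def)
      also have "card \<dots> \<le> card (\<Union>(N' ` U)) + card (\<Union>(N ` T))"
        by (rule card_Un_le)
      finally show "card U \<le> card (\<Union>(N' ` U))"
        using 2 by simp
    qed (use fin in \<open>auto simp: N'_def\<close>)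
    then obtain w2 where w2: "inj_on w2 (S - T)" "\<And>C. C \<in> S - T \<Longrightarrow> w2 C \<in> N' C"
      by blast
    define w where "w C = (if C \<in> T then w1 C else w2 C)" for C
    have "inj_on w S"
    proof (rule inj_onI)
      fix C D assume CD: "C \<in> S" "D \<in> S" "w C = w D"
      show "C = D"
        using CD w1 w2 inj_onD[OF w1(1), of C D] inj_onD[OF w2(1), of C D]
        by (cases "C \<in> T"; cases "D \<in> T") (force simp: w_def N'_def)+
    qed
    moreover have "w C \<in> N C" if "C \<in> S" for C
      using w1(2)[of C] w2(2)[of C] that by (auto simp: w_def N'_def)
    ultimately show ?thesis by blast
  next
    case 3
    then obtain C0 where C0: "C0 \<in> S" by blast
    have "card {C0} \<le> card (\<Union>(N ` {C0}))"
      using C0 by (intro hall) auto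
    then have "N C0 \<noteq> {}" by auto
    then obtain x where x: "x \<in> N C0" by blast
    define N' where "N' C = N C - {x}" for C
    have "\<exists>w. inj_on w (S - {C0}) \<and> (\<forall>C\<in>S - {C0}. w C \<in> N' C)"
    proof (intro less.hyps)
      show "card (S - {C0}) < card S"
        using C0 fin(1) by (intro psubset_card_mono) auto
      fix U assume U: "U \<subseteq> S - {C0}"
      show "card U \<le> card (\<Union>(N' ` U))"
      proof (cases "U = {}")
        case False
        then have "card U < card (\<Union>(N ` U))"
          using U C0 by (intro 3) auto
        also have "\<dots> \<le> card (insert x (\<Union>(N' ` U)))"
          using U fin by (intro card_mono) (auto simp: N'_def intro: finite_subset)
        also have "\<dots> \<le> Suc (card (\<Union>(N' ` U)))"
          by (rule card_insert_le_m1) auto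
        finally show ?thesis by simp
      qed auto
    qed (use fin in \<open>auto simp: N'_def\<close>)
    then obtain w where w: "inj_on w (S - {C0})" "\<And>C. C \<in> S - {C0} \<Longrightarrow> w C \<in> N' C"
      by blast
    have "inj_on (w(C0 := x)) S"
    proof (rule inj_onI)
      fix C D assume CD: "C \<in> S" "D \<in> S" "(w(C0 := x)) C = (w(C0 := x)) D"
      show "C = D"
        using CD w(2)[of C] w(2)[of D] inj_onD[OF w(1), of C D]
        by (cases "C = C0"; cases "D = C0") (auto simp: N'_def)
    qed
    moreover have "(w(C0 := x)) C \<in> N C" if "C \<in> S" for C
      using w(2)[of C] that x by (auto simp: N'_def)
    ultimately show ?thesis by blast
  qed
qed

text \<open>Gaussian elimination: each induction step removes one equation of \<open>W\<close> and
  at most one unknown.\<close>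

lemma homogeneous_system_nontrivial:
  fixes M :: "'c \<Rightarrow> 'w \<Rightarrow> 'f::field"
  assumes "finite W" "finite S" "card W < card S"
  shows "\<exists>a. (\<exists>C\<in>S. a C \<noteq> 0) \<and> (\<forall>w\<in>W. (\<Sum>C\<in>S. a C * M C w) = 0)"
  using assms
proof (induction W arbitrary: S M rule: finite_induct)
  case empty
  then have "S \<noteq> {}" by auto
  then show ?case by (intro exI[of _ "\<lambda>_. 1"]) auto
next
  case (insert w0 W)
  show ?case
  proof (cases "\<forall>C\<in>S. M C w0 = 0")
    case True
    have "\<exists>a. (\<exists>C\<in>S. a C \<noteq> 0) \<and> (\<forall>w\<in>W. (\<Sum>C\<in>S. a C * M C w) = 0)"
      using insert by (intro insert.IH) auto
    then show ?thesis using True by auto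
  next
    case False
    then obtain C0 where C0: "C0 \<in> S" "M C0 w0 \<noteq> 0" by blast
    \<comment> \<open>The system after the unknown at \<open>C0\<close> has been eliminated by means
      of equation \<open>w0\<close>; \<open>b\<close> below restores that unknown.\<close>
    define M' where "M' C w = M C w - M C w0 / M C0 w0 * M C0 w" for C w
    have "\<exists>a. (\<exists>C\<in>S - {C0}. a C \<noteq> 0) \<and> (\<forall>w\<in>W. (\<Sum>C\<in>S - {C0}. a C * M' C w) = 0)"
      using insert C0 by (intro insert.IH) auto
    then obtain a where a: "\<exists>C\<in>S - {C0}. a C \<noteq> 0" "\<And>w. w \<in> W \<Longrightarrow> (\<Sum>C\<in>S - {C0}. a C * M' C w) = 0"
      by blast
    define b where "b = a(C0 := - (\<Sum>C\<in>S - {C0}. a C * M C w0) / M C0 w0)"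
    have b: "(\<Sum>C\<in>S. b C * M C w) = (\<Sum>C\<in>S - {C0}. a C * M' C w)" for w
    proof -
      have "(\<Sum>C\<in>S. b C * M C w) = b C0 * M C0 w + (\<Sum>C\<in>S - {C0}. b C * M C w)"
        using C0 insert.prems by (intro sum.remove) auto
      also have "(\<Sum>C\<in>S - {C0}. b C * M C w) = (\<Sum>C\<in>S - {C0}. a C * M C w)"
        by (intro sum.cong) (auto simp: b_def)
      also have "b C0 * M C0 w = - (\<Sum>C\<in>S - {C0}. a C * (M C w0 / M C0 w0 * M C0 w))"
        by (simp add: b_def sum_distrib_right sum_divide_distrib mult.assoc)
      finally show ?thesis
        by (simp add: M'_def right_diff_distrib sum_subtractf)
    qed
    have "M' C w0 = 0" for C
      using C0 by (simp add: M'_def)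
    then have "(\<Sum>C\<in>S. b C * M C w) = 0" if "w \<in> insert w0 W" for w
      using b a(2) that by auto
    moreover have "\<exists>C\<in>S. b C \<noteq> 0"
      using a(1) by (auto simp: b_def)
    ultimately show ?thesis by blast
  qed
qed

section \<open>Components of the graph of two-element supports\<close>

lemma edge2_sym: "edge2 I u v \<Longrightarrow> edge2 I v u"
  by (auto simp: edge2_def insert_commute)

lemma rtranclp_edge2_sym: "(edge2 I)\<^sup>*\<^sup>* u v \<Longrightarrow> (edge2 I)\<^sup>*\<^sup>* v u"
  by (induction rule: rtranclp_induct) (auto intro: converse_rtranclp_into_rtranclp edge2_sym)

lemma components2_eq:
  assumes "C \<in> components2 I" "p \<in> C"
  shows "C = {u. (edge2 I)\<^sup>*\<^sup>* p u}"
proof -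
  obtain v where C: "C = {u. (edge2 I)\<^sup>*\<^sup>* v u}"
    using assms by (auto simp: components2_def)
  then have "(edge2 I)\<^sup>*\<^sup>* v p"
    using assms by auto
  then show ?thesis
    unfolding C using rtranclp_edge2_sym[of I v p] by (auto intro: rtranclp_trans)
qed

lemma components2_nonempty: "C \<in> components2 I \<Longrightarrow> C \<noteq> {}"
  by (auto simp: components2_def)

lemma components2_edge:
  assumes "C \<in> components2 I" "edge2 I p q"
  shows "p \<in> C \<longleftrightarrow> q \<in> C"
  using components2_eq[OF assms(1)] assms(2) edge2_sym[OF assms(2)] by blast

text \<open>A violation of Hall's condition leaves fewer linear conditions than components, hence a
  nontrivial combination of the \<open>\<plusminus>1\<close> colourings of the components orthogonal to all minimal zeros.\<close>
lemma bipartite_components_representatives: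
  fixes A :: "real^'n^'n"
  assumes cop: "A \<in> copositive_cone" and diag: "\<forall>i. A $ i $ i = 1"
    and irr: "irreducible_wrt psd_cone A"
  defines "\<I> \<equiv> min_supp_set A"
  defines "K \<equiv> {C \<in> components2 \<I>. bipartite_comp \<I> C}"
  shows "\<exists>v w. (\<forall>C\<in>K. v C \<in> C \<and> w C \<in> \<I> \<and> card (w C) > 2 \<and> v C \<in> w C) \<and> inj_on w K"
proof -
  define N where "N C = {w\<in>\<I>. 2 < card w \<and> w \<inter> C \<noteq> {}}" for C :: "'n set"
  have "\<forall>w\<in>\<I>. \<exists>u. minimal_zero A u \<and> supp u = w"
    by (auto simp: \<I>_def min_supp_set_def)
  then obtain u where u: "\<And>w. w \<in> \<I> \<Longrightarrow> minimal_zero A (u w)" "\<And>w. w \<in> \<I> \<Longrightarrow> supp (u w) = w"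
    by metis
  have "\<forall>C\<in>K. \<exists>S. \<forall>u\<in>C. \<forall>v\<in>C. edge2 \<I> u v \<longrightarrow> (u \<in> S \<longleftrightarrow> v \<notin> S)"
    by (auto simp: K_def bipartite_comp_def)
  then obtain S where S: "\<And>C p q. C \<in> K \<Longrightarrow> p \<in> C \<Longrightarrow> q \<in> C \<Longrightarrow> edge2 \<I> p q \<Longrightarrow> p \<in> S C \<longleftrightarrow> q \<notin> S C"
    by metis
  \<comment> \<open>The two-colouring of \<open>C\<close>, extended by 0. It is orthogonal to every
    minimal zero supported on a pair: such a zero has equal entries, and its pair is an edge lying
    outside \<open>C\<close> or joining opposite colours.\<close>
  define s :: "'n set \<Rightarrow> real^'n" where
    "s C = (\<chi> i. if i \<in> C then if i \<in> S C then 1 else -1 else 0)" for C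
  have "card T \<le> card (\<Union>(N ` T))" if T: "T \<subseteq> K" for T
  proof (rule ccontr)
    assume "\<not> card T \<le> card (\<Union>(N ` T))"
    then obtain a where a: "\<exists>C\<in>T. a C \<noteq> 0" "\<And>w. w \<in> \<Union>(N ` T) \<Longrightarrow> (\<Sum>C\<in>T. a C * (s C \<bullet> u w)) = 0"
      using homogeneous_system_nontrivial[of "\<Union>(N ` T)" T "\<lambda>C w. s C \<bullet> u w"] by auto
    define x where "x = (\<Sum>C\<in>T. a C *\<^sub>R s C)"
    have xv: "x \<bullet> v = (\<Sum>C\<in>T. a C * (s C \<bullet> v))" for v
      by (simp add: x_def inner_sum_left)
    have "x \<bullet> v = 0" if v: "minimal_zero A v" for v
    proof -
      define J where "J = supp v"
      have J: "J \<in> \<I>"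
        using v by (auto simp: \<I>_def min_supp_set_def J_def)
      have zv: "is_zero A v"
        using v by (simp add: minimal_zero_def)
      have s0: "s C \<bullet> v = 0" if "J \<inter> C = {}" for C
        unfolding inner_vec_def
      proof (intro sum.neutral ballI)
        fix i
        show "s C $ i \<bullet> v $ i = 0"
          using that by (cases "i \<in> C") (auto simp: s_def J_def supp_def)
      qed
      consider "J \<in> \<Union>(N ` T)" | "2 < card J" "J \<notin> \<Union>(N ` T)" | "card J = 2"
        using supp_card_ge_2[OF diag zv] unfolding J_def by linarith
      then show ?thesis
      proof cases
        case 1
        \<comment> \<open>The linear condition was imposed only on the representative
          \<open>u J\<close>; uniqueness up to scaling extends it to every minimal zero with support
          \<open>J\<close>.\<close>
        obtain c where "v = c *\<^sub>R u J"
          using minimal_zero_unique[OF cop u(1)[OF J] v] u(2)[OF J] J_def by blast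
        moreover have "x \<bullet> u J = 0"
          using a(2)[OF 1] by (simp add: xv)
        ultimately show ?thesis by simp
      next
        case 2
        then have "s C \<bullet> v = 0" if "C \<in> T" for C
          using that J by (intro s0) (auto simp: N_def)
        then show ?thesis by (simp add: xv)
      next
        case 3
        then obtain p q where pq: "J = {p, q}" "p \<noteq> q"
          by (auto simp: card_2_iff)
        then have e: "edge2 \<I> p q"
          using J by (simp add: edge2_def)
        have vpq: "v $ p = v $ q"
          using pair_zero(2)[OF cop diag zv _ pq(2)] pq(1) J_def by blast
        have "s C \<bullet> v = 0" if "C \<in> T" for C
        proof (cases "p \<in> C")
          case False
          then have "q \<notin> C"
            using components2_edge[OF _ e] that T by (auto simp: K_def)
          then show ?thesis
            using False pq by (intro s0) auto
        next
          case True
          then have q: "q \<in> C"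
            using components2_edge[OF _ e] that T by (auto simp: K_def)
          have "s C \<bullet> v = (\<Sum>i\<in>{p, q}. s C $ i * v $ i)"
            unfolding inner_vec_def inner_real_def
            using pq by (intro sum.mono_neutral_right) (auto simp: J_def supp_def)
          also have "\<dots> = (s C $ p + s C $ q) * v $ q"
            using pq(2) vpq by (simp add: algebra_simps)
          also have "s C $ p + s C $ q = 0"
            using S[of C p q] that T True q e by (auto simp: s_def)
          finally show ?thesis by simp
        qed
        then show ?thesis by (simp add: xv)
      qed
    qed
    then have "x = 0"
      by (rule minimal_zeros_span[OF cop irr])
    obtain C0 where C0: "C0 \<in> T" "a C0 \<noteq> 0"
      using a(1) by blast
    then have C0': "C0 \<in> components2 \<I>"
      using T by (auto simp: K_def)
    then obtain i where i: "i \<in> C0"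
      using components2_nonempty by blast
    \<comment> \<open>Distinct components are disjoint, so only \<open>C0\<close> contributes to
      coordinate \<open>i\<close> of \<open>x\<close>.\<close>
    have "s C $ i = 0" if "C \<in> T - {C0}" for C
    proof -
      have "i \<notin> C"
      proof
        assume "i \<in> C"
        then have "C = C0"
          using components2_eq[of C \<I> i] components2_eq[OF C0' i] that T by (auto simp: K_def)
        then show False using that by simp
      qed
      then show ?thesis by (simp add: s_def)
    qed
    then have "x $ i = (\<Sum>C\<in>{C0}. a C * s C $ i)"
      unfolding x_def sum_component vector_scaleR_component real_scaleR_def using C0
      by (intro sum.mono_neutral_right) auto
    then have "x $ i = a C0 * s C0 $ i"
      by simp
    then show False
      using \<open>x = 0\<close> C0 i by (auto simp: s_def split: if_splits)
  qed
  then obtain w where w: "inj_on w K" "\<And>C. C \<in> K \<Longrightarrow> w C \<in> N C"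
    using hall_marriage[of K N] by auto
  then have "\<forall>C\<in>K. \<exists>v. v \<in> w C \<inter> C"
    by (auto simp: N_def)
  then obtain v where "\<And>C. C \<in> K \<Longrightarrow> v C \<in> w C \<inter> C"
    by metis
  then show ?thesis
    using w by (intro exI[of _ v] exI[of _ w]) (auto simp: N_def)
qed

subsection \<open>Gram vectors\<close>

text \<open>With a vanishing diagonal entry, the form at \<open>s e_i + t e_j\<close> starts with a
  term linear in \<open>t\<close>, and both signs of \<open>s\<close> are allowed.\<close>

lemma psd_entry_zero:
  fixes P :: "real^'n^'n"
  assumes P: "P \<in> psd_cone" and 0: "P $ i $ i = 0"
  shows "P $ i $ j = 0"
proof -
  have sym: "symmetric_mat P"
    using P by (simp add: psd_cone_def)
  have "0 \<le> (2 * s * P $ i $ j) * t + P $ j $ j * t\<^sup>2" if "s\<^sup>2 = 1" for s t :: real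
  proof -
    have "0 \<le> (s *\<^sub>R axis i 1 + t *\<^sub>R axis j 1) \<bullet> (P *v (s *\<^sub>R axis i 1 + t *\<^sub>R axis j (1::real)))"
      using P by (simp add: psd_cone_def)
    also have "\<dots> = (2 * s * P $ i $ j) * t + P $ j $ j * t\<^sup>2"
      unfolding quad_form_add_scaleR[OF sym] using 0 sym
      by (simp add: matrix_vector_mult_scaleR inner_axis' matrix_vector_mult_basis column_def
          symmetric_mat_iff algebra_simps)
    finally show ?thesis .
  qed
  from this[of 1] this[of "- 1"] have "0 \<le> 2 * P $ i $ j" "0 \<le> - 2 * P $ i $ j"
    using nonneg_small_linear_term[of 1 "2 * P $ i $ j" "P $ j $ j"]
      nonneg_small_linear_term[of 1 "- 2 * P $ i $ j" "P $ j $ j"] by auto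
  then show ?thesis by simp
qed

text \<open>Cholesky factorisation, by induction over a set \<open>S\<close> outside which the
  diagonal vanishes. Keeping the vectors zero outside \<open>S\<close> reserves a fresh coordinate
  for the next pivot.\<close>

lemma psd_gram_exists:
  fixes P :: "real^'n^'n"
  assumes "P \<in> psd_cone"
  shows "\<exists>X :: 'n \<Rightarrow> real^'n. \<forall>i j. P $ i $ j = X i \<bullet> X j"
proof -
  have "\<exists>X :: 'n \<Rightarrow> real^'n. (\<forall>i j. P $ i $ j = X i \<bullet> X j) \<and> (\<forall>i k. k \<notin> S \<longrightarrow> X i $ k = 0)"
    if "P \<in> psd_cone" "\<And>i. i \<notin> S \<Longrightarrow> P $ i $ i = 0" for S :: "'n set" and P :: "real^'n^'n"
    using finite[of S] that
  proof (induction S arbitrary: P rule: finite_induct)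
    case empty
    then have "P $ i $ j = 0" for i j
      using psd_entry_zero by blast
    then show ?case
      by (intro exI[of _ "\<lambda>_. 0"]) simp
  next
    case (insert k S)
    have sym: "P $ i $ j = P $ j $ i" for i j
      using insert.prems by (auto simp: psd_cone_def symmetric_mat_iff)
    have psd: "0 \<le> x \<bullet> (P *v x)" for x
      using insert.prems by (simp add: psd_cone_def)
    define d where "d = P $ k $ k"
    have "0 \<le> axis k 1 \<bullet> (P *v axis k (1::real))"
      by (rule psd)
    then have d0: "0 \<le> d"
      by (simp add: d_def inner_axis' matrix_vector_mult_basis column_def)
    show ?case
    proof (cases "d = 0")
      case True
      then have "P $ i $ i = 0" if "i \<notin> S" for i
        using insert.prems(2)[of i] that by (cases "i = k") (auto simp: d_def)
      from insert.IH[OF insert.prems(1) this] show ?thesis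
        by blast
    next
      case False
      then have d: "0 < d"
        using d0 by simp
      \<comment> \<open>The Schur complement of the pivot. Its form at \<open>x\<close> is the
        minimum of the form of \<open>P\<close> on the line through \<open>x\<close> in direction
        \<open>axis k 1\<close>, hence nonnegative.\<close>
      define Q :: "real^'n^'n" where "Q = (\<chi> i j. P $ i $ j - P $ i $ k * P $ j $ k / d)"
      have "0 \<le> x \<bullet> (Q *v x)" for x
      proof -
        define r where "r = (P *v x) $ k"
        have r: "r = (\<Sum>j\<in>UNIV. P $ j $ k * x $ j)"
          unfolding r_def matrix_vector_mult_def using sym[of k] by simp
        have "x \<bullet> (Q *v x) = x \<bullet> (P *v x) - (\<Sum>i\<in>UNIV. \<Sum>j\<in>UNIV. (P $ i $ k * x $ i) * (P $ j $ k * x $ j)) / d"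
          by (simp add: quad_form_sum Q_def left_diff_distrib sum_subtractf sum_divide_distrib
              right_diff_distrib algebra_simps)
        also have "\<dots> = x \<bullet> (P *v x) - r\<^sup>2 / d"
          by (simp add: r power2_eq_square sum_product)
        also have "\<dots> = (x + (- r / d) *\<^sub>R axis k 1) \<bullet> (P *v (x + (- r / d) *\<^sub>R axis k 1))"
        proof -
          have "symmetric_mat P"
            using sym by (simp add: symmetric_mat_iff)
          then show ?thesis
            unfolding quad_form_add_scaleR[OF \<open>symmetric_mat P\<close>] using d
            by (simp add: inner_axis' matrix_vector_mult_basis column_def power2_eq_square
                flip: r_def d_def)
        qed
        finally show ?thesis
          using psd by metis
      qed
      then have "Q \<in> psd_cone"
        using sym by (auto simp: psd_cone_def symmetric_mat_iff Q_def mult.commute)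
      moreover have "Q $ i $ i = 0" if "i \<notin> S" for i
      proof (cases "i = k")
        case True
        then show ?thesis using d by (simp add: Q_def d_def)
      next
        case False
        then have "P $ i $ i = 0"
          using insert.prems(2) that by auto
        then have "P $ i $ k = 0"
          using psd_entry_zero[OF insert.prems(1)] by blast
        then show ?thesis
          using \<open>P $ i $ i = 0\<close> by (simp add: Q_def)
      qed
      ultimately obtain X :: "'n \<Rightarrow> real^'n" where
        X: "\<And>i j. Q $ i $ j = X i \<bullet> X j" "\<And>i l. l \<notin> S \<Longrightarrow> X i $ l = 0"
        using insert.IH[of Q] by blast
      \<comment> \<open>The fresh coordinate \<open>k\<close> gives back the rank-one part missing
        from \<open>Q\<close>.\<close>
      define Y :: "'n \<Rightarrow> real^'n" where "Y i = X i + axis k (P $ i $ k / sqrt d)" for i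
      have Y: "Y i \<bullet> Y j = P $ i $ j" for i j
      proof -
        have "Y i \<bullet> Y j = X i \<bullet> X j + (P $ i $ k / sqrt d) * (P $ j $ k / sqrt d)"
          using X(2)[OF insert.hyps(2)] by (simp add: Y_def inner_add_left inner_add_right inner_axis inner_axis')
        then show ?thesis
          using d X(1)[of i j] by (simp add: Q_def)
      qed
      have "\<forall>i l. l \<notin> insert k S \<longrightarrow> Y i $ l = 0"
        using X(2) by (auto simp: Y_def axis_def)
      with Y show ?thesis
        by (intro exI[of _ Y]) simp
    qed
  qed
  from this[of P UNIV] show ?thesis
    using assms by auto
qed

lemma gram_psd:
  fixes X :: "'n::finite \<Rightarrow> 'a::real_inner"
  shows "(\<chi> i j. X i \<bullet> X j) \<in> psd_cone"
proof -
  have "x \<bullet> ((\<chi> i j. X i \<bullet> X j) *v x) = (\<Sum>i\<in>UNIV. x $ i *\<^sub>R X i) \<bullet> (\<Sum>i\<in>UNIV. x $ i *\<^sub>R X i)" for x :: "real^'n"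
    by (simp add: quad_form_sum inner_sum_left inner_sum_right sum_distrib_left
        inner_commute mult_ac)
  then show ?thesis
    by (simp add: psd_cone_def symmetric_mat_iff inner_commute)
qed

text \<open>If no such \<open>y\<close> exists, a hyperplane separating \<open>b\<close> from the sums of a vector \<open>(y \<bullet> X i)\<^sub>i\<close> with
  \<open>norm y \<le> 1\<close> and a nonnegative vector has a nonnegative normal \<open>w\<close> violating the hypothesis.\<close>
lemma ball_dual_vector_exists:
  fixes X :: "'n::finite \<Rightarrow> 'a::euclidean_space" and b :: "'n \<Rightarrow> real"
  assumes cop: "\<And>w t. (\<And>i. 0 \<le> w i) \<Longrightarrow> 0 < t \<Longrightarrow>
    0 \<le> (norm (\<Sum>i\<in>J. w i *\<^sub>R X i))\<^sup>2 + 2 * t * (\<Sum>i\<in>J. w i * b i) + t\<^sup>2"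
  shows "\<exists>y. norm y \<le> 1 \<and> (\<forall>i\<in>J. y \<bullet> X i \<le> b i)"
proof (rule ccontr)
  assume contra: "\<not> ?thesis"
  define F :: "'a \<Rightarrow> real^'n" where "F y = (\<chi> i. if i \<in> J then y \<bullet> X i else 0)" for y
  define B :: "real^'n" where "B = (\<chi> i. if i \<in> J then b i else 0)"
  \<comment> \<open>A compact plus a closed set is closed, which permits strict separation from
    \<open>B\<close>.\<close>
  define S where "S = (\<Union>x\<in>F ` cball 0 1. \<Union>y\<in>{s. \<forall>i. 0 \<le> s $ i}. {x + y})"
  have linF: "linear F"
    by (auto intro!: linearI simp: F_def vec_eq_iff inner_add_left)
  have "compact (F ` cball 0 1)"
    by (intro compact_continuous_image linear_continuous_on linF compact_cball)
      (simp add: linF linear_conv_bounded_linear[symmetric])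
  moreover have "{s::real^'n. \<forall>i. 0 \<le> s $ i} = (\<Inter>i. {s. 0 \<le> s $ i})"
    by auto
  then have "closed {s::real^'n. \<forall>i. 0 \<le> s $ i}"
    by (auto intro!: closed_INT closed_Collect_le continuous_intros)
  ultimately have "closed S"
    unfolding S_def by (rule compact_closed_sums)
  moreover have "convex S"
    unfolding S_def
    by (intro convex_sums convex_linear_image linF convex_cball)
      (auto simp: convex_def intro!: add_nonneg_nonneg mult_nonneg_nonneg)
  moreover have "B \<notin> S"
  proof
    assume "B \<in> S"
    then obtain y s where ys: "norm y \<le> 1" "\<forall>i. 0 \<le> s $ i" "B = F y + s"
      by (auto simp: S_def)
    have "y \<bullet> X i \<le> b i" if "i \<in> J" for i
      using arg_cong[OF ys(3), of "\<lambda>v. v $ i"] that ys(2)[rule_format, of i]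
      by (simp add: B_def F_def)
    then show False
      using contra ys(1) by blast
  qed
  ultimately obtain w c where wc: "w \<bullet> B < c" "\<And>x. x \<in> S \<Longrightarrow> c < w \<bullet> x"
    using separating_hyperplane_closed_point[of S B] by blast
  have inS: "F y + s \<in> S" if "norm y \<le> 1" "\<forall>i. 0 \<le> s $ i" for y s
    unfolding S_def using that by (intro UN_I[of "F y"] UN_I[of s]) auto
  have w0: "0 \<le> w $ i" for i
  proof (rule ccontr)
    assume neg: "\<not> 0 \<le> w $ i"
    \<comment> \<open>Far enough along \<open>axis i 1\<close> for the product with \<open>w\<close>
      to become \<open>- (\<bar>c\<bar> + 1)\<close>, which is below \<open>c\<close>.\<close>
    define r where "r = (\<bar>c\<bar> + 1) / (- (w $ i))"
    have "0 \<le> r"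
      using neg unfolding r_def by (intro divide_nonneg_pos) auto
    then have "F 0 + axis i r \<in> S"
      by (intro inS) (auto simp: axis_def)
    then have "c < w \<bullet> (F 0 + axis i r)"
      by (rule wc)
    also have "\<dots> = r * w $ i"
      using linF by (simp add: linear_0 inner_axis)
    also have "\<dots> = - (\<bar>c\<bar> + 1)"
      using neg by (simp add: r_def field_simps)
    finally show False by linarith
  qed
  define V where "V = (\<Sum>i\<in>J. w $ i *\<^sub>R X i)"
  define \<beta> where "\<beta> = (\<Sum>i\<in>J. w $ i * b i)"
  have wF: "w \<bullet> F y = y \<bullet> V" for y
  proof -
    have "w \<bullet> F y = (\<Sum>i\<in>UNIV. if i \<in> J then w $ i * (y \<bullet> X i) else 0)"
      unfolding inner_vec_def by (intro sum.cong) (auto simp: F_def)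
    then show ?thesis
      by (simp add: V_def inner_sum_right sum.If_cases)
  qed
  have wB: "w \<bullet> B = \<beta>"
  proof -
    have "w \<bullet> B = (\<Sum>i\<in>UNIV. if i \<in> J then w $ i * b i else 0)"
      unfolding inner_vec_def by (intro sum.cong) (auto simp: B_def)
    then show ?thesis
      by (simp add: \<beta>_def sum.If_cases)
  qed
  \<comment> \<open>This argument of \<open>F\<close> minimises \<open>y \<bullet> V\<close> over
    the unit ball. For \<open>V = 0\<close> it is 0, and the value is still
    \<open>- norm V\<close>.\<close>
  have "c < w \<bullet> (F (- (1 / norm V) *\<^sub>R V) + 0)"
    by (intro wc inS) auto
  also have "\<dots> = - norm V"
    by (simp add: wF power2_eq_square flip: power2_norm_eq_inner)
  finally have lt: "norm V + \<beta> < 0"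
    using wc(1) wB by simp
  have c0: "0 \<le> (norm V)\<^sup>2 + 2 * t * \<beta> + t\<^sup>2" if "0 < t" for t
    unfolding V_def \<beta>_def using w0 that by (intro cop) auto
  show False
  proof (cases "V = 0")
    case True
    have "0 \<le> 2 * \<beta> * t + 1 * t\<^sup>2" if "0 < t" for t
      using c0[OF that] True by (simp add: mult_ac)
    then have "0 \<le> 2 * \<beta>"
      using nonneg_small_linear_term[of 1 "2 * \<beta>" 1] by simp
    then show False
      using lt True by simp
  next
    case False
    then have "0 < norm V" by simp
    then have "0 \<le> 2 * norm V * (norm V + \<beta>)"
      using c0[of "norm V"] by (simp add: algebra_simps power2_eq_square)
    then show False
      using \<open>0 < norm V\<close> lt by (simp add: zero_le_mult_iff)
  qed
qed

lemma gram_on_exists: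
  fixes A :: "real^'n^'n"
  assumes sym: "symmetric_mat A" and psd: "\<And>x. supp x \<subseteq> J \<Longrightarrow> 0 \<le> x \<bullet> (A *v x)"
  shows "\<exists>X :: 'n \<Rightarrow> real^'n. \<forall>i\<in>J. \<forall>j\<in>J. X i \<bullet> X j = A $ i $ j"
proof -
  define R where "R x = (\<chi> i. if i \<in> J then x $ i else 0)" for x :: "real^'n"
  have "x \<bullet> (submat J A *v x) = R x \<bullet> (A *v R x)" for x
    unfolding quad_form_sum by (intro sum.cong refl) (auto simp: submat_def R_def)
  moreover have "supp (R x) \<subseteq> J" for x
    by (auto simp: supp_def R_def split: if_splits)
  ultimately have "submat J A \<in> psd_cone"
    using psd sym by (auto simp: psd_cone_def symmetric_mat_iff submat_def)
  then obtain X :: "'n \<Rightarrow> real^'n" where X: "\<And>i j. submat J A $ i $ j = X i \<bullet> X j"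
    using psd_gram_exists by blast
  have "X i \<bullet> X j = A $ i $ j" if "i \<in> J" "j \<in> J" for i j
    using X[of i j] that by (simp add: submat_def)
  then show ?thesis by blast
qed

text \<open>On \<open>J\<close> the Gram vectors of \<open>A\<close> itself serve. Copositivity at
  nonnegative vectors supported in \<open>insert k J\<close> is the hypothesis of
  \<open>ball_dual_vector_exists\<close>, which yields a vector of norm at most 1 for
  \<open>k\<close>. The extra real coordinate lengthens it to norm 1 without changing its products
  with the others.\<close>

lemma unit_gram_minorant:
  fixes A :: "real^'n^'n"
  assumes cop: "A \<in> copositive_cone" and diag: "\<forall>i. A $ i $ i = 1"
    and psd: "\<And>x. supp x \<subseteq> J \<Longrightarrow> 0 \<le> x \<bullet> (A *v x)" and k: "k \<notin> J"
  shows "\<exists>Y :: 'n \<Rightarrow> (real^'n) \<times> real. (\<forall>i\<in>insert k J. norm (Y i) = 1) \<and>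
    (\<forall>i\<in>insert k J. \<forall>j\<in>insert k J. Y i \<bullet> Y j \<le> A $ i $ j)"
proof -
  have symA: "A $ i $ j = A $ j $ i" for i j
    using copositiveD(1)[OF cop] by (simp add: symmetric_mat_iff)
  obtain X :: "'n \<Rightarrow> real^'n" where XA: "\<And>i j. i \<in> J \<Longrightarrow> j \<in> J \<Longrightarrow> X i \<bullet> X j = A $ i $ j"
    using gram_on_exists[of A J, OF copositiveD(1)[OF cop] psd] by blast
  have "\<exists>y. norm y \<le> 1 \<and> (\<forall>i\<in>J. y \<bullet> X i \<le> A $ k $ i)"
  proof (rule ball_dual_vector_exists)
    fix w :: "'n \<Rightarrow> real" and t :: real
    assume w: "\<And>i. 0 \<le> w i" and t: "0 < t"
    define x :: "real^'n" where "x = (\<chi> i. if i \<in> J then w i else 0)"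
    have "nonneg_vec (x + t *\<^sub>R axis k 1)"
      using w t by (auto simp: nonneg_vec_def x_def axis_def)
    then have "0 \<le> (x + t *\<^sub>R axis k 1) \<bullet> (A *v (x + t *\<^sub>R axis k 1))"
      by (rule copositiveD(2)[OF cop])
    also have "\<dots> = x \<bullet> (A *v x) + 2 * t * (A *v x) $ k + t\<^sup>2"
      unfolding quad_form_add_scaleR[OF copositiveD(1)[OF cop]] using diag
      by (simp add: inner_axis' matrix_vector_mult_basis column_def)
    also have "(A *v x) $ k = (\<Sum>i\<in>UNIV. if i \<in> J then w i * A $ k $ i else 0)"
      unfolding matrix_vector_mult_def vec_lambda_beta by (intro sum.cong) (auto simp: x_def)
    also have "\<dots> = (\<Sum>i\<in>J. w i * A $ k $ i)"
      by (simp add: sum.If_cases)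
    also have "x \<bullet> (A *v x) = (\<Sum>i\<in>J. \<Sum>j\<in>J. (w i *\<^sub>R X i) \<bullet> (w j *\<^sub>R X j))"
    proof -
      have "x \<bullet> (A *v x) = (\<Sum>i\<in>UNIV. if i \<in> J then \<Sum>j\<in>UNIV. if j \<in> J then A $ i $ j * w i * w j else 0 else 0)"
        unfolding quad_form_sum by (intro sum.cong) (auto simp: x_def intro!: sum.cong)
      also have "\<dots> = (\<Sum>i\<in>J. \<Sum>j\<in>J. A $ i $ j * w i * w j)"
        by (simp add: sum.If_cases)
      also have "\<dots> = (\<Sum>i\<in>J. \<Sum>j\<in>J. (w i *\<^sub>R X i) \<bullet> (w j *\<^sub>R X j))"
        by (intro sum.cong refl) (simp add: XA)
      finally show ?thesis .
    qed
    also have "\<dots> = (norm (\<Sum>i\<in>J. w i *\<^sub>R X i))\<^sup>2"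
      unfolding power2_norm_eq_inner inner_sum_left inner_sum_right by (rule sum.swap)
    finally show "0 \<le> (norm (\<Sum>i\<in>J. w i *\<^sub>R X i))\<^sup>2 + 2 * t * (\<Sum>i\<in>J. w i * A $ k $ i) + t\<^sup>2" .
  qed
  then obtain y where y: "norm y \<le> 1" "\<And>i. i \<in> J \<Longrightarrow> y \<bullet> X i \<le> A $ k $ i"
    by blast
  have "y \<bullet> y \<le> 1"
    using y(1) by (simp add: norm_eq_sqrt_inner)
  define Y where "Y i = (if i = k then (y, sqrt (1 - y \<bullet> y)) else (X i, 0))" for i
  have Y1: "Y i \<bullet> Y i = 1" if "i \<in> insert k J" for i
    using that XA[of i i] diag \<open>y \<bullet> y \<le> 1\<close> by (auto simp: Y_def inner_prod_def)
  have "Y i \<bullet> Y j \<le> A $ i $ j" if "i \<in> insert k J" "j \<in> insert k J" for i j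
  proof (cases "i = j")
    case True
    then show ?thesis
      using Y1[OF that(1)] diag by simp
  next
    case False
    then show ?thesis
      using that XA[of i j] y(2)[of i] y(2)[of j] symA[of k i]
      by (auto simp: Y_def inner_prod_def inner_commute)
  qed
  then show ?thesis
    using Y1 by (intro exI[of _ Y]) (auto simp: norm_eq_sqrt_inner)
qed

subsection \<open>Random hyperplanes\<close>

text \<open>Cauchy's functional equation on an interval: nonnegativity makes \<open>F\<close>
  monotone, and comparison with a grid of mesh \<open>L / n\<close> leaves an error of at most
  \<open>F L / n\<close>.\<close>

lemma additive_nonneg_linear:
  fixes F :: "real \<Rightarrow> real"
  assumes nonneg: "\<And>x. 0 \<le> x \<Longrightarrow> x \<le> L \<Longrightarrow> 0 \<le> F x"
    and add: "\<And>x y. 0 \<le> x \<Longrightarrow> 0 \<le> y \<Longrightarrow> x + y \<le> L \<Longrightarrow> F (x + y) = F x + F y"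
    and L: "0 < L" and x: "0 \<le> x" "x \<le> L"
  shows "F x = F L * x / L"
proof -
  have mono: "F a \<le> F b" if "0 \<le> a" "a \<le> b" "b \<le> L" for a b
    using add[of a "b - a"] nonneg[of "b - a"] that by auto
  have mult: "F (real n * h) = real n * F h" if "0 \<le> h" "real n * h \<le> L" for n h
    using that(2)
  proof (induction n)
    case 0
    show ?case using add[of 0 0] L by simp
  next
    case (Suc n)
    have "real n * h \<le> L"
      using Suc.prems that(1) by (simp add: algebra_simps)
    moreover have "F (real n * h + h) = F (real n * h) + F h"
      using Suc.prems that(1) by (intro add) (auto simp: algebra_simps)
    ultimately show ?case
      using Suc.IH by (simp add: algebra_simps)
  qed
  have est: "\<bar>F x - F L * x / L\<bar> \<le> F L / real n" if n: "0 < n" for n :: nat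
  proof -
    define h where "h = L / real n"
    have h: "0 < h" "real n * h = L"
      using L n by (auto simp: h_def)
    have FL: "F L = real n * F h"
      using mult[of h n] h by simp
    have Fh: "0 \<le> F h"
      using h n nonneg[of L] L FL by (simp add: zero_le_mult_iff)
    define k where "k = nat \<lfloor>x / h\<rfloor>"
    have "0 \<le> x / h"
      using x h by simp
    then have "real k = of_int \<lfloor>x / h\<rfloor>"
      by (simp add: k_def)
    then have "real k \<le> x / h" "x / h < real k + 1"
      by linarith+
    then have k: "real k * h \<le> x" "x < (real k + 1) * h"
      using h by (auto simp: field_simps)
    have lo: "real k * F h \<le> F x"
      using mono[of "real k * h" x] mult[of h k] k h x by simp
    have hi: "F x \<le> (real k + 1) * F h"
    proof (cases "(real k + 1) * h \<le> L")
      case True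
      then show ?thesis
        using mono[of x "(real k + 1) * h"] mult[of h "Suc k"] k h x by (simp add: add.commute)
    next
      case False
      then have "real n * h < (real k + 1) * h"
        using h by simp
      then have "real n \<le> real k + 1"
        using h(1) by (simp only: mult_less_cancel_right_pos less_imp_le)
      then have "real n * F h \<le> (real k + 1) * F h"
        using Fh by (rule mult_right_mono)
      then show ?thesis
        using mono[of x L] x FL by simp
    qed
    have e: "F L * x / L = F h * (x / h)"
      using FL h L n by (simp add: h_def)
    have "F h * real k \<le> F h * (x / h)" "F h * (x / h) \<le> F h * (real k + 1)"
      using \<open>real k \<le> x / h\<close> \<open>x / h < real k + 1\<close> Fh
      by (auto simp del: times_divide_eq_right intro!: mult_left_mono)
    then have "\<bar>F x - F L * x / L\<bar> \<le> F h"
      using lo hi unfolding e by (simp add: distrib_left distrib_right mult.commute abs_le_iff del: times_divide_eq_right)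
    then show ?thesis
      using FL n by simp
  qed
  show ?thesis
  proof (rule ccontr)
    assume "F x \<noteq> F L * x / L"
    then have d: "0 < \<bar>F x - F L * x / L\<bar>" by simp
    obtain n where n: "F L / \<bar>F x - F L * x / L\<bar> < real n"
      using reals_Archimedean2 by blast
    have "0 \<le> F L / \<bar>F x - F L * x / L\<bar>"
      using d nonneg[of L] L by simp
    then have "0 < n"
      using n by (metis less_le_trans not_less of_nat_0 of_nat_0_less_iff order_le_less_trans)
    then show False
      using est[of n] n d by (simp add: field_simps)
  qed
qed

text \<open>For nonzero \<open>x\<close> and \<open>y\<close> this is a double wedge, up to its
  boundary. Cutting it to the unit ball makes its volume finite and keeps the construction
  compatible with orthogonal maps.\<close>

definition sign_disagree :: "'a::euclidean_space \<Rightarrow> 'a \<Rightarrow> 'a set" where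
  "sign_disagree x y = {g \<in> ball 0 1. (0 \<le> x \<bullet> g) \<noteq> (0 \<le> y \<bullet> g)}"

lemma halfspace_sets_lebesgue: "{g. 0 \<le> x \<bullet> g} \<in> sets lebesgue"
  by (intro sets_completionI_sets) (simp add: closed_halfspace_ge)

lemma sign_disagree_lmeasurable: "sign_disagree x y \<in> lmeasurable"
proof -
  have "sign_disagree x y = ball 0 1 \<inter> (({g. 0 \<le> x \<bullet> g} - {g. 0 \<le> y \<bullet> g}) \<union> ({g. 0 \<le> y \<bullet> g} - {g. 0 \<le> x \<bullet> g}))"
    by (auto simp: sign_disagree_def)
  also have "\<dots> \<in> lmeasurable"
    by (intro fmeasurable_Int_fmeasurable lmeasurable_ball sets.Un sets.Diff halfspace_sets_lebesgue)
  finally show ?thesis .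
qed

lemma sign_disagree_orthogonal_image:
  fixes f :: "'a::euclidean_space \<Rightarrow> 'a"
  assumes f: "orthogonal_transformation f"
  shows "sign_disagree (f x) (f y) = f ` sign_disagree x y"
proof -
  have fi: "f v \<bullet> f w = v \<bullet> w" for v w
    using f by (simp add: orthogonal_transformation_def)
  have n: "norm (f v) = norm v" for v
    using f by (simp add: orthogonal_transformation)
  show ?thesis
  proof
    show "sign_disagree (f x) (f y) \<subseteq> f ` sign_disagree x y"
    proof
      fix g assume g: "g \<in> sign_disagree (f x) (f y)"
      obtain g' where "g = f g'"
        using orthogonal_transformation_surj[OF f] by (metis surjD)
      then show "g \<in> f ` sign_disagree x y"
        using g by (auto simp: sign_disagree_def fi n)
    qed
  qed (auto simp: sign_disagree_def fi n)
qed

section \<open>Sign disagreement along a unit circle\<close>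

context
  fixes e1 e2 :: "real^'m::{finite,wellorder}"
  assumes e: "e1 \<bullet> e1 = 1" "e2 \<bullet> e2 = 1" "e1 \<bullet> e2 = 0"
begin

definition circle_pt :: "real \<Rightarrow> real^'m::_" where
  "circle_pt t = cos t *\<^sub>R e1 + sin t *\<^sub>R e2"

text \<open>Rotation by \<open>c\<close> in the plane of the orthonormal pair \<open>e1\<close>,
  \<open>e2\<close> and the identity on its orthogonal complement, written as a correction of
  \<open>v\<close> so that no basis of the whole space has to be chosen.\<close>

definition plane_rotation :: "real \<Rightarrow> real^'m::_ \<Rightarrow> real^'m::_" where
  "plane_rotation c v = v + ((cos c - 1) * (v \<bullet> e1) - sin c * (v \<bullet> e2)) *\<^sub>R e1
     + (sin c * (v \<bullet> e1) + (cos c - 1) * (v \<bullet> e2)) *\<^sub>R e2"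

lemma plane_rotation_orthogonal: "orthogonal_transformation (plane_rotation c)"
  unfolding orthogonal_transformation
proof (intro conjI allI)
  show "linear (plane_rotation c)"
    by (rule linearI) (simp_all add: plane_rotation_def inner_add_left algebra_simps)
  fix v
  have e': "e2 \<bullet> e1 = 0"
    using e by (simp add: inner_commute)
  define a b where "a = v \<bullet> e1" and "b = v \<bullet> e2"
  have ab: "e1 \<bullet> v = a" "e2 \<bullet> v = b" "v \<bullet> e1 = a" "v \<bullet> e2 = b"
    by (auto simp: a_def b_def inner_commute)
  have "plane_rotation c v \<bullet> plane_rotation c v =
      v \<bullet> v + 2 * ((cos c - 1) * a - sin c * b) * a + 2 * (sin c * a + (cos c - 1) * b) * b
      + ((cos c - 1) * a - sin c * b)\<^sup>2 + (sin c * a + (cos c - 1) * b)\<^sup>2"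
    unfolding plane_rotation_def inner_add_left inner_add_right inner_scaleR_left inner_scaleR_right ab e e'
    by (simp add: algebra_simps power2_eq_square)
  also have "\<dots> = v \<bullet> v + (a\<^sup>2 + b\<^sup>2) * ((sin c)\<^sup>2 + (cos c)\<^sup>2 - 1)"
    by algebra
  finally show "norm (plane_rotation c v) = norm v"
    by (simp add: norm_eq_sqrt_inner)
qed

lemma plane_rotation_circle_pt: "plane_rotation c (circle_pt t) = circle_pt (t + c)"
proof -
  have 1: "circle_pt t \<bullet> e1 = cos t" "circle_pt t \<bullet> e2 = sin t"
    using e by (auto simp: circle_pt_def inner_add_left inner_commute[of e2 e1])
  show ?thesis
    unfolding plane_rotation_def 1
    by (simp add: circle_pt_def cos_add sin_add algebra_simps)
qed

lemma measure_sign_disagree_shift: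
  "measure lebesgue (sign_disagree (circle_pt a) (circle_pt (a + b)))
   = measure lebesgue (sign_disagree (circle_pt 0) (circle_pt b))"
proof -
  have "sign_disagree (circle_pt a) (circle_pt (a + b)) = plane_rotation a ` sign_disagree (circle_pt 0) (circle_pt b)"
    unfolding sign_disagree_orthogonal_image[OF plane_rotation_orthogonal, symmetric]
      plane_rotation_circle_pt by (simp add: add.commute)
  then show ?thesis
    using measure_orthogonal_image[OF plane_rotation_orthogonal sign_disagree_lmeasurable] by metis
qed

lemma negligible_circle_pt_orthogonal: "negligible {g. circle_pt a \<bullet> g = 0}"
proof (rule negligible_hyperplane)
  have "circle_pt a \<bullet> circle_pt a = (sin a)\<^sup>2 + (cos a)\<^sup>2"
    using e by (simp add: circle_pt_def inner_add_left inner_add_right inner_commute[of e2 e1]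
        flip: power2_eq_square)
  then show "circle_pt a \<noteq> 0 \<or> (0::real) \<noteq> 0"
    by auto
qed

text \<open>For nonnegative \<open>a\<close>, \<open>b\<close> with \<open>0 < a + b < pi\<close>
  this exhibits the middle point as a conic combination of the outer ones, so no hyperplane through
  the origin can strictly separate it from both.\<close>

lemma circle_pt_between: "sin (a + b) *\<^sub>R circle_pt a = sin b *\<^sub>R circle_pt 0 + sin a *\<^sub>R circle_pt (a + b)"
proof -
  have "sin (a + b) * cos a = sin b + sin a * cos (a + b)"
  proof -
    have "sin (a + b) * cos a - sin a * cos (a + b) = sin (a + b - a)"
      by (simp only: sin_diff mult.commute)
    then show ?thesis by simp
  qed
  then show ?thesis
    by (simp add: circle_pt_def scaleR_add_right scaleR_add_left[symmetric] mult.commute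
        flip: add.assoc)
qed

text \<open>Disagreement composes like exclusive or, so the set for \<open>a + b\<close> is the
  symmetric difference of the sets for the two arcs. On their overlap the outer points agree and the
  middle one differs, which the conic combination excludes. For \<open>a + b = pi\<close> the outer
  points are antipodal and agree only on a null set.\<close>

lemma measure_sign_disagree_add:
  assumes a: "0 \<le> a" and b: "0 \<le> b" and ab: "a + b \<le> pi"
  defines "m \<equiv> \<lambda>t. measure lebesgue (sign_disagree (circle_pt 0) (circle_pt t))"
  shows "m (a + b) = m a + m b"
proof -
  define D1 where "D1 = sign_disagree (circle_pt 0) (circle_pt a)"
  define D2 where "D2 = sign_disagree (circle_pt a) (circle_pt (a + b))"
  define D where "D = sign_disagree (circle_pt 0) (circle_pt (a + b))"
  have meas: "D1 \<in> lmeasurable" "D2 \<in> lmeasurable"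
    by (auto simp: D1_def D2_def sign_disagree_lmeasurable)
  have D: "D = (D1 \<union> D2) - (D1 \<inter> D2)"
    by (auto simp: D_def D1_def D2_def sign_disagree_def)
  have neg: "negligible (D1 \<inter> D2)"
  proof (rule negligible_subset[OF negligible_circle_pt_orthogonal[of 0]], rule subsetI)
    fix g assume "g \<in> D1 \<inter> D2"
    then have s: "(0 \<le> circle_pt 0 \<bullet> g) \<noteq> (0 \<le> circle_pt a \<bullet> g)"
      "(0 \<le> circle_pt a \<bullet> g) \<noteq> (0 \<le> circle_pt (a + b) \<bullet> g)"
      by (auto simp: D1_def D2_def sign_disagree_def)
    show "g \<in> {g. circle_pt 0 \<bullet> g = 0}"
    proof (cases "a + b = pi")
      case True
      then have "circle_pt (a + b) = - circle_pt 0"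
        by (simp add: circle_pt_def)
      then show ?thesis
        using s by auto
    next
      case False
      have sin: "0 \<le> sin a" "0 \<le> sin b"
        using a b ab by (auto intro: sin_ge_zero)
      have between: "sin (a + b) * (circle_pt a \<bullet> g) = sin b * (circle_pt 0 \<bullet> g) + sin a * (circle_pt (a + b) \<bullet> g)"
        using arg_cong[OF circle_pt_between, of "\<lambda>v. v \<bullet> g"] by (simp add: inner_add_left)
      show ?thesis
      proof (cases "a + b = 0")
        case True
        then have "a = 0" using a b by simp
        then show ?thesis using s by simp
      next
        case False
        then have pos: "0 < sin (a + b)"
          using \<open>a + b \<noteq> pi\<close> a b ab by (intro sin_gt_zero) auto
        have "sin a \<noteq> 0 \<or> sin b \<noteq> 0"
          using pos by (auto simp: sin_add)
        have False
        proof (cases "0 \<le> circle_pt 0 \<bullet> g")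
          case True
          then have "0 \<le> sin (a + b) * (circle_pt a \<bullet> g)"
            unfolding between using s sin by (intro add_nonneg_nonneg mult_nonneg_nonneg) auto
          then show False
            using pos s True by (simp add: zero_le_mult_iff)
        next
          case False
          then have lt: "circle_pt 0 \<bullet> g < 0" "circle_pt (a + b) \<bullet> g < 0" "0 \<le> circle_pt a \<bullet> g"
            using s by auto
          have "0 \<le> sin (a + b) * (circle_pt a \<bullet> g)"
            using lt pos by simp
          moreover have "sin b * (circle_pt 0 \<bullet> g) \<le> 0" "sin a * (circle_pt (a + b) \<bullet> g) \<le> 0"
            using lt sin by (auto intro: mult_nonneg_nonpos)
          ultimately have "sin b * (circle_pt 0 \<bullet> g) = 0" "sin a * (circle_pt (a + b) \<bullet> g) = 0"
            unfolding between by linarith+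
          then show False
            using lt \<open>sin a \<noteq> 0 \<or> sin b \<noteq> 0\<close> by auto
        qed
        then show ?thesis ..
      qed
    qed
  qed
  have "m (a + b) = measure lebesgue (D1 \<union> D2)"
    unfolding m_def D_def[symmetric]
    by (rule measure_negligible_symdiff) (auto simp: D meas fmeasurable.Un intro: negligible_subset[OF neg])
  also have "\<dots> = measure lebesgue D1 + measure lebesgue D2 - measure lebesgue (D1 \<inter> D2)"
    using meas by (rule measure_Un3)
  also have "measure lebesgue (D1 \<inter> D2) = 0"
    by (rule negligible_imp_measure0[OF neg])
  also have "measure lebesgue D2 = m b"
    unfolding D2_def m_def by (rule measure_sign_disagree_shift)
  finally show ?thesis
    by (simp add: m_def D1_def)
qed

text \<open>Additivity makes the measure linear in the angle. At \<open>pi\<close> the two points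
  are antipodal and disagree almost everywhere, which fixes the factor.\<close>

lemma measure_sign_disagree_circle_pt:
  assumes t: "0 \<le> t" "t \<le> pi"
  shows "measure lebesgue (sign_disagree (circle_pt 0) (circle_pt t)) = measure lebesgue (ball (0::real^'m::_) 1) * t / pi"
proof -
  have "measure lebesgue (sign_disagree (circle_pt 0) (circle_pt t))
     = measure lebesgue (sign_disagree (circle_pt 0) (circle_pt pi)) * t / pi"
    by (rule additive_nonneg_linear[where F="\<lambda>t. measure lebesgue (sign_disagree (circle_pt 0) (circle_pt t))"])
      (use t in \<open>auto intro: measure_sign_disagree_add\<close>)
  also have "measure lebesgue (sign_disagree (circle_pt 0) (circle_pt pi)) = measure lebesgue (ball (0::real^'m::_) 1)"
  proof (rule measure_negligible_symdiff)
    show "negligible (ball 0 1 - sign_disagree (circle_pt 0) (circle_pt pi)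
        \<union> (sign_disagree (circle_pt 0) (circle_pt pi) - ball 0 1))"
      by (rule negligible_subset[OF negligible_circle_pt_orthogonal[of 0]])
        (auto simp: sign_disagree_def circle_pt_def)
  qed auto
  finally show ?thesis .
qed

end

proposition measure_sign_disagree:
  fixes x y :: "real^'m::{finite,wellorder}"
  assumes dim: "2 \<le> CARD('m)" and x: "norm x = 1" and y: "norm y = 1"
  shows "measure lebesgue (sign_disagree x y) = measure lebesgue (ball (0::real^'m::_) 1) * arccos (x \<bullet> y) / pi"
proof -
  define c where "c = x \<bullet> y"
  have xx: "x \<bullet> x = 1" and yy: "y \<bullet> y = 1"
    using x y by (auto simp: norm_eq_1)
  have c: "- 1 \<le> c" "c \<le> 1"
    using Cauchy_Schwarz_ineq2[of x y] x y by (auto simp: c_def)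
  define t where "t = arccos c"
  have t: "0 \<le> t" "t \<le> pi" "cos t = c" "sin t = sqrt (1 - c\<^sup>2)"
    using c by (auto simp: t_def arccos_lbound arccos_ubound sin_arccos)
  define z where "z = y - c *\<^sub>R x"
  have xz: "x \<bullet> z = 0"
    by (simp add: z_def inner_diff_right xx c_def)
  have zz: "z \<bullet> z = 1 - c\<^sup>2"
    by (simp add: z_def inner_diff_left inner_diff_right xx yy c_def inner_commute[of y x] power2_eq_square)
  then have nz: "norm z = sin t"
    by (simp add: norm_eq_sqrt_inner t)
  have "\<exists>e2. x \<bullet> e2 = 0 \<and> e2 \<bullet> e2 = 1 \<and> z = sin t *\<^sub>R e2"
  proof (cases "z = 0")
    case True
    \<comment> \<open>Here \<open>y\<close> is \<open>x\<close> or \<open>- x\<close>, and any unit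
      vector orthogonal to \<open>x\<close> completes the plane.\<close>
    obtain v where v: "v \<noteq> 0" "orthogonal x v"
      using orthogonal_to_vector_exists[of x] dim by auto
    then show ?thesis
      using True nz by (intro exI[of _ "(1 / norm v) *\<^sub>R v"])
        (auto simp: orthogonal_def power2_eq_square simp flip: power2_norm_eq_inner)
  next
    case False
    then show ?thesis
      using xz nz by (intro exI[of _ "(1 / norm z) *\<^sub>R z"])
        (auto simp: power2_eq_square simp flip: power2_norm_eq_inner)
  qed
  then obtain e2 where e2: "x \<bullet> e2 = 0" "e2 \<bullet> e2 = 1" "z = sin t *\<^sub>R e2"
    by blast
  have "circle_pt x e2 0 = x" "circle_pt x e2 t = y"
    using e2(3) t(3) by (auto simp: circle_pt_def[OF xx e2(2,1)] z_def algebra_simps)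
  then show ?thesis
    using measure_sign_disagree_circle_pt[OF xx e2(2,1) t(1,2)] by (simp add: t_def c_def)
qed

section \<open>Sign patterns cut out by a random hyperplane\<close>

definition sgn_of :: "'n set \<Rightarrow> 'n \<Rightarrow> real" where
  "sgn_of S i = (if i \<in> S then 1 else - 1)"

text \<open>\<open>w S\<close> is the fraction of the unit ball on which exactly the vectors indexed
  by \<open>S\<close> have nonnegative product with \<open>g\<close>. A pattern realised with strict
  signs contains an open piece of the ball, hence has positive weight.\<close>

lemma sign_pattern_weights_vec:
  fixes X :: "'n::finite \<Rightarrow> real^'m::{finite,wellorder}"
  assumes dim: "2 \<le> CARD('m)" and unit: "\<And>i. i \<in> J \<Longrightarrow> norm (X i) = 1"
  shows "\<exists>w. (\<forall>S. 0 \<le> w S) \<and> (\<Sum>S\<in>Pow J. w S) = 1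
    \<and> (\<forall>i\<in>J. \<forall>j\<in>J. (\<Sum>S\<in>Pow J. w S * (sgn_of S i * sgn_of S j)) = 1 - 2 * arccos (X i \<bullet> X j) / pi)
    \<and> (\<forall>S\<in>Pow J. (\<exists>g. \<forall>i\<in>J. X i \<bullet> g = sgn_of S i) \<longrightarrow> 0 < w S)"
proof -
  define cell where "cell S = {g \<in> ball 0 1. {i\<in>J. 0 \<le> X i \<bullet> g} = S}" for S
  define V where "V = measure lebesgue (ball (0::real^'m::_) 1)"
  have V: "0 < V"
    by (simp add: V_def content_ball_pos)
  have meas: "cell S \<in> lmeasurable" for S
  proof (cases "S \<subseteq> J")
    case True
    then have "cell S = ball 0 1 \<inter> ((\<Inter>i\<in>S. {g. 0 \<le> X i \<bullet> g}) - (\<Union>i\<in>J - S. {g. 0 \<le> X i \<bullet> g}))"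
      by (auto simp: cell_def)
    also have "\<dots> \<in> lmeasurable"
    proof (intro fmeasurable_Int_fmeasurable lmeasurable_ball sets.Diff sets.finite_UN halfspace_sets_lebesgue)
      show "(\<Inter>i\<in>S. {g. 0 \<le> X i \<bullet> g}) \<in> sets lebesgue"
        by (cases "S = {}") (auto intro!: sets.finite_INT halfspace_sets_lebesgue)
    qed auto
    finally show ?thesis .
  next
    case False
    then have "cell S = {}"
      by (auto simp: cell_def)
    then show ?thesis by simp
  qed
  have sum_cells: "(\<Sum>S\<in>{S\<in>Pow J. Q S}. measure lebesgue (cell S))
      = measure lebesgue {g \<in> ball 0 1. Q {i\<in>J. 0 \<le> X i \<bullet> g}}" for Q
  proof -
    have "{g \<in> ball 0 1. Q {i\<in>J. 0 \<le> X i \<bullet> g}} = \<Union>(cell ` {S\<in>Pow J. Q S})"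
      by (auto simp: cell_def)
    moreover have "pairwise (\<lambda>S T. disjnt (cell S) (cell T)) {S\<in>Pow J. Q S}"
      by (auto simp: pairwise_def disjnt_def cell_def)
    ultimately show ?thesis
      using meas by (simp add: measure_UNION')
  qed
  define w where "w S = measure lebesgue (cell S) / V" for S
  have total: "(\<Sum>S\<in>Pow J. w S) = 1"
  proof -
    have "(\<Sum>S\<in>Pow J. measure lebesgue (cell S)) = V"
      using sum_cells[of "\<lambda>_. True"] unfolding V_def by (simp only: simp_thms Collect_mem_eq)
    then show ?thesis
      using V unfolding w_def sum_divide_distrib[symmetric] by simp
  qed
  have corr: "(\<Sum>S\<in>Pow J. w S * (sgn_of S i * sgn_of S j)) = 1 - 2 * arccos (X i \<bullet> X j) / pi"
    if i: "i \<in> J" and j: "j \<in> J" for i j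
  proof -
    have "(\<Sum>S\<in>Pow J. w S * (sgn_of S i * sgn_of S j))
        = (\<Sum>S\<in>Pow J. w S - 2 * (if (i \<in> S) \<noteq> (j \<in> S) then w S else 0))"
      by (intro sum.cong) (auto simp: sgn_of_def)
    also have "\<dots> = 1 - 2 * (\<Sum>S\<in>{S\<in>Pow J. (i \<in> S) \<noteq> (j \<in> S)}. w S)"
      unfolding sum_subtractf total sum_distrib_left[symmetric] by (subst sum.inter_filter) auto
    also have "(\<Sum>S\<in>{S\<in>Pow J. (i \<in> S) \<noteq> (j \<in> S)}. w S)
        = measure lebesgue {g \<in> ball 0 1. (i \<in> {i\<in>J. 0 \<le> X i \<bullet> g}) \<noteq> (j \<in> {i\<in>J. 0 \<le> X i \<bullet> g})} / V"
      unfolding w_def sum_divide_distrib[symmetric] sum_cells ..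
    also have "{g \<in> ball 0 1. (i \<in> {i\<in>J. 0 \<le> X i \<bullet> g}) \<noteq> (j \<in> {i\<in>J. 0 \<le> X i \<bullet> g})} = sign_disagree (X i) (X j)"
      using i j by (auto simp: sign_disagree_def)
    also have "measure lebesgue (sign_disagree (X i) (X j)) = V * arccos (X i \<bullet> X j) / pi"
      unfolding V_def by (rule measure_sign_disagree[OF dim unit[OF i] unit[OF j]])
    finally show ?thesis
      using V by simp
  qed
  have pos: "0 < w S" if S: "S \<in> Pow J" and g: "\<And>i. i \<in> J \<Longrightarrow> X i \<bullet> g = sgn_of S i" for S g
  proof -
    define U where "U = ball 0 1 \<inter> (\<Inter>i\<in>S. {h. 0 < X i \<bullet> h}) \<inter> (\<Inter>i\<in>J - S. {h. X i \<bullet> h < 0})"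
    have "open U"
      unfolding U_def by (intro open_Int open_INT ballI open_halfspace_gt open_halfspace_lt open_ball) auto
    moreover have "(1 / (1 + norm g)) *\<^sub>R g \<in> U"
    proof -
      have "0 < 1 + norm g"
        by (simp add: add_pos_nonneg)
      then show ?thesis
        using S g by (auto simp: U_def sgn_of_def field_simps)
    qed
    ultimately have "\<not> negligible U"
      using open_not_negligible by blast
    moreover have "U \<subseteq> cell S"
      using S by (force simp: U_def cell_def)
    ultimately have "\<not> negligible (cell S)"
      using negligible_subset by blast
    then have "measure lebesgue (cell S) \<noteq> 0"
      using meas negligible_iff_measure by blast
    then show ?thesis
      using V by (simp add: w_def order_less_le)
  qed
  have nonneg: "0 \<le> w S" for S
    using V by (simp add: w_def)
  show ?thesis
    using total corr pos nonneg by (intro exI[of _ w]) blast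
qed

text \<open>The library's measure theory of linear maps needs a well-ordered index type; the even-sized
  type \<open>'n bit0\<close> provides one with enough room for the vectors.\<close>
lemma sign_pattern_weights:
  fixes X :: "'n::finite \<Rightarrow> (real^'n) \<times> real"
  assumes unit: "\<And>i. i \<in> J \<Longrightarrow> norm (X i) = 1"
  shows "\<exists>w. (\<forall>S. 0 \<le> w S) \<and> (\<Sum>S\<in>Pow J. w S) = 1
    \<and> (\<forall>i\<in>J. \<forall>j\<in>J. (\<Sum>S\<in>Pow J. w S * (sgn_of S i * sgn_of S j)) = 1 - 2 * arccos (X i \<bullet> X j) / pi)
    \<and> (\<forall>S\<in>Pow J. (\<exists>g. \<forall>i\<in>J. X i \<bullet> g = sgn_of S i) \<longrightarrow> 0 < w S)"
proof -
  have "0 < CARD('n)"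
    by simp
  then have "dim (UNIV :: ((real^'n) \<times> real) set) \<le> dim (UNIV :: (real^'n bit0) set)"
    by (simp add: dim_UNIV)
  then obtain f :: "(real^'n) \<times> real \<Rightarrow> real^'n bit0" where f: "linear f" "\<And>x. norm (f x) = norm x"
    using isometry_subset_subspace[OF subspace_UNIV subspace_UNIV] by (metis UNIV_I)
  have fi: "f x \<bullet> f y = x \<bullet> y" for x y
    using f by (simp add: dot_norm linear_add[OF f(1), symmetric])
  have "2 \<le> CARD('n bit0)"
    using \<open>0 < CARD('n)\<close> by simp
  moreover have "norm (f (X i)) = 1" if "i \<in> J" for i
    using unit[OF that] f(2) by simp
  ultimately obtain w where w: "\<forall>S. 0 \<le> w S" "(\<Sum>S\<in>Pow J. w S) = 1"
    "\<forall>i\<in>J. \<forall>j\<in>J. (\<Sum>S\<in>Pow J. w S * (sgn_of S i * sgn_of S j)) = 1 - 2 * arccos (f (X i) \<bullet> f (X j)) / pi"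
    "\<forall>S\<in>Pow J. (\<exists>g. \<forall>i\<in>J. f (X i) \<bullet> g = sgn_of S i) \<longrightarrow> 0 < w S"
    using sign_pattern_weights_vec[of J "\<lambda>i. f (X i)"] by blast
  have "0 < w S" if "S \<in> Pow J" "\<forall>i\<in>J. X i \<bullet> g = sgn_of S i" for S g
  proof -
    have "\<forall>i\<in>J. f (X i) \<bullet> f g = sgn_of S i"
      using that(2) fi by simp
    then show ?thesis
      using w(4) that(1) by blast
  qed
  then show ?thesis
    using w(1,2,3) by (intro exI[of _ w]) (auto simp: fi)
qed

text \<open>An odd number of signs sums to an odd integer, which cannot be 0.\<close>

lemma odd_sum_sgn_of_square_ge_1:
  assumes "finite J" "odd (card J)"
  shows "1 \<le> (\<Sum>i\<in>J. sgn_of S i)\<^sup>2"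
proof -
  define z where "z = (\<Sum>i\<in>J. if i \<in> S then 1 else - 1 :: int)"
  have "odd z \<longleftrightarrow> odd (card J)"
    using assms(1) unfolding z_def by (induction J rule: finite_induct) auto
  then have "odd z"
    using assms(2) by simp
  then have "1 \<le> z\<^sup>2"
    by (metis dvd_0_right int_one_le_iff_zero_less zero_less_power2)
  moreover have "(\<Sum>i\<in>J. sgn_of S i) = of_int z"
    unfolding z_def of_int_sum by (intro sum.cong) (auto simp: sgn_of_def)
  ultimately show ?thesis
    by (metis of_int_1_le_iff of_int_power)
qed

text \<open>The double sum is the expected square of the sum of the random signs. For five vectors
  this is the pentagonal inequality.\<close>

lemma odd_clique_inequality:
  fixes X :: "'n::finite \<Rightarrow> (real^'n) \<times> real"
  assumes unit: "\<And>i. i \<in> J \<Longrightarrow> norm (X i) = 1" and odd: "odd (card J)"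
  shows "1 \<le> (\<Sum>i\<in>J. \<Sum>j\<in>J. 1 - 2 * arccos (X i \<bullet> X j) / pi)"
proof -
  obtain w where w: "\<forall>S. 0 \<le> w S" "(\<Sum>S\<in>Pow J. w S) = 1"
    "\<forall>i\<in>J. \<forall>j\<in>J. (\<Sum>S\<in>Pow J. w S * (sgn_of S i * sgn_of S j)) = 1 - 2 * arccos (X i \<bullet> X j) / pi"
    using sign_pattern_weights[of J X, OF unit] by blast
  have "1 = (\<Sum>S\<in>Pow J. w S * 1)"
    using w(2) by simp
  also have "\<dots> \<le> (\<Sum>S\<in>Pow J. w S * (\<Sum>i\<in>J. sgn_of S i)\<^sup>2)"
    using w(1) odd by (intro sum_mono mult_left_mono odd_sum_sgn_of_square_ge_1) auto
  also have "\<dots> = (\<Sum>S\<in>Pow J. \<Sum>i\<in>J. \<Sum>j\<in>J. w S * (sgn_of S i * sgn_of S j))"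
    by (simp only: power2_eq_square sum_product) (simp add: sum_distrib_left)
  also have "\<dots> = (\<Sum>i\<in>J. \<Sum>S\<in>Pow J. \<Sum>j\<in>J. w S * (sgn_of S i * sgn_of S j))"
    by (rule sum.swap)
  also have "\<dots> = (\<Sum>i\<in>J. \<Sum>j\<in>J. \<Sum>S\<in>Pow J. w S * (sgn_of S i * sgn_of S j))"
    by (intro sum.cong refl sum.swap)
  also have "\<dots> = (\<Sum>i\<in>J. \<Sum>j\<in>J. 1 - 2 * arccos (X i \<bullet> X j) / pi)"
    using w(3) by (intro sum.cong refl) blast
  finally show ?thesis .
qed

subsection \<open>The cut polytope\<close>

text \<open>Subsets of \<open>J\<close> index the vertices, but not injectively: \<open>S\<close>
  and \<open>J - S\<close> give the same matrix.\<close>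

definition cut_vertex :: "'n set \<Rightarrow> 'n set \<Rightarrow> real^'n^'n" where
  "cut_vertex J S = submat J (\<chi> i j. sgn_of S i * sgn_of S j)"

lemma maxcut_eq:
  fixes J :: "'n::finite set"
  shows "maxcut J = convex hull (cut_vertex J ` Pow J)"
proof -
  have "{submat J (\<chi> i j. v i * v j) | v :: 'n \<Rightarrow> real. \<forall>i. v i = 1 \<or> v i = -1} = cut_vertex J ` Pow J"
  proof (intro equalityI subsetI)
    fix M assume "M \<in> {submat J (\<chi> i j. v i * v j) | v :: 'n \<Rightarrow> real. \<forall>i. v i = 1 \<or> v i = -1}"
    then obtain v where v: "M = submat J (\<chi> i j. v i * v j)" "\<forall>i. v i = 1 \<or> v i = -1"
      by blast
    have sv: "sgn_of {i\<in>J. v i = 1} i = v i" if "i \<in> J" for i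
      using v(2) that by (auto simp: sgn_of_def)
    then have "M = cut_vertex J {i\<in>J. v i = 1}"
      by (auto simp: v(1) cut_vertex_def submat_def vec_eq_iff)
    then show "M \<in> cut_vertex J ` Pow J"
      by blast
  next
    fix M assume "M \<in> cut_vertex J ` Pow J"
    then obtain S where "M = submat J (\<chi> i j. sgn_of S i * sgn_of S j)"
      by (auto simp: cut_vertex_def)
    moreover have "\<forall>i. sgn_of S i = 1 \<or> sgn_of S i = - 1"
      by (simp add: sgn_of_def)
    ultimately show "M \<in> {submat J (\<chi> i j. v i * v j) | v :: 'n \<Rightarrow> real. \<forall>i. v i = 1 \<or> v i = -1}"
      by blast
  qed
  then show ?thesis
    by (simp add: maxcut_def)
qed

lemma submat_eq_sum_cut_vertex:
  fixes B :: "real^'n^'n"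
  assumes "\<And>i j. i \<in> J \<Longrightarrow> j \<in> J \<Longrightarrow> (\<Sum>S\<in>Pow J. w S * (sgn_of S i * sgn_of S j)) = B $ i $ j"
  shows "submat J B = (\<Sum>S\<in>Pow J. w S *\<^sub>R cut_vertex J S)"
  using assms by (auto simp: vec_eq_iff submat_def cut_vertex_def)

lemma submat_in_maxcut:
  fixes B :: "real^'n^'n"
  assumes "\<And>S. 0 \<le> w S" "(\<Sum>S\<in>Pow J. w S) = 1"
    and "\<And>i j. i \<in> J \<Longrightarrow> j \<in> J \<Longrightarrow> (\<Sum>S\<in>Pow J. w S * (sgn_of S i * sgn_of S j)) = B $ i $ j"
  shows "submat J B \<in> maxcut J"
proof -
  have "submat J B = (\<Sum>S\<in>Pow J. w S *\<^sub>R cut_vertex J S)"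
    by (rule submat_eq_sum_cut_vertex) (rule assms(3))
  also have "\<dots> \<in> convex hull (cut_vertex J ` Pow J)"
    using assms(1,2) by (intro convex_sum) (auto intro: hull_inc)
  finally show ?thesis
    by (simp add: maxcut_eq)
qed

lemma submat_in_rel_interior_maxcut:
  fixes B :: "real^'n^'n"
  assumes pos: "\<And>S. S \<in> Pow J \<Longrightarrow> 0 < w S" and total: "(\<Sum>S\<in>Pow J. w S) = 1"
    and "\<And>i j. i \<in> J \<Longrightarrow> j \<in> J \<Longrightarrow> (\<Sum>S\<in>Pow J. w S * (sgn_of S i * sgn_of S j)) = B $ i $ j"
  shows "submat J B \<in> rel_interior (maxcut J)"
proof -
  let ?T = "cut_vertex J ` Pow J"
  \<comment> \<open>The criterion for the relative interior asks for one positive coefficient per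
    vertex, so the weights of all sets giving the same vertex are added.\<close>
  define u where "u M = (\<Sum>S\<in>{S\<in>Pow J. cut_vertex J S = M}. w S)" for M
  have "\<forall>M\<in>?T. 0 < u M"
    unfolding u_def using pos by (auto intro!: sum_pos)
  moreover have "sum u ?T = 1"
    unfolding u_def using total by (subst sum.image_gen[symmetric]) auto
  moreover have "(\<Sum>M\<in>?T. u M *\<^sub>R M) = submat J B"
  proof -
    have "submat J B = (\<Sum>S\<in>Pow J. w S *\<^sub>R cut_vertex J S)"
      by (rule submat_eq_sum_cut_vertex) (use assms in auto)
    also have "\<dots> = (\<Sum>M\<in>?T. \<Sum>S\<in>{S\<in>Pow J. cut_vertex J S = M}. w S *\<^sub>R cut_vertex J S)"
      by (rule sum.image_gen) auto
    also have "\<dots> = (\<Sum>M\<in>?T. u M *\<^sub>R M)"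
      unfolding u_def scaleR_sum_left by (intro sum.cong) auto
    finally show ?thesis ..
  qed
  ultimately have "submat J B \<in> {M. \<exists>u. (\<forall>N\<in>?T. 0 < u N) \<and> sum u ?T = 1 \<and> (\<Sum>N\<in>?T. u N *\<^sub>R N) = M}"
    by blast
  then show ?thesis
    unfolding maxcut_eq using explicit_subset_rel_interior_convex_hull_minimal[of ?T] by auto
qed

subsection \<open>Triples and quintuples\<close>

lemma quad_form_sum_on:
  fixes A :: "real^'n^'n"
  assumes "supp x \<subseteq> J"
  shows "x \<bullet> (A *v x) = (\<Sum>i\<in>J. \<Sum>j\<in>J. A $ i $ j * x $ i * x $ j)"
proof -
  have x0: "x $ i = 0" if "i \<notin> J" for i
    using assms that by (auto simp: supp_def)
  have "x \<bullet> (A *v x) = (\<Sum>i\<in>J. \<Sum>j\<in>UNIV. A $ i $ j * x $ i * x $ j)"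
    unfolding quad_form_sum by (intro sum.mono_neutral_right) (auto simp: x0)
  also have "\<dots> = (\<Sum>i\<in>J. \<Sum>j\<in>J. A $ i $ j * x $ i * x $ j)"
    by (intro sum.cong refl sum.mono_neutral_right) (auto simp: x0)
  finally show ?thesis .
qed

lemma quad_form_triple:
  fixes A :: "real^'n^'n"
  assumes "supp x \<subseteq> {i, j, k}" and d: "i \<noteq> j" "i \<noteq> k" "j \<noteq> k"
    and sym: "symmetric_mat A" and diag: "\<forall>i. A $ i $ i = 1"
  shows "x \<bullet> (A *v x) = (x $ i)\<^sup>2 + (x $ j)\<^sup>2 + (x $ k)\<^sup>2 + 2 * A $ i $ j * x $ i * x $ j
     + 2 * A $ i $ k * x $ i * x $ k + 2 * A $ j $ k * x $ j * x $ k"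
proof -
  have s: "A $ j $ i = A $ i $ j" "A $ k $ i = A $ i $ k" "A $ k $ j = A $ j $ k"
    using sym by (auto simp: symmetric_mat_iff)
  show ?thesis
    unfolding quad_form_sum_on[OF assms(1)] using d diag
    by (simp add: s algebra_simps power2_eq_square)
qed

text \<open>The form belongs to the Gram matrix of the planar unit vectors \<open>(1, 0)\<close>,
  \<open>(- cos c, sin c)\<close> and \<open>(- cos b, - sin b)\<close>. The assumption, which holds
  for \<open>a + b + c = pi\<close>, identifies the product of the last two.\<close>

lemma triangle_form_eq:
  fixes a b c x y z :: real
  assumes "cos a = - cos (b + c)"
  shows "x\<^sup>2 + y\<^sup>2 + z\<^sup>2 - 2 * cos c * x * y - 2 * cos b * x * z - 2 * cos a * y * z
    = (x - y * cos c - z * cos b)\<^sup>2 + (y * sin c - z * sin b)\<^sup>2"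
proof -
  have a: "cos a = sin b * sin c - cos b * cos c"
    using assms by (simp add: cos_add)
  have "(cos b)\<^sup>2 + (sin b)\<^sup>2 = 1" "(cos c)\<^sup>2 + (sin c)\<^sup>2 = 1"
    by simp_all
  with a show ?thesis
    by algebra
qed

text \<open>The side lengths of a triangle with angles \<open>a\<close>, \<open>b\<close>,
  \<open>c0\<close> annihilate its form, and by the law of sines they are proportional to the sines.
  Passing from \<open>c0\<close> to the smaller angle \<open>c\<close> can only lower the
  value.\<close>

lemma triangle_form_nonpos:
  fixes a b c :: real
  assumes "0 < a" "0 < b" "0 < c" "a + b + c \<le> pi"
  shows "\<exists>x>0. \<exists>y>0. \<exists>z>0.
    x\<^sup>2 + y\<^sup>2 + z\<^sup>2 - 2 * cos c * x * y - 2 * cos b * x * z - 2 * cos a * y * z \<le> 0"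
proof -
  define c0 where "c0 = pi - a - b"
  have pos: "0 < sin a" "0 < sin b" "0 < sin c0"
    using assms by (auto intro!: sin_gt_zero simp: c0_def)
  have "cos c0 \<le> cos c"
    using assms by (intro cos_monotone_0_pi_le) (auto simp: c0_def)
  have a: "a = pi - (b + c0)"
    by (simp add: c0_def)
  have ca: "cos a = - cos (b + c0)"
    unfolding a by simp
  have sa: "sin a = sin b * cos c0 + sin c0 * cos b"
  proof -
    have "sin a = sin (b + c0)"
      unfolding a by simp
    then show ?thesis
      by (simp add: sin_add)
  qed
  have "(sin a)\<^sup>2 + (sin b)\<^sup>2 + (sin c0)\<^sup>2 - 2 * cos c * sin a * sin b - 2 * cos b * sin a * sin c0
      - 2 * cos a * sin b * sin c0
    \<le> (sin a)\<^sup>2 + (sin b)\<^sup>2 + (sin c0)\<^sup>2 - 2 * cos c0 * sin a * sin b - 2 * cos b * sin a * sin c0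
      - 2 * cos a * sin b * sin c0"
    using \<open>cos c0 \<le> cos c\<close> pos by (simp add: mult_right_mono)
  also have "\<dots> = (sin a - sin b * cos c0 - sin c0 * cos b)\<^sup>2 + (sin b * sin c0 - sin c0 * sin b)\<^sup>2"
    by (rule triangle_form_eq[OF ca])
  also have "\<dots> = 0"
    by (simp add: sa)
  finally show ?thesis
    using pos by blast
qed

text \<open>Comparison with the triangle with angles \<open>a\<close>, \<open>b\<close> and
  \<open>c0 = pi - a - b < c\<close>: its form is a sum of two squares, and the given one exceeds it
  by \<open>2 * ((cos c0 - cos c) * (x * y))\<close>. All three terms vanish only at the origin of
  the orthant.\<close>

lemma triangle_form_pos:
  fixes a b c x y z :: real
  assumes a: "0 < a" "a < pi" and b: "0 < b" "b < pi" and c: "0 < c" "c < pi"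
    and sum: "pi < a + b + c"
    and xyz: "0 \<le> x" "0 \<le> y" "0 \<le> z" "x \<noteq> 0 \<or> y \<noteq> 0 \<or> z \<noteq> 0"
  shows "0 < x\<^sup>2 + y\<^sup>2 + z\<^sup>2 - 2 * cos c * x * y - 2 * cos b * x * z - 2 * cos a * y * z"
    (is "0 < ?F")
proof (rule ccontr)
  assume contra: "\<not> 0 < ?F"
  have sb: "0 < sin b"
    using b by (intro sin_gt_zero)
  have xy0: "0 \<le> x * y" and yz0: "0 \<le> y * z"
    using xyz by auto
  show False
  proof (cases "a + b < pi")
    case True
    define c0 where "c0 = pi - a - b"
    have lt: "cos c < cos c0"
      using True a b c sum by (intro cos_monotone_0_pi) (auto simp: c0_def)
    have sc0: "0 < sin c0"
      using True a b by (intro sin_gt_zero) (auto simp: c0_def)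
    have ca: "cos a = - cos (b + c0)"
      by (simp add: c0_def cos_diff)
    have F: "?F = (x - y * cos c0 - z * cos b)\<^sup>2 + (y * sin c0 - z * sin b)\<^sup>2 + 2 * ((cos c0 - cos c) * (x * y))"
      unfolding triangle_form_eq[OF ca, symmetric] by (simp add: algebra_simps)
    have "0 \<le> (cos c0 - cos c) * (x * y)"
      using lt xy0 by simp
    then have e: "(cos c0 - cos c) * (x * y) = 0" "(x - y * cos c0 - z * cos b)\<^sup>2 = 0" "(y * sin c0 - z * sin b)\<^sup>2 = 0"
      using contra zero_le_power2[of "x - y * cos c0 - z * cos b"] zero_le_power2[of "y * sin c0 - z * sin b"]
      unfolding F by linarith+
    then have "x = 0 \<or> y = 0"
      using lt by simp
    then show False
    proof
      assume "y = 0"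
      then show False
        using e sb xyz by auto
    next
      assume x: "x = 0"
      then have 1: "y * cos c0 + z * cos b = 0" and 2: "y * sin c0 = z * sin b"
        using e by auto
      have "z * sin (b + c0) = 0"
      proof -
        have "z * sin (b + c0) = (z * sin b) * cos c0 + z * cos b * sin c0"
          by (simp add: sin_add algebra_simps)
        also have "\<dots> = (y * cos c0 + z * cos b) * sin c0"
          by (simp add: 2[symmetric] algebra_simps)
        finally show ?thesis
          using 1 by simp
      qed
      moreover have "0 < sin (b + c0)"
        using a by (intro sin_gt_zero) (auto simp: c0_def)
      ultimately have "z = 0" by simp
      then show False
        using 2 sc0 x xyz by auto
    qed
  next
    case False
    \<comment> \<open>There is no such triangle for \<open>a + b \<ge> pi\<close>. Its place is
      taken by the degenerate one with \<open>c0 = 0\<close>, after bounding \<open>cos a\<close> by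
      \<open>- cos b\<close>.\<close>
    have "cos a \<le> cos (pi - b)"
      using False a b by (intro cos_monotone_0_pi_le) auto
    then have "cos a * (y * z) \<le> (- cos b) * (y * z)"
      using yz0 by (intro mult_right_mono) auto
    moreover have "(x - y - z * cos b)\<^sup>2 + z\<^sup>2 * (sin b)\<^sup>2 + 2 * ((1 - cos c) * (x * y))
      = x\<^sup>2 + y\<^sup>2 + z\<^sup>2 - 2 * cos c * x * y - 2 * cos b * x * z + 2 * (cos b * (y * z))"
      unfolding sin_squared_eq by (simp add: algebra_simps power2_eq_square)
    ultimately have F: "(x - y - z * cos b)\<^sup>2 + z\<^sup>2 * (sin b)\<^sup>2 + 2 * ((1 - cos c) * (x * y)) \<le> ?F"
      by (simp add: algebra_simps)
    have c1: "cos c < 1"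
      using cos_monotone_0_pi[of 0 c] c by simp
    then have "0 \<le> (1 - cos c) * (x * y)"
      using xy0 by simp
    moreover have "0 \<le> z\<^sup>2 * (sin b)\<^sup>2"
      by simp
    ultimately have e: "(1 - cos c) * (x * y) = 0" "z\<^sup>2 * (sin b)\<^sup>2 = 0" "(x - y - z * cos b)\<^sup>2 = 0"
      using contra F zero_le_power2[of "x - y - z * cos b"] by linarith+
    then have "x = 0 \<or> y = 0" "z = 0"
      using c1 sb by auto
    then show False
      using e xyz by auto
  qed
qed

text \<open>Eliminating one variable from the kernel equations gives
  \<open>cos q + cos p * cos r = sin p * sin r\<close> up to sign, and positivity of the kernel
  vector selects the sign. The spurious solution \<open>q = p + r - pi\<close> cannot hold for both
  \<open>a\<close> and \<open>b\<close>, since that would give \<open>c = pi\<close>.\<close>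

lemma triangle_angle_sum:
  fixes a b c x y z :: real
  assumes a: "0 < a" "a < pi" and b: "0 < b" "b < pi" and c: "0 < c" "c < pi"
    and pos: "0 < x" "0 < y" "0 < z"
    and e: "x = cos c * y + cos b * z" "y = cos c * x + cos a * z" "z = cos b * x + cos a * y"
  shows "a + b + c = pi"
proof -
  have key: "q = pi - p - r \<or> q = p + r - pi"
    if "0 < p" "p < pi" "0 < q" "q < pi" "0 < r" "r < pi" "0 < u" "0 < v" "0 < t"
      "u = cos r * v + cos q * t" "v = cos r * u + cos p * t" "t = cos q * u + cos p * v"
    for p q r u v t :: real
  proof -
    have sr: "0 < sin r" and sp: "0 < sin p"
      using that(1,2,5,6) by (auto intro: sin_gt_zero)
    have "u * (sin r)\<^sup>2 = (cos q + cos p * cos r) * t"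
      using that(10,11) unfolding sin_squared_eq by algebra
    moreover have "t * (sin p)\<^sup>2 = (cos q + cos p * cos r) * u"
      using that(11,12) unfolding sin_squared_eq by algebra
    ultimately have 1: "(cos q + cos p * cos r)\<^sup>2 * (t * u) = (sin p * sin r)\<^sup>2 * (t * u)"
      by algebra
    have "0 < u * (sin r)\<^sup>2"
      using that(7) sr by simp
    then have "0 < cos q + cos p * cos r"
      using \<open>u * (sin r)\<^sup>2 = _\<close> that(9) by (simp add: zero_less_mult_iff)
    moreover have "(cos q + cos p * cos r)\<^sup>2 = (sin p * sin r)\<^sup>2"
      using 1 that(7,9) by simp
    ultimately have "cos q + cos p * cos r = sin p * sin r"
      using sr sp by (metis less_imp_le mult_nonneg_nonneg power2_eq_iff_nonneg)
    then have cq: "cos q = - cos (p + r)"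
      by (simp add: cos_add)
    show ?thesis
    proof (cases "p + r \<le> pi")
      case True
      have "cos q = cos (pi - p - r)"
        using cq by (simp add: diff_diff_eq)
      then have "q = pi - p - r"
        using cos_inj_pi[of q "pi - p - r"] True that(1-6) by auto
      then show ?thesis ..
    next
      case False
      have "cos q = cos (p + r - pi)"
        using cq by simp
      then have "q = p + r - pi"
        using cos_inj_pi[of q "p + r - pi"] False that(1-6) by auto
      then show ?thesis ..
    qed
  qed
  have "b = pi - a - c \<or> b = a + c - pi"
    by (rule key[OF a b c pos e])
  moreover have "a = pi - b - c \<or> a = b + c - pi"
    by (rule key[OF b a c pos(2,1,3) e(2,1)]) (use e(3) in \<open>simp add: add.commute\<close>)
  ultimately show ?thesis
    using c by linarith
qed

section \<open>The pentagonal inequality for copositive matrices\<close>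

lemma arccos_minus_cos: "0 \<le> t \<Longrightarrow> t \<le> pi \<Longrightarrow> arccos (- cos t) = pi - t"
  using arccos_cos[of "pi - t"] by simp

text \<open>The five by five matrix with unit diagonal and all other entries
  \<open>- cos (3 * pi / 8)\<close> therefore has negative row sums, and its form is negative at the
  all-ones vector.\<close>

lemma cos_3pi_8_gt: "1 / 4 < cos (3 * pi / 8)"
proof -
  have "cos (3 * pi / 4) = - (sqrt 2 / 2)"
  proof -
    have "cos (3 * pi / 4) = cos (pi - pi / 4)"
      by simp
    then show ?thesis
      by (simp only: cos_pi_minus cos_45)
  qed
  moreover have "cos (3 * pi / 4) = 2 * (cos (3 * pi / 8))\<^sup>2 - 1"
    using cos_double_cos[of "3 * pi / 8"] by simp
  moreover have "sqrt 2 < 3 / 2"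
    by (rule real_less_lsqrt) (auto simp: power2_eq_square)
  ultimately have "(1 / 4)\<^sup>2 < (cos (3 * pi / 8))\<^sup>2"
    by (simp add: power2_eq_square)
  moreover have "0 \<le> cos (3 * pi / 8)"
    by (rule cos_ge_zero) auto
  ultimately show ?thesis
    by (rule power2_less_imp_less)
qed

text \<open>If the angle sum were smaller than \<open>13\<pi>\<close> (each off-diagonal angle being counted twice), one could
  perturb the angles to make the matrix strictly copositive, and then move them linearly towards
  \<open>3\<pi>/8\<close>, where copositivity is lost. All sums over triples stay above \<open>\<pi>\<close> on the way, so that the
  first zero that appears has at least four positive entries, and the matrix then dominates a
  positive semidefinite one, for which the pentagonal inequality is known.\<close>
lemma copositive_pentagon:
  fixes A :: "real^'n^'n"
  assumes cop: "A \<in> copositive_cone" and diag: "\<forall>i. A $ i $ i = 1" and le1: "\<And>i j. A $ i $ j \<le> 1"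
    and J: "card J = 5"
  shows "13 * pi \<le> (\<Sum>i\<in>J. \<Sum>j\<in>J. arccos (- (A $ i $ j)))"
proof (rule ccontr)
  assume contra: "\<not> ?thesis"
  have sym: "A $ i $ j = A $ j $ i" for i j
    using copositiveD(1)[OF cop] by (simp add: symmetric_mat_iff)
  have finJ: "finite J" by simp
  define \<phi> where "\<phi> i j = arccos (- (A $ i $ j))" for i j
  have \<phi>: "0 \<le> \<phi> i j" "\<phi> i j \<le> pi" "cos (\<phi> i j) = - (A $ i $ j)" for i j
    using copositive_entry_ge[OF cop diag, of i j] le1[of i j]
    by (auto simp: \<phi>_def arccos_lbound arccos_ubound)
  define S where "S = (\<Sum>i\<in>J. \<Sum>j\<in>J. \<phi> i j)"
  have S: "S < 13 * pi"
    using contra by (simp add: S_def \<phi>_def)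
  \<comment> \<open>Each of the 25 angles grows by at most \<open>e\<close>, which uses up at most
    half of the gap to \<open>13 * pi\<close>.\<close>
  define e where "e = (13 * pi - S) / 50"
  have e: "0 < e"
    using S by (simp add: e_def)
  \<comment> \<open>Capping at \<open>pi\<close> leaves entries equal to 1 unchanged and keeps all
    angles where the cosine is monotone.\<close>
  define \<phi>' where "\<phi>' i j = min (\<phi> i j + e) pi" for i j
  \<comment> \<open>The target \<open>3 * pi / 8\<close> lies between \<open>pi / 3\<close> and
    \<open>2 * pi / 5\<close>: triples sum to more than \<open>pi\<close>, yet the total of all 25
    angles is \<open>25 / 2 * pi\<close>, below \<open>13 * pi\<close>. Its cosine exceeds
    \<open>1 / 4\<close>, so copositivity fails at \<open>t = 1\<close>.\<close>
  define \<psi> where "\<psi> t i j = (1 - t) * \<phi>' i j + t * (if i = j then pi else 3 * pi / 8)" for t i j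
  have \<phi>': "0 < \<phi>' i j" "\<phi>' i j \<le> pi" for i j
    using \<phi>[of i j] e by (auto simp: \<phi>'_def)
  have \<phi>ii: "\<phi>' i i = pi" for i
    using diag e by (simp add: \<phi>'_def \<phi>_def)
  have \<psi>ii: "\<psi> t i i = pi" for t i
    by (simp add: \<psi>_def \<phi>ii algebra_simps)
  have \<phi>'sym: "\<phi>' i j = \<phi>' j i" for i j
    using sym[of i j] by (simp add: \<phi>'_def \<phi>_def)
  have \<psi>sym: "\<psi> t i j = \<psi> t j i" for t i j
    using \<phi>'sym[of i j] by (simp add: \<psi>_def)
  define g where "g t x = (\<Sum>i\<in>J. \<Sum>j\<in>J. - cos (\<psi> t i j) * x $ i * x $ j)" for t and x :: "real^'n"
  have g_scale: "g t (c *\<^sub>R x) = c\<^sup>2 * g t x" for t c x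
    by (simp add: g_def sum_distrib_left power2_eq_square mult_ac)
  \<comment> \<open>The perturbation strictly raises every entry different from 1. If the form were
    nonpositive at \<open>x\<close>, only products belonging to entries 1 could be nonzero, and the
    form would be the square of the coordinate sum.\<close>
  have g0: "0 < g 0 x" if x: "nonneg_vec x" "supp x \<subseteq> J" "x \<noteq> 0" for x
  proof (rule ccontr)
    assume neg: "\<not> 0 < g 0 x"
    have x0: "0 \<le> x $ i" for i
      using x by (simp add: nonneg_vec_def)
    have mono: "A $ i $ j \<le> - cos (\<phi>' i j)" for i j
      using cos_monotone_0_pi_le[of "\<phi> i j" "\<phi>' i j"] \<phi>[of i j] \<phi>'[of i j] e by (simp add: \<phi>'_def)
    have strict: "A $ i $ j < - cos (\<phi>' i j)" if "A $ i $ j \<noteq> 1" for i j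
    proof -
      have "\<phi> i j \<noteq> pi"
        using \<phi>(3)[of i j] that by auto
      then have "\<phi> i j < \<phi>' i j"
        using \<phi>(2)[of i j] e by (simp add: \<phi>'_def)
      from cos_monotone_0_pi[OF \<phi>(1) this \<phi>'(2)] show ?thesis
        using \<phi>(3)[of i j] by simp
    qed
    have "0 \<le> x \<bullet> (A *v x)"
      by (rule copositiveD(2)[OF cop x(1)])
    then have "(\<Sum>i\<in>J. \<Sum>j\<in>J. (- cos (\<phi>' i j) - A $ i $ j) * (x $ i * x $ j)) \<le> 0"
      using neg unfolding quad_form_sum_on[OF x(2)] g_def
      by (simp add: \<psi>_def left_diff_distrib sum_subtractf mult.assoc)
    moreover have nn: "0 \<le> (- cos (\<phi>' i j) - A $ i $ j) * (x $ i * x $ j)" for i j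
      using mono[of i j] x0 by (intro mult_nonneg_nonneg) auto
    ultimately have "(\<Sum>i\<in>J. \<Sum>j\<in>J. (- cos (\<phi>' i j) - A $ i $ j) * (x $ i * x $ j)) = 0"
      by (intro antisym sum_nonneg) auto
    then have z: "(- cos (\<phi>' i j) - A $ i $ j) * (x $ i * x $ j) = 0" if "i \<in> J" "j \<in> J" for i j
      using that nn by (simp add: sum_nonneg_eq_0_iff sum_nonneg)
    have "- cos (\<phi>' i j) * x $ i * x $ j = x $ i * x $ j" if "i \<in> J" "j \<in> J" for i j
    proof (cases "A $ i $ j = 1")
      case True
      then have "\<phi>' i j = pi"
        using e by (simp add: \<phi>'_def \<phi>_def)
      then show ?thesis by simp
    next
      case False
      then show ?thesis
        using z[OF that] strict[OF False] by auto
    qed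
    then have "g 0 x = (\<Sum>i\<in>J. \<Sum>j\<in>J. x $ i * x $ j)"
      unfolding g_def by (intro sum.cong refl) (simp add: \<psi>_def)
    also have "\<dots> = (\<Sum>i\<in>J. x $ i)\<^sup>2"
      by (simp add: power2_eq_square sum_product)
    finally have "(\<Sum>i\<in>J. x $ i) = 0"
      using neg by simp
    then have "\<forall>i\<in>J. x $ i = 0"
      using x0 by (simp add: sum_nonneg_eq_0_iff)
    then have "supp x = {}"
      using x(2) by (auto simp: supp_def)
    then show False
      using x(3) supp_empty_iff by blast
  qed
  define \<Delta> where "\<Delta> = {x::real^'n. nonneg_vec x \<and> supp x \<subseteq> J \<and> norm x = 1}"
  have "\<Delta> = (\<Inter>i. {y. 0 \<le> y $ i}) \<inter> (\<Inter>i\<in>-J. {y. y $ i = 0}) \<inter> sphere 0 1"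
    by (auto simp: \<Delta>_def nonneg_vec_def supp_def)
  then have compact\<Delta>: "compact \<Delta>"
    by (auto intro!: closed_Int_compact closed_INT closed_Int closed_Collect_le closed_Collect_eq
        continuous_intros)
  define Z where "Z = ({0..1} \<times> \<Delta>) \<inter> {p. g (fst p) (snd p) \<le> 0}"
  have "compact Z"
    unfolding Z_def
  proof (intro compact_Int_closed compact_Times compact\<Delta> closed_Collect_le continuous_intros)
    show "compact {0..1::real}" by simp
    show "continuous_on UNIV (\<lambda>p. g (fst p) (snd p))"
      unfolding g_def \<psi>_def by (intro continuous_intros)
  qed
  moreover have "Z \<noteq> {}"
  proof -
    define v :: "real^'n" where "v = (\<chi> i. if i \<in> J then 1 else 0)"
    have "g 1 v = (\<Sum>i\<in>J. \<Sum>j\<in>J. if i = j then 1 else - cos (3 * pi / 8))"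
      unfolding g_def by (intro sum.cong refl) (auto simp: v_def \<psi>_def)
    also have "\<dots> = (\<Sum>i\<in>J. 1 - 4 * cos (3 * pi / 8))"
    proof (intro sum.cong refl)
      fix i assume i: "i \<in> J"
      have "(\<Sum>j\<in>J. if i = j then 1 else - cos (3 * pi / 8))
          = 1 + (\<Sum>j\<in>J - {i}. if i = j then 1 else - cos (3 * pi / 8))"
        using i by (subst sum.remove[of J i]) auto
      also have "(\<Sum>j\<in>J - {i}. if i = j then 1 else - cos (3 * pi / 8)) = (\<Sum>j\<in>J - {i}. - cos (3 * pi / 8))"
        by (intro sum.cong) auto
      also have "\<dots> = - 4 * cos (3 * pi / 8)"
        using i J by simp
      finally show "(\<Sum>j\<in>J. if i = j then 1 else - cos (3 * pi / 8)) = 1 - 4 * cos (3 * pi / 8)"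
        by simp
    qed
    also have "\<dots> \<le> 0"
      using cos_3pi_8_gt J by simp
    finally have "g 1 v \<le> 0" .
    have "J \<noteq> {}"
      using J by auto
    then have "v \<noteq> 0"
      by (auto simp: v_def vec_eq_iff)
    define x where "x = (1 / norm v) *\<^sub>R v"
    have "g 1 x \<le> 0"
      unfolding x_def g_scale using \<open>g 1 v \<le> 0\<close> by (simp add: mult_nonneg_nonpos divide_nonpos_nonneg)
    moreover have "x \<in> \<Delta>"
      using \<open>v \<noteq> 0\<close> by (auto simp: \<Delta>_def x_def nonneg_vec_def supp_def v_def)
    ultimately have "(1, x) \<in> Z"
      by (simp add: Z_def)
    then show ?thesis by blast
  qed
  \<comment> \<open>The earliest parameter at which the form is nonpositive somewhere on
    \<open>\<Delta>\<close>.\<close>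
  ultimately obtain p where p: "p \<in> Z" "\<And>q. q \<in> Z \<Longrightarrow> fst p \<le> fst q"
    using continuous_attains_inf[of Z fst] continuous_on_fst[OF continuous_on_id] by blast
  define t0 where "t0 = fst p"
  define x0 where "x0 = snd p"
  have t0: "0 \<le> t0" "t0 \<le> 1" and x0: "x0 \<in> \<Delta>" and gx0: "g t0 x0 \<le> 0"
    using p(1) by (auto simp: Z_def t0_def x0_def)
  have min: "t0 \<le> t" if "0 \<le> t" "t \<le> 1" "x \<in> \<Delta>" "g t x \<le> 0" for t x
    using p(2)[of "(t, x)"] that by (simp add: Z_def t0_def)
  have "t0 \<noteq> 0"
  proof
    assume "t0 = 0"
    then have "g 0 x0 \<le> 0" using gx0 by simp
    moreover have "0 < g 0 x0"
      using x0 by (intro g0) (auto simp: \<Delta>_def)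
    ultimately show False by simp
  qed
  then have t0pos: "0 < t0"
    using t0 by simp
  have g\<Delta>: "0 \<le> g t0 x" if "x \<in> \<Delta>" for x
  proof (rule tendsto_lowerbound)
    have "continuous_on UNIV (\<lambda>t. g t x)"
      unfolding g_def \<psi>_def by (intro continuous_intros)
    then have "isCont (\<lambda>t. g t x) t0"
      by (simp add: continuous_on_eq_continuous_at)
    then show "((\<lambda>t. g t x) \<longlongrightarrow> g t0 x) (at_left t0)"
      by (simp add: isCont_def filterlim_at_split)
    have "eventually (\<lambda>t. t \<in> {0<..<t0}) (at_left t0)"
      by (rule eventually_at_leftI[of 0]) (use t0pos in auto)
    then show "\<forall>\<^sub>F t in at_left t0. 0 \<le> g t x"
    proof eventually_elim
      case (elim t)
      then show ?case
        using min[of t x] that t0 by force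
    qed
    show "at_left t0 \<noteq> bot"
      by simp
  qed
  \<comment> \<open>The identity outside \<open>J\<close> turns the block into a copositive matrix
    with unit diagonal on all indices, as the lemmas about zeros require.\<close>
  define M :: "real^'n^'n" where
    "M = (\<chi> i j. if i \<in> J \<and> j \<in> J then - cos (\<psi> t0 i j) else if i = j then 1 else 0)"
  have symM: "symmetric_mat M"
    by (auto simp: symmetric_mat_iff M_def \<psi>sym[of t0])
  have diagM: "\<forall>i. M $ i $ i = 1"
    by (simp add: M_def \<psi>ii)
  have MJ: "x \<bullet> (M *v x) = g t0 x" if "supp x \<subseteq> J" for x
    unfolding quad_form_sum_on[OF that] g_def by (intro sum.cong refl) (simp add: M_def)
  have gJ: "0 \<le> g t0 x" if "nonneg_vec x" "supp x \<subseteq> J" for x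
  proof (cases "x = 0")
    case False
    have "(1 / norm x) *\<^sub>R x \<in> \<Delta>"
      using that False by (auto simp: \<Delta>_def nonneg_vec_def supp_def)
    then have "0 \<le> g t0 ((1 / norm x) *\<^sub>R x)"
      by (rule g\<Delta>)
    then show ?thesis
      unfolding g_scale using False by (simp add: zero_le_mult_iff zero_le_divide_iff)
  qed (simp add: g_def)
  have copM: "M \<in> copositive_cone"
    unfolding copositive_cone_def
  proof (intro CollectI conjI symM allI impI)
    fix x :: "real^'n" assume x: "nonneg_vec x"
    define y :: "real^'n" where "y = (\<chi> i. if i \<in> J then x $ i else 0)"
    have "x \<bullet> (M *v x) = (\<Sum>i\<in>UNIV. \<Sum>j\<in>UNIV. M $ i $ j * y $ i * y $ j + (if i = j then if i \<in> J then 0 else (x $ i)\<^sup>2 else 0))"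
      unfolding quad_form_sum by (intro sum.cong refl) (auto simp: y_def M_def power2_eq_square)
    also have "\<dots> = y \<bullet> (M *v y) + (\<Sum>i\<in>UNIV. if i \<in> J then 0 else (x $ i)\<^sup>2)"
      by (simp add: quad_form_sum sum.distrib)
    also have "y \<bullet> (M *v y) = g t0 y"
      by (rule MJ) (auto simp: supp_def y_def split: if_splits)
    finally have "x \<bullet> (M *v x) = g t0 y + (\<Sum>i\<in>UNIV. if i \<in> J then 0 else (x $ i)\<^sup>2)" .
    moreover have "0 \<le> g t0 y"
      using x by (intro gJ) (auto simp: nonneg_vec_def supp_def y_def split: if_splits)
    moreover have "0 \<le> (\<Sum>i\<in>UNIV. if i \<in> J then 0 else (x $ i)\<^sup>2)"
      by (intro sum_nonneg) auto
    ultimately show "0 \<le> x \<bullet> (M *v x)"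
      by simp
  qed
  have x0J: "supp x0 \<subseteq> J" and x0n: "nonneg_vec x0" "x0 \<noteq> 0"
    using x0 by (auto simp: \<Delta>_def)
  have zero: "is_zero M x0"
    using x0n MJ[OF x0J] gx0 gJ[OF x0n(1) x0J] by (simp add: is_zero_def)
  \<comment> \<open>A triple with angle sum at most \<open>pi\<close> would carry a positive vector
    with nonpositive form, against strict positivity at parameter 0.\<close>
  have tri': "pi < \<phi>' i j + \<phi>' i k + \<phi>' j k" if ijk: "i \<in> J" "j \<in> J" "k \<in> J" "i \<noteq> j" "i \<noteq> k" "j \<noteq> k" for i j k
  proof (rule ccontr)
    assume "\<not> ?thesis"
    then obtain x y z where xyz: "0 < x" "0 < y" "0 < z"
      "x\<^sup>2 + y\<^sup>2 + z\<^sup>2 - 2 * cos (\<phi>' i j) * x * y - 2 * cos (\<phi>' i k) * x * z - 2 * cos (\<phi>' j k) * y * z \<le> 0"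
      using triangle_form_nonpos[of "\<phi>' j k" "\<phi>' i k" "\<phi>' i j"] \<phi>'(1) by auto
    define u :: "real^'n" where "u = (\<chi> l. if l = i then x else if l = j then y else if l = k then z else 0)"
    have uJ: "supp u \<subseteq> {i, j, k}"
      by (auto simp: supp_def u_def split: if_splits)
    have "u $ i \<noteq> 0"
      using xyz by (simp add: u_def)
    then have "u \<noteq> 0" by auto
    moreover have "nonneg_vec u"
      using xyz by (auto simp: nonneg_vec_def u_def)
    ultimately have "0 < g 0 u"
      using uJ ijk by (intro g0) auto
    moreover have "g 0 u = (\<Sum>a\<in>{i,j,k}. \<Sum>b\<in>{i,j,k}. - cos (\<phi>' a b) * u $ a * u $ b)"
    proof -
      have "g 0 u = (\<Sum>a\<in>{i,j,k}. \<Sum>b\<in>J. - cos (\<phi>' a b) * u $ a * u $ b)"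
        unfolding g_def \<psi>_def using ijk
        by (intro sum.mono_neutral_cong_right) (auto simp: u_def)
      also have "\<dots> = (\<Sum>a\<in>{i,j,k}. \<Sum>b\<in>{i,j,k}. - cos (\<phi>' a b) * u $ a * u $ b)"
        using ijk by (intro sum.cong refl sum.mono_neutral_right) (auto simp: u_def)
      finally show ?thesis .
    qed
    moreover have "\<dots> = x\<^sup>2 + y\<^sup>2 + z\<^sup>2 - 2 * cos (\<phi>' i j) * x * y - 2 * cos (\<phi>' i k) * x * z - 2 * cos (\<phi>' j k) * y * z"
      using ijk by (simp add: u_def \<phi>ii \<phi>'sym[of j i] \<phi>'sym[of k i] \<phi>'sym[of k j] power2_eq_square algebra_simps)
    ultimately show False
      using xyz by simp
  qed
  have tri: "pi < \<psi> t0 i j + \<psi> t0 i k + \<psi> t0 j k" if ijk: "i \<in> J" "j \<in> J" "k \<in> J" "i \<noteq> j" "i \<noteq> k" "j \<noteq> k" for i j k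
  proof -
    have "(1 - t0) * pi \<le> (1 - t0) * (\<phi>' i j + \<phi>' i k + \<phi>' j k)"
      using tri'[OF ijk] t0 by (intro mult_left_mono) auto
    moreover have "t0 * pi < t0 * (9 * pi / 8)"
      using t0pos by simp
    moreover have "\<psi> t0 i j + \<psi> t0 i k + \<psi> t0 j k = (1 - t0) * (\<phi>' i j + \<phi>' i k + \<phi>' j k) + t0 * (9 * pi / 8)"
      using ijk by (simp add: \<psi>_def algebra_simps)
    moreover have "(1 - t0) * pi = pi - t0 * pi"
      by (simp add: algebra_simps)
    ultimately show ?thesis
      by linarith
  qed
  have \<psi>: "0 < \<psi> t0 i j" "\<psi> t0 i j < pi" if "i \<noteq> j" for i j
  proof -
    have p: "\<psi> t0 i j = (1 - t0) * \<phi>' i j + t0 * (3 * pi / 8)"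
      using that by (simp add: \<psi>_def)
    have "0 \<le> (1 - t0) * \<phi>' i j"
      using \<phi>'(1)[of i j] t0 by simp
    then show "0 < \<psi> t0 i j"
      unfolding p using t0pos by (simp add: add_nonneg_pos)
    have "(1 - t0) * \<phi>' i j \<le> (1 - t0) * pi"
      using \<phi>'(2)[of i j] t0 by (intro mult_left_mono) auto
    moreover have "t0 * (3 * pi / 8) < t0 * pi"
      using t0pos by simp
    moreover have "(1 - t0) * pi = pi - t0 * pi"
      by (simp add: algebra_simps)
    ultimately show "\<psi> t0 i j < pi"
      unfolding p by linarith
  qed
  have "4 \<le> card (supp x0)"
  proof (rule ccontr)
    assume "\<not> 4 \<le> card (supp x0)"
    then obtain T where T: "supp x0 \<subseteq> T" "T \<subseteq> J" "card T = 3"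
      using exists_subset_between[of "supp x0" 3 J] x0J J finJ by auto
    then obtain i j k where ijk: "T = {i, j, k}" "i \<noteq> j" "i \<noteq> k" "j \<noteq> k"
      by (auto simp: card_3_iff)
    have inJ: "i \<in> J" "j \<in> J" "k \<in> J"
      using T ijk by auto
    have "x0 $ i \<noteq> 0 \<or> x0 $ j \<noteq> 0 \<or> x0 $ k \<noteq> 0"
    proof (rule ccontr)
      assume "\<not> ?thesis"
      then have "supp x0 = {}"
        using T(1) ijk(1) by (auto simp: supp_def)
      then show False
        using x0n supp_empty_iff by blast
    qed
    then have "0 < (x0 $ i)\<^sup>2 + (x0 $ j)\<^sup>2 + (x0 $ k)\<^sup>2 - 2 * cos (\<psi> t0 i j) * x0 $ i * x0 $ j
        - 2 * cos (\<psi> t0 i k) * x0 $ i * x0 $ k - 2 * cos (\<psi> t0 j k) * x0 $ j * x0 $ k"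
      using \<psi> ijk x0n(1) tri[OF inJ ijk(2-4)]
      by (intro triangle_form_pos) (auto simp: nonneg_vec_def)
    also have "\<dots> = x0 \<bullet> (M *v x0)"
      using quad_form_triple[of x0 i j k M] T(1) ijk symM diagM inJ by (simp add: M_def)
    finally show False
      using zero by (simp add: is_zero_def)
  qed
  \<comment> \<open>At most one index of \<open>J\<close> is missing from the support of the zero,
    so \<open>M\<close> is positive semidefinite on \<open>J - {k}\<close> and
    \<open>unit_gram_minorant\<close> covers all five indices.\<close>
  obtain k where k: "k \<in> J" "J - {k} \<subseteq> supp x0"
  proof (cases "supp x0 = J")
    case True
    obtain k where "k \<in> J" using J by fastforce
    then show ?thesis using True that by blast
  next
    case False
    then obtain k where k: "k \<in> J" "k \<notin> supp x0"
      using x0J by blast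
    have "supp x0 = J - {k}"
      using k x0J \<open>4 \<le> card (supp x0)\<close> J by (intro card_seteq) auto
    then show ?thesis using k that by blast
  qed
  obtain Y :: "'n \<Rightarrow> (real^'n) \<times> real" where Y: "\<forall>i\<in>insert k (J - {k}). norm (Y i) = 1"
    "\<forall>i\<in>insert k (J - {k}). \<forall>j\<in>insert k (J - {k}). Y i \<bullet> Y j \<le> M $ i $ j"
    using unit_gram_minorant[OF copM diagM, of "J - {k}" k] zero_support_psd[OF copM zero] k(2) by blast
  have insJ: "insert k (J - {k}) = J"
    using k(1) by auto
  have psi_bd: "0 \<le> \<psi> t0 i j" "\<psi> t0 i j \<le> pi" for i j
    using \<psi>[of i j] \<psi>ii[of t0 i] by (cases "i = j"; force)+
  have "1 \<le> (\<Sum>i\<in>J. \<Sum>j\<in>J. 1 - 2 * arccos (Y i \<bullet> Y j) / pi)"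
    using Y(1) J unfolding insJ by (intro odd_clique_inequality) auto
  also have "\<dots> \<le> (\<Sum>i\<in>J. \<Sum>j\<in>J. 2 / pi * \<psi> t0 i j - 1)"
  proof (intro sum_mono)
    fix i j assume ij: "i \<in> J" "j \<in> J"
    have "Y i \<bullet> Y j \<le> - cos (\<psi> t0 i j)"
      using Y(2) ij unfolding insJ by (auto simp: M_def)
    moreover have "- 1 \<le> Y i \<bullet> Y j"
      using Cauchy_Schwarz_ineq2[of "Y i" "Y j"] Y(1) ij unfolding insJ by (auto simp: abs_le_iff)
    ultimately have "arccos (- cos (\<psi> t0 i j)) \<le> arccos (Y i \<bullet> Y j)"
      by (intro arccos_le_arccos) auto
    then have "pi - \<psi> t0 i j \<le> arccos (Y i \<bullet> Y j)"
      using psi_bd by (simp add: arccos_minus_cos)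
    then have "2 / pi * (pi - \<psi> t0 i j) \<le> 2 / pi * arccos (Y i \<bullet> Y j)"
      by (intro mult_left_mono) auto
    then show "1 - 2 * arccos (Y i \<bullet> Y j) / pi \<le> 2 / pi * \<psi> t0 i j - 1"
      by (simp add: right_diff_distrib)
  qed
  also have "\<dots> = 2 / pi * (\<Sum>i\<in>J. \<Sum>j\<in>J. \<psi> t0 i j) - 25"
    using J by (simp add: sum_subtractf sum_distrib_left)
  \<comment> \<open>The 25 terms \<open>2 / pi * \<psi> t0 i j - 1\<close> sum to at least 1, so the
    angles sum to at least \<open>26 * pi / 2\<close>.\<close>
  finally have ge: "13 * pi \<le> (\<Sum>i\<in>J. \<Sum>j\<in>J. \<psi> t0 i j)"
    by (simp add: field_simps)
  have sum': "(\<Sum>i\<in>J. \<Sum>j\<in>J. \<phi>' i j) < 13 * pi"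
  proof -
    have "(\<Sum>i\<in>J. \<Sum>j\<in>J. \<phi>' i j) \<le> (\<Sum>i\<in>J. \<Sum>j\<in>J. \<phi> i j + e)"
      by (intro sum_mono) (simp add: \<phi>'_def)
    also have "\<dots> = S + 25 * e"
      using J by (simp add: sum.distrib S_def)
    also have "25 * e = (13 * pi - S) / 2"
      by (simp add: e_def)
    also have "S + (13 * pi - S) / 2 < 13 * pi"
      using S by (simp add: field_simps)
    finally show ?thesis .
  qed
  have sum1: "(\<Sum>i\<in>J. \<Sum>j\<in>J. if i = j then pi else 3 * pi / 8) = 25 / 2 * pi"
  proof -
    have "(\<Sum>j\<in>J. if i = j then pi else 3 * pi / 8) = 5 / 2 * pi" if i: "i \<in> J" for i
    proof -
      have "(\<Sum>j\<in>J. if i = j then pi else 3 * pi / 8)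
          = pi + (\<Sum>j\<in>J - {i}. if i = j then pi else 3 * pi / 8)"
        using i by (subst sum.remove[of J i]) auto
      also have "(\<Sum>j\<in>J - {i}. if i = j then pi else 3 * pi / 8) = (\<Sum>j\<in>J - {i}. 3 * pi / 8)"
        by (intro sum.cong) auto
      also have "\<dots> = 3 / 2 * pi"
        using i J by simp
      finally show ?thesis by simp
    qed
    then have "(\<Sum>i\<in>J. \<Sum>j\<in>J. if i = j then pi else 3 * pi / 8) = (\<Sum>i\<in>J. 5 / 2 * pi)"
      by (intro sum.cong refl)
    then show ?thesis
      using J by simp
  qed
  have "(\<Sum>i\<in>J. \<Sum>j\<in>J. \<psi> t0 i j) = (1 - t0) * (\<Sum>i\<in>J. \<Sum>j\<in>J. \<phi>' i j) + t0 * (25 / 2 * pi)"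
    unfolding sum1[symmetric] by (simp only: \<psi>_def sum.distrib sum_distrib_left)
  also have "\<dots> < 13 * pi"
  proof -
    have "(1 - t0) * (\<Sum>i\<in>J. \<Sum>j\<in>J. \<phi>' i j) \<le> (1 - t0) * (13 * pi)"
      using sum' t0 by (intro mult_left_mono) auto
    moreover have "t0 * (25 / 2 * pi) < t0 * (13 * pi)"
      using t0pos by (intro mult_strict_left_mono) auto
    moreover have "(1 - t0) * (13 * pi) = 13 * pi - t0 * (13 * pi)"
      by (simp add: algebra_simps)
    ultimately show ?thesis
      by linarith
  qed
  finally show False
    using ge by simp
qed

subsection \<open>Structure of the minimal support set\<close>

lemma minimal_support_card_le:
  fixes A :: "real^'n^'n"
  assumes cop: "A \<in> copositive_cone" and diag: "\<forall>i. A $ i $ i = 1"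
    and irr: "irreducible_wrt psd_cone A" and u: "is_zero A u"
  shows "card (supp u) + 2 \<le> CARD('n)"
proof (rule ccontr)
  assume "\<not> ?thesis"
  then have big: "CARD('n) - 1 \<le> card (supp u)"
    by linarith
  obtain k where k: "UNIV - {k} \<subseteq> supp u"
  proof (cases "supp u = UNIV")
    case True
    then show ?thesis using that by blast
  next
    case False
    then obtain k where k: "k \<notin> supp u" by blast
    have "supp u = UNIV - {k}"
      using k big by (intro card_seteq) auto
    then show ?thesis using that by blast
  qed
  have ins: "insert k (UNIV - {k}) = UNIV"
    by auto
  obtain Y :: "'n \<Rightarrow> (real^'n) \<times> real" where Y: "\<forall>i. norm (Y i) = 1" "\<forall>i j. Y i \<bullet> Y j \<le> A $ i $ j"
    using unit_gram_minorant[OF cop diag, of "UNIV - {k}" k] zero_support_psd[OF cop u] k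
    unfolding ins by blast
  let ?P = "\<chi> i j. Y i \<bullet> Y j"
  have "?P = 0"
    using Y(2) by (intro irreducible_not_psd_plus_nonneg[OF irr gram_psd _ copositiveD(1)[OF cop]]) simp
  then have "?P $ k $ k = 0"
    by (simp only: zero_index)
  then show False
    using Y(1)[rule_format, of k] by simp
qed

section \<open>Angles attached to a copositive matrix with unit diagonal\<close>

context
  fixes A :: "real^'n^'n"
  assumes cop: "A \<in> copositive_cone" and diag: "\<forall>i. A $ i $ i = 1"
    and le1: "\<And>i j. A $ i $ j \<le> 1"
begin

text \<open>The negation assigns 0 to the entries \<open>- 1\<close>, which mark two-element
  supports, and \<open>pi\<close> to the diagonal.\<close>

definition angle :: "'n \<Rightarrow> 'n \<Rightarrow> real" where
  "angle i j = arccos (- (A $ i $ j))"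

lemma angle_bounds: "0 \<le> angle i j" "angle i j \<le> pi" "cos (angle i j) = - (A $ i $ j)"
  using copositive_entry_ge[OF cop diag, of i j] le1[of i j]
  by (auto simp: angle_def arccos_lbound arccos_ubound)

lemma angle_sym: "angle i j = angle j i"
  using copositiveD(1)[OF cop] by (simp add: angle_def symmetric_mat_iff)

lemma angle_self: "angle i i = pi"
  using diag by (simp add: angle_def)

lemma angle_eq_0_iff:
  assumes "i \<noteq> j"
  shows "angle i j = 0 \<longleftrightarrow> {i, j} \<in> min_supp_set A"
  unfolding pair_in_min_supp_set_iff[OF cop diag assms]
  using angle_bounds(3)[of i j] by (auto simp: angle_def)

lemma angle_cut_entry: "2 * (angle i j / pi) - 1 = 1 - 2 * arccos (A $ i $ j) / pi"
proof -
  have "angle i j = pi - arccos (A $ i $ j)"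
    using copositive_entry_ge[OF cop diag, of i j] le1[of i j] by (simp add: angle_def arccos_minus)
  then show ?thesis
    by (simp add: diff_divide_distrib)
qed

text \<open>If \<open>A\<close> is definite on \<open>J\<close>, its Gram vectors there are linearly
  independent, so every sign pattern is realised by some \<open>g\<close> and all weights are
  positive.\<close>

lemma sign_pattern_weights_copositive:
  assumes psd: "\<And>x. supp x \<subseteq> J \<Longrightarrow> 0 \<le> x \<bullet> (A *v x)"
  shows "\<exists>w. (\<forall>S. 0 \<le> w S) \<and> (\<Sum>S\<in>Pow J. w S) = 1
    \<and> (\<forall>i\<in>J. \<forall>j\<in>J. (\<Sum>S\<in>Pow J. w S * (sgn_of S i * sgn_of S j)) = 2 * (angle i j / pi) - 1)
    \<and> ((\<forall>x. supp x \<subseteq> J \<longrightarrow> x \<bullet> (A *v x) \<le> 0 \<longrightarrow> x = 0) \<longrightarrow> (\<forall>S\<in>Pow J. 0 < w S))"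
proof -
  obtain X :: "'n \<Rightarrow> real^'n" where X: "\<And>i j. i \<in> J \<Longrightarrow> j \<in> J \<Longrightarrow> X i \<bullet> X j = A $ i $ j"
    using gram_on_exists[of A J, OF copositiveD(1)[OF cop] psd] by blast
  define Y where "Y i = (X i, 0::real)" for i
  have Y: "Y i \<bullet> Y j = A $ i $ j" if "i \<in> J" "j \<in> J" for i j
    using X[OF that] by (simp add: Y_def inner_prod_def)
  have unit: "norm (Y i) = 1" if "i \<in> J" for i
    using Y[OF that that] diag by (simp add: norm_eq_1)
  obtain w where w: "\<forall>S. 0 \<le> w S" "(\<Sum>S\<in>Pow J. w S) = 1"
    "\<forall>i\<in>J. \<forall>j\<in>J. (\<Sum>S\<in>Pow J. w S * (sgn_of S i * sgn_of S j)) = 1 - 2 * arccos (Y i \<bullet> Y j) / pi"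
    "\<forall>S\<in>Pow J. (\<exists>g. \<forall>i\<in>J. Y i \<bullet> g = sgn_of S i) \<longrightarrow> 0 < w S"
    using sign_pattern_weights[of J Y, OF unit] by blast
  have "0 < w S" if pd: "\<forall>x. supp x \<subseteq> J \<longrightarrow> x \<bullet> (A *v x) \<le> 0 \<longrightarrow> x = 0" and S: "S \<in> Pow J" for S
  proof -
    \<comment> \<open>Continuing the block of \<open>J\<close> by the identity gives an injective,
      hence surjective map. A solution of \<open>D *v c\<close> equal to the sign vector supplies
      the coefficients of \<open>g\<close> in terms of the vectors \<open>Y j\<close>.\<close>
    define D :: "real^'n^'n" where
      "D = (\<chi> i j. if i \<in> J then if j \<in> J then A $ i $ j else 0 else if i = j then 1 else 0)"
    have DJ: "(D *v x) $ i = (\<Sum>j\<in>J. A $ i $ j * x $ j)" if "i \<in> J" for x i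
    proof -
      have "(D *v x) $ i = (\<Sum>j\<in>UNIV. if j \<in> J then A $ i $ j * x $ j else 0)"
        unfolding matrix_vector_mult_def vec_lambda_beta by (intro sum.cong) (auto simp: D_def that)
      then show ?thesis
        by (simp add: sum.If_cases)
    qed
    have Dout: "(D *v x) $ i = x $ i" if "i \<notin> J" for x i
    proof -
      have "(D *v x) $ i = (\<Sum>j\<in>UNIV. if i = j then x $ j else 0)"
        unfolding matrix_vector_mult_def vec_lambda_beta by (intro sum.cong) (auto simp: D_def that)
      then show ?thesis by simp
    qed
    have "x = 0" if Dx: "D *v x = 0" for x
    proof -
      have sx: "supp x \<subseteq> J"
      proof
        fix i assume "i \<in> supp x"
        then show "i \<in> J"
          using Dout[of i x] Dx by (cases "i \<in> J") (auto simp: supp_def)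
      qed
      have "x \<bullet> (A *v x) = (\<Sum>i\<in>J. x $ i * (D *v x) $ i)"
        unfolding quad_form_sum_on[OF sx]
        by (intro sum.cong refl) (simp add: DJ sum_distrib_left mult_ac)
      then show "x = 0"
        using pd sx Dx by simp
    qed
    then have "inj ((*v) D)"
      by (simp add: linear_injective_0 matrix_vector_mul_linear)
    then have "surj ((*v) D)"
      by (simp add: linear_injective_imp_surjective matrix_vector_mul_linear)
    then obtain c where c: "D *v c = (\<chi> i. sgn_of S i)"
      by (metis surjD)
    have "Y i \<bullet> (\<Sum>j\<in>J. c $ j *\<^sub>R Y j) = sgn_of S i" if i: "i \<in> J" for i
    proof -
      have "Y i \<bullet> (\<Sum>j\<in>J. c $ j *\<^sub>R Y j) = (\<Sum>j\<in>J. A $ i $ j * c $ j)"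
        unfolding inner_sum_right by (intro sum.cong refl) (simp add: Y i)
      also have "\<dots> = sgn_of S i"
        using DJ[OF i, of c] c by simp
      finally show ?thesis .
    qed
    then show ?thesis
      using w(4) S by blast
  qed
  then show ?thesis
    using w(1,2,3) Y unfolding angle_cut_entry by (intro exI[of _ w]) simp
qed

lemma minimal_support_in_maxcut:
  assumes "J \<in> min_supp_set A"
  shows "submat J (\<chi> i j. 2 * (angle i j / pi) - 1) \<in> maxcut J"
proof -
  obtain u where "is_zero A u" "J = supp u"
    using assms by (auto simp: min_supp_set_def minimal_zero_def)
  then obtain w where w: "\<forall>S. 0 \<le> w S" "(\<Sum>S\<in>Pow J. w S) = 1"
    "\<forall>i\<in>J. \<forall>j\<in>J. (\<Sum>S\<in>Pow J. w S * (sgn_of S i * sgn_of S j)) = 2 * (angle i j / pi) - 1"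
    using sign_pattern_weights_copositive[of J] zero_support_psd[OF cop, of u] by blast
  show ?thesis
    by (rule submat_in_maxcut[of w]) (use w in auto)
qed

lemma proper_minimal_support_in_rel_interior_maxcut:
  assumes "J' \<in> min_supp_set A" "J \<subset> J'"
  shows "submat J (\<chi> i j. 2 * (angle i j / pi) - 1) \<in> rel_interior (maxcut J)"
proof -
  obtain u where u: "minimal_zero A u" "J' = supp u"
    using assms by (auto simp: min_supp_set_def)
  then have "is_zero A u"
    by (simp add: minimal_zero_def)
  then have "\<And>x. supp x \<subseteq> J \<Longrightarrow> 0 \<le> x \<bullet> (A *v x)"
    using zero_support_psd[OF cop, of u] u(2) assms(2) by blast
  moreover have "\<forall>x. supp x \<subseteq> J \<longrightarrow> x \<bullet> (A *v x) \<le> 0 \<longrightarrow> x = 0"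
    using minimal_zero_support_definite[OF cop u(1)] u(2) assms(2) by blast
  ultimately obtain w where w: "(\<Sum>S\<in>Pow J. w S) = 1" "\<forall>S\<in>Pow J. 0 < w S"
    "\<forall>i\<in>J. \<forall>j\<in>J. (\<Sum>S\<in>Pow J. w S * (sgn_of S i * sgn_of S j)) = 2 * (angle i j / pi) - 1"
    using sign_pattern_weights_copositive[of J] by blast
  show ?thesis
    by (rule submat_in_rel_interior_maxcut[of J w]) (use w in auto)
qed

text \<open>The three equations saying that \<open>A *v u\<close> vanishes on its support are the
  hypotheses of \<open>triangle_angle_sum\<close>. Definiteness on the two-element subsets keeps the
  angles strictly between 0 and \<open>pi\<close>.\<close>

lemma angle_triple_eq:
  assumes d: "i \<noteq> j" "i \<noteq> k" "j \<noteq> k" and T: "{i, j, k} \<in> min_supp_set A"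
  shows "angle i j + angle i k + angle j k = pi"
proof -
  obtain u where u: "minimal_zero A u" "supp u = {i, j, k}"
    using T by (auto simp: min_supp_set_def)
  then have zu: "is_zero A u"
    by (simp add: minimal_zero_def)
  have strict: "0 < angle p q \<and> angle p q < pi" if pq: "p \<noteq> q" "{p, q} \<subset> {i, j, k}" for p q
  proof -
    \<comment> \<open>Eliminating coordinate \<open>p\<close> against \<open>q\<close> in this way
      gives the form the value \<open>1 - (A $ p $ q)\<^sup>2\<close>.\<close>
    define x where "x = axis p 1 + (- (A $ p $ q)) *\<^sub>R axis q (1::real)"
    have "supp x \<subset> supp u"
      using u(2) pq(2) by (auto simp: x_def supp_def axis_def split: if_splits)
    moreover have "x $ p = 1"
      using pq(1) by (simp add: x_def axis_def)
    then have "x \<noteq> 0" by auto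
    ultimately have "0 < x \<bullet> (A *v x)"
      using minimal_zero_support_definite[OF cop u(1), of x] by fastforce
    also have "\<dots> = 1 - (A $ p $ q)\<^sup>2"
      unfolding x_def quad_form_add_scaleR[OF copositiveD(1)[OF cop]]
      using diag copositiveD(1)[OF cop]
      by (simp add: inner_axis' matrix_vector_mult_basis column_def symmetric_mat_iff power2_eq_square)
    finally have "\<bar>A $ p $ q\<bar> < 1"
      by (simp add: abs_square_less_1)
    then show ?thesis
      unfolding angle_def by (intro conjI arccos_lt_bounded[THEN conjunct1] arccos_lt_bounded[THEN conjunct2]) auto
  qed
  have Au: "(A *v u) $ l = A $ l $ i * u $ i + A $ l $ j * u $ j + A $ l $ k * u $ k" for l
  proof -
    have "(A *v u) $ l = (\<Sum>m\<in>{i, j, k}. A $ l $ m * u $ m)"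
      unfolding matrix_vector_mult_def vec_lambda_beta
      using u(2) by (intro sum.mono_neutral_right) (auto simp: supp_def)
    then show ?thesis using d by simp
  qed
  have c: "A $ p $ q = - cos (angle p q)" for p q
    using angle_bounds(3)[of p q] by simp
  have s: "angle j i = angle i j" "angle k i = angle i k" "angle k j = angle j k"
    by (auto intro: angle_sym)
  have pos: "0 < u $ i" "0 < u $ j" "0 < u $ k"
    using is_zero_pos[OF zu] u(2) by auto
  have z: "(A *v u) $ i = 0" "(A *v u) $ j = 0" "(A *v u) $ k = 0"
    using zero_image_eq_0[OF cop zu] u(2) by auto
  have ps: "{j, k} \<subset> {i, j, k}" "{i, k} \<subset> {i, j, k}" "{i, j} \<subset> {i, j, k}"
    using d by (auto simp: psubset_eq set_eq_iff)
  have "angle j k + angle i k + angle i j = pi"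
  proof (rule triangle_angle_sum)
    show "u $ i = cos (angle i j) * u $ j + cos (angle i k) * u $ k"
      using z(1) unfolding Au c angle_self by simp
    show "u $ j = cos (angle i j) * u $ i + cos (angle j k) * u $ k"
      using z(2) unfolding Au c angle_self s by simp
    show "u $ k = cos (angle i k) * u $ i + cos (angle j k) * u $ j"
      using z(3) unfolding Au c angle_self s by simp
  qed (use strict[OF d(3) ps(1)] strict[OF d(2) ps(2)] strict[OF d(1) ps(3)] pos in auto)
  then show ?thesis by simp
qed

text \<open>No pair among the three indices is a minimal support, so the angles are positive. A sum
  of at most \<open>pi\<close> would then produce a zero supported in the triple, and with it a
  minimal support inside.\<close>

lemma angle_triple_gt:
  assumes d: "i \<noteq> j" "i \<noteq> k" "j \<noteq> k" and T: "\<not> (\<exists>J\<in>min_supp_set A. J \<subseteq> {i, j, k})"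
  shows "pi < angle i j + angle i k + angle j k"
proof (rule ccontr)
  assume "\<not> ?thesis"
  moreover have "0 < angle i j" "0 < angle i k" "0 < angle j k"
    using T d angle_eq_0_iff[of i j] angle_eq_0_iff[of i k] angle_eq_0_iff[of j k]
      angle_bounds(1)[of i j] angle_bounds(1)[of i k] angle_bounds(1)[of j k]
    by (auto simp: order_less_le)
  ultimately obtain x y z where xyz: "0 < x" "0 < y" "0 < z"
      "x\<^sup>2 + y\<^sup>2 + z\<^sup>2 - 2 * cos (angle i j) * x * y - 2 * cos (angle i k) * x * z - 2 * cos (angle j k) * y * z \<le> 0"
    using triangle_form_nonpos[of "angle j k" "angle i k" "angle i j"] by auto
  define u :: "real^'n" where "u = (\<chi> l. if l = i then x else if l = j then y else if l = k then z else 0)"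
  have uT: "supp u \<subseteq> {i, j, k}"
    by (auto simp: supp_def u_def split: if_splits)
  have "u \<bullet> (A *v u) \<le> 0"
    unfolding quad_form_triple[OF uT d copositiveD(1)[OF cop] diag]
    using xyz d by (simp add: u_def angle_bounds(3))
  moreover have n: "nonneg_vec u"
    using xyz by (auto simp: nonneg_vec_def u_def)
  moreover have "u $ i \<noteq> 0"
    using xyz by (simp add: u_def)
  then have "u \<noteq> 0" by auto
  ultimately have "is_zero A u"
    using copositiveD(2)[OF cop n] by (simp add: is_zero_def)
  then obtain v where "minimal_zero A v" "supp v \<subseteq> supp u"
    using ex_minimal_zero_subset by blast
  then show False
    using T uT by (auto simp: min_supp_set_def)
qed

text \<open>The zero on the pair has equal coordinates, so nonnegativity of \<open>A *v u\<close> at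
  \<open>k\<close> reads \<open>A $ k $ i + A $ k $ j \<ge> 0\<close>, which is a comparison of
  cosines.\<close>

lemma angle_pair_ge:
  assumes ij: "i \<noteq> j" and P: "{i, j} \<in> min_supp_set A"
  shows "pi \<le> angle i k + angle j k"
proof -
  obtain u where u: "is_zero A u" "supp u = {i, j}"
    using P by (auto simp: min_supp_set_def minimal_zero_def)
  have eq: "u $ i = u $ j"
    by (rule pair_zero(2)[OF cop diag u ij])
  have pos: "0 < u $ j"
    using is_zero_pos[OF u(1)] u(2) by auto
  have "(A *v u) $ k = (\<Sum>m\<in>{i, j}. A $ k $ m * u $ m)"
    unfolding matrix_vector_mult_def vec_lambda_beta
    using u(2) by (intro sum.mono_neutral_right) (auto simp: supp_def)
  also have "\<dots> = (A $ k $ i + A $ k $ j) * u $ j"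
    using ij eq by (simp add: algebra_simps)
  finally have "0 \<le> (A $ k $ i + A $ k $ j) * u $ j"
    using zero_image_nonneg[OF cop u(1), of k] by simp
  then have "0 \<le> A $ k $ i + A $ k $ j"
    using pos by (simp add: zero_le_mult_iff)
  then have "cos (angle k i) \<le> cos (pi - angle k j)"
    by (simp add: angle_bounds(3))
  then have "pi - angle k j \<le> angle k i"
    using angle_bounds[of k i] angle_bounds[of k j] by (subst (asm) cos_mono_le_eq) auto
  then show ?thesis
    using angle_sym[of i k] angle_sym[of j k] by simp
qed

lemma angle_pentagon:
  fixes \<iota> :: "nat \<Rightarrow> 'n"
  assumes inj: "inj_on \<iota> {..<5}"
  shows "4 \<le> (\<Sum>(a, b) \<in> {(a, b). a < b \<and> b < (5::nat)}. angle (\<iota> a) (\<iota> b) / pi)"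
proof -
  define f where "f a b = angle (\<iota> a) (\<iota> b)" for a b
  have f: "f a a = pi" "f a b = f b a" for a b
    by (auto simp: f_def angle_self intro: angle_sym)
  have l5: "{..<5} = {0, 1, 2, 3, 4::nat}"
    by auto
  have "card (\<iota> ` {..<5}) = 5"
    using inj by (simp add: card_image)
  then have "13 * pi \<le> (\<Sum>i\<in>\<iota> ` {..<5}. \<Sum>j\<in>\<iota> ` {..<5}. angle i j)"
    using copositive_pentagon[OF cop diag le1] by (simp add: angle_def)
  also have "\<dots> = (\<Sum>a<5. \<Sum>b<5. f a b)"
    using inj by (simp add: sum.reindex f_def)
  \<comment> \<open>The diagonal accounts for \<open>5 * pi\<close> and every pair is counted twice,
    which turns the bound \<open>13 * pi\<close> into \<open>4 * pi\<close>.\<close>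
  also have "\<dots> = 5 * pi + 2 * (f 0 1 + f 0 2 + f 0 3 + f 0 4 + f 1 2 + f 1 3 + f 1 4 + f 2 3 + f 2 4 + f 3 4)"
    unfolding l5 using f(2)[of 1 0] f(2)[of 2 0] f(2)[of 3 0] f(2)[of 4 0] f(2)[of 2 1] f(2)[of 3 1]
      f(2)[of 4 1] f(2)[of 3 2] f(2)[of 4 2] f(2)[of 4 3] by (simp add: f(1))
  finally have "4 * pi \<le> f 0 1 + f 0 2 + f 0 3 + f 0 4 + f 1 2 + f 1 3 + f 1 4 + f 2 3 + f 2 4 + f 3 4"
    by simp
  moreover have "(\<Sum>(a, b) \<in> {(a, b). a < b \<and> b < (5::nat)}. angle (\<iota> a) (\<iota> b) / pi)
    = (f 0 1 + f 0 2 + f 0 3 + f 0 4 + f 1 2 + f 1 3 + f 1 4 + f 2 3 + f 2 4 + f 3 4) / pi"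
  proof -
    have "{(a, b). a < b \<and> b < (5::nat)} = (SIGMA a:{..<5}. {a<..<5})"
      by auto
    then have "(\<Sum>(a, b) \<in> {(a, b). a < b \<and> b < (5::nat)}. angle (\<iota> a) (\<iota> b) / pi)
        = (\<Sum>a<5. \<Sum>b\<in>{a<..<5}. f a b / pi)"
      by (simp add: sum.Sigma f_def)
    moreover have "{0<..<5} = {1, 2, 3, 4::nat}" "{1<..<5} = {2, 3, 4::nat}"
      "{2<..<5} = {3, 4::nat}" "{3<..<5} = {4::nat}" "{4<..<5::nat} = {}"
      by auto
    ultimately show ?thesis
      by (simp add: l5 add_divide_distrib)
  qed
  ultimately show ?thesis
    by (simp add: pos_le_divide_eq)
qed

end

theorem theorem5p8:
  fixes A :: "real^'n^'n"
  defines "\<I> \<equiv> min_supp_set A"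
  assumes cop: "A \<in> copositive_cone"
    and diag: "\<forall>i. A $ i $ i = 1"
    and irr_psd: "irreducible_wrt psd_cone A"
    and irr_nn: "irreducible_wrt nonneg_cone A"
  shows
    "(\<forall>I\<in>\<I>. 2 \<le> card I \<and> card I + 2 \<le> CARD('n))
   \<and> \<not> (\<exists>I\<in>\<I>. \<exists>J\<in>\<I>. I \<subset> J)
   \<and> (\<forall>(I :: 'n set) (l :: nat) Ii (f :: nat \<Rightarrow> 'n set) (k :: nat \<Rightarrow> 'n) Ij.
        l \<ge> 1 \<longrightarrow> Ii \<in> \<I> \<longrightarrow> Ij \<in> \<I> \<longrightarrow> I \<subset> Ii
        \<longrightarrow> (\<forall>r\<in>{1..l}. f r \<in> \<I> \<and> f r - I = {k r})
        \<longrightarrow> (\<forall>r\<in>{1..<l}. f r \<inter> I \<subseteq> f (Suc r) \<inter> I)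
        \<longrightarrow> Ij \<subseteq> I \<union> k ` {1..l}
        \<longrightarrow> (\<exists>r\<in>{1..l}. Ij = f r))
   \<and> (\<exists>(v :: 'n set \<Rightarrow> 'n) (w :: 'n set \<Rightarrow> 'n set).
        (\<forall>C\<in>{C \<in> components2 \<I>. bipartite_comp \<I> C}.
           v C \<in> C \<and> w C \<in> \<I> \<and> card (w C) > 2 \<and> v C \<in> w C)
        \<and> inj_on w {C \<in> components2 \<I>. bipartite_comp \<I> C})
   \<and> (\<exists>\<alpha> :: 'n \<Rightarrow> 'n \<Rightarrow> real.
        let B = (\<chi> i j. 2 * \<alpha> i j - 1) in
        (\<forall>i j. \<alpha> i j = \<alpha> j i \<and> 0 \<le> \<alpha> i j \<and> \<alpha> i j \<le> 1)
        \<and> (\<forall>i. \<alpha> i i = 1)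
        \<and> (\<forall>i j. i \<noteq> j \<and> {i, j} \<in> \<I> \<longrightarrow> \<alpha> i j = 0)
        \<and> (\<forall>i j. i \<noteq> j \<and> {i, j} \<notin> \<I> \<longrightarrow> \<alpha> i j > 0)
        \<and> (\<forall>J\<in>\<I>. submat J B \<in> maxcut J)
        \<and> (\<forall>J. J \<noteq> {} \<and> (\<exists>J'\<in>\<I>. J \<subset> J')
              \<longrightarrow> submat J B \<in> rel_interior (maxcut J))
        \<and> (\<forall>i j k. i \<noteq> j \<and> i \<noteq> k \<and> j \<noteq> k \<and> {i, j, k} \<in> \<I>
              \<longrightarrow> \<alpha> i j + \<alpha> i k + \<alpha> j k = 1)
        \<and> (\<forall>i j k. i \<noteq> j \<and> i \<noteq> k \<and> j \<noteq> k \<and> \<not> (\<exists>J\<in>\<I>. J \<subseteq> {i, j, k})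
              \<longrightarrow> \<alpha> i j + \<alpha> i k + \<alpha> j k > 1)
        \<and> (\<forall>i j k. i \<noteq> j \<and> i \<noteq> k \<and> j \<noteq> k \<and> {i, j} \<in> \<I>
              \<longrightarrow> \<alpha> i k + \<alpha> j k \<ge> 1)
        \<and> (\<forall>\<iota> :: nat \<Rightarrow> 'n. inj_on \<iota> {..<5} \<longrightarrow>
              (\<Sum>(a, b) \<in> {(a, b). a < b \<and> b < (5::nat)}. \<alpha> (\<iota> a) (\<iota> b)) \<ge> 4))"
proof (intro conjI)
  have le1: "A $ i $ j \<le> 1" for i j
    by (rule irreducible_entry_le[OF cop diag irr_nn])
  note ang = cop diag le1
  show "\<forall>I\<in>\<I>. 2 \<le> card I \<and> card I + 2 \<le> CARD('n)"
    using supp_card_ge_2[OF diag] minimal_support_card_le[OF cop diag irr_psd]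
    by (auto simp: \<I>_def min_supp_set_def minimal_zero_def)
  show "\<not> (\<exists>I\<in>\<I>. \<exists>J\<in>\<I>. I \<subset> J)"
    using min_supp_set_no_psubset unfolding \<I>_def by blast
  show "\<forall>(I :: 'n set) (l :: nat) Ii (f :: nat \<Rightarrow> 'n set) (k :: nat \<Rightarrow> 'n) Ij.
        l \<ge> 1 \<longrightarrow> Ii \<in> \<I> \<longrightarrow> Ij \<in> \<I> \<longrightarrow> I \<subset> Ii
        \<longrightarrow> (\<forall>r\<in>{1..l}. f r \<in> \<I> \<and> f r - I = {k r})
        \<longrightarrow> (\<forall>r\<in>{1..<l}. f r \<inter> I \<subseteq> f (Suc r) \<inter> I)
        \<longrightarrow> Ij \<subseteq> I \<union> k ` {1..l}
        \<longrightarrow> (\<exists>r\<in>{1..l}. Ij = f r)"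
  proof (intro allI impI)
    fix I l Ii and f :: "nat \<Rightarrow> 'n set" and k :: "nat \<Rightarrow> 'n" and Ij
    assume h: "Ii \<in> \<I>" "Ij \<in> \<I>" "I \<subset> Ii" "\<forall>r\<in>{1..l}. f r \<in> \<I> \<and> f r - I = {k r}"
      "\<forall>r\<in>{1..<l}. f r \<inter> I \<subseteq> f (Suc r) \<inter> I" "Ij \<subseteq> I \<union> k ` {1..l}"
    show "\<exists>r\<in>{1..l}. Ij = f r"
      using min_supp_set_chain[OF cop h(1,2)[unfolded \<I>_def] h(3) _ _ h(6), of f] h(4,5)
      unfolding \<I>_def by blast
  qed
  show "\<exists>(v :: 'n set \<Rightarrow> 'n) (w :: 'n set \<Rightarrow> 'n set).
        (\<forall>C\<in>{C \<in> components2 \<I>. bipartite_comp \<I> C}.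
           v C \<in> C \<and> w C \<in> \<I> \<and> card (w C) > 2 \<and> v C \<in> w C)
        \<and> inj_on w {C \<in> components2 \<I>. bipartite_comp \<I> C}"
    unfolding \<I>_def by (rule bipartite_components_representatives[OF cop diag irr_psd])
  define \<alpha> where "\<alpha> i j = angle A i j / pi" for i j
  have sum3: "x / pi + y / pi + z / pi = (x + y + z) / pi" for x y z :: real
    by (simp add: add_divide_distrib)
  note bounds = angle_bounds[OF ang] and zero_iff = angle_eq_0_iff[OF ang]
  show "\<exists>\<alpha> :: 'n \<Rightarrow> 'n \<Rightarrow> real.
        let B = (\<chi> i j. 2 * \<alpha> i j - 1) in
        (\<forall>i j. \<alpha> i j = \<alpha> j i \<and> 0 \<le> \<alpha> i j \<and> \<alpha> i j \<le> 1)
        \<and> (\<forall>i. \<alpha> i i = 1)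
        \<and> (\<forall>i j. i \<noteq> j \<and> {i, j} \<in> \<I> \<longrightarrow> \<alpha> i j = 0)
        \<and> (\<forall>i j. i \<noteq> j \<and> {i, j} \<notin> \<I> \<longrightarrow> \<alpha> i j > 0)
        \<and> (\<forall>J\<in>\<I>. submat J B \<in> maxcut J)
        \<and> (\<forall>J. J \<noteq> {} \<and> (\<exists>J'\<in>\<I>. J \<subset> J')
              \<longrightarrow> submat J B \<in> rel_interior (maxcut J))
        \<and> (\<forall>i j k. i \<noteq> j \<and> i \<noteq> k \<and> j \<noteq> k \<and> {i, j, k} \<in> \<I>
              \<longrightarrow> \<alpha> i j + \<alpha> i k + \<alpha> j k = 1)
        \<and> (\<forall>i j k. i \<noteq> j \<and> i \<noteq> k \<and> j \<noteq> k \<and> \<not> (\<exists>J\<in>\<I>. J \<subseteq> {i, j, k})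
              \<longrightarrow> \<alpha> i j + \<alpha> i k + \<alpha> j k > 1)
        \<and> (\<forall>i j k. i \<noteq> j \<and> i \<noteq> k \<and> j \<noteq> k \<and> {i, j} \<in> \<I>
              \<longrightarrow> \<alpha> i k + \<alpha> j k \<ge> 1)
        \<and> (\<forall>\<iota> :: nat \<Rightarrow> 'n. inj_on \<iota> {..<5} \<longrightarrow>
              (\<Sum>(a, b) \<in> {(a, b). a < b \<and> b < (5::nat)}. \<alpha> (\<iota> a) (\<iota> b)) \<ge> 4)"
    unfolding Let_def \<I>_def
  proof (intro exI[of _ \<alpha>] conjI allI ballI impI; (elim conjE bexE)?)
    fix i j
    show "\<alpha> i j = \<alpha> j i"
      using angle_sym[OF ang] by (simp add: \<alpha>_def)
    show "0 \<le> \<alpha> i j" "\<alpha> i j \<le> 1"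
      using bounds[of i j] by (auto simp: \<alpha>_def)
    show "\<alpha> i i = 1"
      using angle_self[OF ang] by (simp add: \<alpha>_def)
  next
    fix i j :: 'n assume "i \<noteq> j" "{i, j} \<in> min_supp_set A"
    then show "\<alpha> i j = 0"
      using zero_iff by (simp add: \<alpha>_def)
  next
    fix i j :: 'n assume "i \<noteq> j" "{i, j} \<notin> min_supp_set A"
    then have "angle A i j \<noteq> 0"
      using zero_iff by simp
    then show "0 < \<alpha> i j"
      using bounds(1)[of i j] by (simp add: \<alpha>_def)
  next
    fix J assume "J \<in> min_supp_set A"
    then show "submat J (\<chi> i j. 2 * \<alpha> i j - 1) \<in> maxcut J"
      unfolding \<alpha>_def by (rule minimal_support_in_maxcut[OF ang])
  next
    fix J J' assume "J' \<in> min_supp_set A" "J \<subset> J'"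
    then show "submat J (\<chi> i j. 2 * \<alpha> i j - 1) \<in> rel_interior (maxcut J)"
      unfolding \<alpha>_def by (rule proper_minimal_support_in_rel_interior_maxcut[OF ang])
  next
    fix i j k :: 'n assume "i \<noteq> j" "i \<noteq> k" "j \<noteq> k" "{i, j, k} \<in> min_supp_set A"
    then show "\<alpha> i j + \<alpha> i k + \<alpha> j k = 1"
      using angle_triple_eq[OF ang, of i j k] by (simp add: \<alpha>_def sum3)
  next
    fix i j k :: 'n assume "i \<noteq> j" "i \<noteq> k" "j \<noteq> k" "\<not> (\<exists>J\<in>min_supp_set A. J \<subseteq> {i, j, k})"
    then show "1 < \<alpha> i j + \<alpha> i k + \<alpha> j k"
      using angle_triple_gt[OF ang, of i j k] by (simp add: \<alpha>_def sum3)
  next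
    fix i j k :: 'n assume "i \<noteq> j" "{i, j} \<in> min_supp_set A"
    then show "1 \<le> \<alpha> i k + \<alpha> j k"
      using angle_pair_ge[OF ang, of i j k] by (simp add: \<alpha>_def add_divide_distrib[symmetric])
  next
    fix \<iota> :: "nat \<Rightarrow> 'n" assume "inj_on \<iota> {..<5}"
    then show "4 \<le> (\<Sum>(a, b) \<in> {(a, b). a < b \<and> b < (5::nat)}. \<alpha> (\<iota> a) (\<iota> b))"
      unfolding \<alpha>_def by (rule angle_pentagon[OF ang])
  qed
qed

end
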